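(* Consider the network, the optimization problem and the algorithm OptDist-VC (with scalar parameters $\alpha,\beta,\gamma,c>0$) described in the context. Then for any $c>0$, when $\alpha,\beta,\gamma$ are small enough in the following sense, the sequence of reactive power injections $\mathbf q(t)$ produced by OptDist-VC converges, as $t\to\infty$, to the unique optimizer of problem (P). Step size conditions: the ratio $\beta/\alpha=\eta$ is fixed to be any positive real number (so that the constants $a,\tau,\nu,\kappa(P_0),\kappa(P),C_2$ of the context are determined); then $$0<\alpha<\min\Big(\frac1\tau,\ \frac{\tau}{2\nu^2\kappa(P_0)}\Big),\qquad \beta=\eta\alpha,\qquad 0<\gamma<\min\Big(\frac{\mu}{2\|\tilde X\|^2},\ \frac{\|\tilde X\|^2(1-\rho)^2}{2\mu C_2^2}\Big),$$ where $\rho=e^{-\tau\alpha/2}+\frac{\alpha^2\nu^2\kappa(P_0)}{2}$ (which is $<1$ for such $\alpha$).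
   Context: **Network.** The network is a rooted tree with buses $\{0,1,\dots,n\}$, root $0$ (the substation), and a set $\mathcal E$ of lines directed away from the root; each line $(h,k)$ has reactance $x_{hk}>0$. $\mathcal P_i\subset\mathcal E$ is the set of lines on the unique path from $0$ to $i$. $X\in\mathbb R^{n\times n}$ is given by $[X]_{ij}=2\sum_{(h,k)\in\mathcal P_i\cap\mathcal P_j}x_{hk}$; it is symmetric positive definite, and $Y:=X^{-1}$. $\mathcal N_i$ denotes the set of neighbors of $i$ in the tree, including $i$ but excluding $0$; $[Y]_{ij}=0$ for $j\notin\mathcal N_i$. For a fixed vector $\mathbf v^{par}\in\mathbb R^n$, the voltage profile is $\mathbf v(\mathbf q)=X\mathbf q+\mathbf v^{par}$. **Problem (P).** Given $d\ge 0$, functions $f_i:\mathbb R\to\mathbb R$, and bounds $\underline v_i,\bar v_i$, $\underline q_i<\bar q_i$: $$\min_{\mathbf q\in\mathbb R^n} f(\mathbf q):=\sum_{i=1}^n f_i(q_i)+\frac d2\mathbf q^TX\mathbf q\quad\text{s.t.}\quad \underline v_i\le v_i(\mathbf q)\le\bar v_i,\ \ \underline q_i\le q_i\le\bar q_i,\ \ i=1,\dots,n.$$ Standing assumptions: (i) $f$ is differentiable, $\mu$-strongly convex and $l$-smooth with $0<\mu\le l$, i.e. $\mu\|\mathbf q-\mathbf q'\|^2\le\langle\mathbf q-\mathbf q',\nabla f(\mathbf q)-\nabla f(\mathbf q')\rangle\le l\|\mathbf q-\mathbf q'\|^2$ for all $\mathbf q,\mathbf q'\in\mathbb R^n$; (ii)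 there is $\hat{\mathbf q}^0$ with $\underline v_i<v_i(\hat{\mathbf q}^0)<\bar v_i$ and $\underline q_i\le\hat q_i^0\le\bar q_i$ for all $i$. **Algorithm OptDist-VC.** For $b_1<b_2$, $\mathrm{ST}_{b_1}^{b_2}(y)=\max(\min(y-b_1,0),y-b_2)$; $[\cdot]^+$ is projection onto the nonnegative reals, and $[\cdot]_{a}^{b}$ is projection onto the interval $[a,b]$. The variables are $\hat q_i(t),\xi_i(t)\in\mathbb R$, $\bar\lambda_i(t),\underline\lambda_i(t)\ge0$ (arbitrary such initial values at $t=0$), and $q_i(t)=[\hat q_i(t)]_{\underline q_i}^{\bar q_i}$. With measured voltage $v_i(t)=v_i(\mathbf q(t))$, for each $t\ge0$ and each $i$: $$\hat q_i(t+1)=\hat q_i(t)-\alpha\Big\{\bar\lambda_i(t)-\underline\lambda_i(t)+d\,\hat q_i(t)+\sum_{j\in\mathcal N_i}[Y]_{ij}\big[f_j'(\hat q_j(t))+\mathrm{ST}_{c\underline q_j}^{c\bar q_j}(\xi_j(t)+c\hat q_j(t))\big]\Big\},$$ $$\xi_i(t+1)=\xi_i(t)+\beta\,\frac{\mathrm{ST}_{c\underline q_i}^{c\bar q_i}(\xi_i(t)+c\hat q_i(t))-\xi_i(t)}{c},$$ $$\bar\lambda_i(t+1)=[\bar\lambda_i(t)+\gamma(v_i(t)-\bar v_i)]^+,\qquad \underline\lambda_i(t+1)=[\underline\lambda_i(t)+\gamma(\underline v_i-v_i(t))]^+,$$ $$q_i(t+1)=[\hat q_i(t+1)]_{\underline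 q_i}^{\bar q_i}.$$ **Constants.** $\|\cdot\|$ is the Euclidean/spectral norm; $\bar\sigma(\cdot),\underline\sigma(\cdot)$ are the largest and smallest eigenvalues, $\kappa(\cdot)$ the condition number. $\tilde X=[-X,X]^T\in\mathbb R^{2n\times n}$, $\mu'=\mu\,\underline\sigma(Y)$, $l'=l\,\bar\sigma(Y)$, $$a=20\,l'\Big[\max\Big(\tfrac{c\bar\sigma(Y)}{\mu'},\tfrac{l'}{\mu'}\Big)\Big]^2\Big[\max\Big(\tfrac{\beta}{\alpha l'c},\tfrac{l'}{\mu'}\Big)\Big]^2\kappa(Y),\qquad \tau=\frac{\beta}{2\alpha}\frac{\underline\sigma(Y)}{a},$$ $$\nu=\max\Big(\sqrt{2(l'+\bar\sigma(Y)c)^2+2\tfrac{\beta^2}{\alpha^2}\bar\sigma(Y)},\ \sqrt{2\bar\sigma(Y)+8\tfrac{\beta^2}{\alpha^2c^2}}\Big),$$ $$P_0=\begin{bmatrix}\frac\beta\alpha aI&\frac\beta\alpha Y^{1/2}\\ \frac\beta\alpha Y^{1/2}&aI\end{bmatrix},\quad P=\begin{bmatrix}\frac\beta\alpha aY^{-1}&\frac\beta\alpha I\\ \frac\beta\alpha I&aI\end{bmatrix},\quad C_2=\|\tilde X\|^2\sqrt{\kappa(P)}\sqrt{\frac{1+4l^2}{\mu^2}}.$$ *)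

theory Defs
  imports "HOL-Analysis.Analysis" "Graph_Theory.Arc_Walk"
begin

text \<open>
  Buses are elements of \<^typ>\<open>'n option\<close>: \<^term>\<open>None\<close> is the substation (bus 0) and
  \<^term>\<open>Some i\<close> are the remaining buses, which also index the vectors of type \<^typ>\<open>real^'n\<close>.
  A line is the ordered pair of its two end buses.
\<close>

definition line_digraph :: "('a \<times> 'a) set \<Rightarrow> ('a, 'a \<times> 'a) pre_digraph" where
  "line_digraph E = \<lparr>verts = UNIV, arcs = E, tail = fst, head = snd\<rparr>"

text \<open>
  A rooted tree on all buses with the lines directed away from the root: exactly one directed walk
  leads from the root to each bus. Uniqueness has to be required of walks and not merely of
  paths: on the lines (0,1), (1,2), (2,1) paths from 0 are unique, but this is not a tree.
\<close>

definition rooted_tree :: "'a \<Rightarrow> ('a \<times> 'a) set \<Rightarrow> bool" where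
  "rooted_tree r E \<longleftrightarrow> (\<forall>v. \<exists>!p. pre_digraph.awalk (line_digraph E) r p v)"

definition path_lines :: "('n option \<times> 'n option) set \<Rightarrow> 'n \<Rightarrow> ('n option \<times> 'n option) set" where
  "path_lines E i = set (THE p. pre_digraph.awalk (line_digraph E) None p (Some i))"

definition reactance_matrix ::
    "('n option \<times> 'n option) set \<Rightarrow> ('n option \<times> 'n option \<Rightarrow> real) \<Rightarrow> real^'n^'n" where
  "reactance_matrix E x = (\<chi> i j. 2 * (\<Sum>e\<in>path_lines E i \<inter> path_lines E j. x e))"

definition nbrs :: "('n option \<times> 'n option) set \<Rightarrow> 'n \<Rightarrow> 'n set" where
  "nbrs E i = insert i {j. (Some i, Some j) \<in> E \<or> (Some j, Some i) \<in> E}"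

definition ST :: "real \<Rightarrow> real \<Rightarrow> real \<Rightarrow> real" where
  "ST b1 b2 y = max (min (y - b1) 0) (y - b2)"

definition eigenvalues :: "real^'n^'n \<Rightarrow> real set" where
  "eigenvalues M = {k. \<exists>w. w \<noteq> 0 \<and> M *v w = k *\<^sub>R w}"

definition eig_max :: "real^'n^'n \<Rightarrow> real" where
  "eig_max M = Max (eigenvalues M)"

definition eig_min :: "real^'n^'n \<Rightarrow> real" where
  "eig_min M = Min (eigenvalues M)"

text \<open>On matrices, \<^const>\<open>norm\<close> is the Frobenius norm, so it cannot be used here.\<close>

definition spectral_norm :: "real^'n^'m \<Rightarrow> real" where
  "spectral_norm M = onorm (\<lambda>w. M *v w)"

definition cond_num :: "real^'n^'n \<Rightarrow> real" where
  "cond_num M = spectral_norm M * spectral_norm (matrix_inv M)"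

definition sqrt_matrix :: "real^'n^'n \<Rightarrow> real^'n^'n" where
  "sqrt_matrix M = (THE S. transpose S = S \<and> (\<forall>w. 0 \<le> w \<bullet> (S *v w)) \<and> S ** S = M)"

definition hblock :: "real^'n^'m \<Rightarrow> real^'k^'m \<Rightarrow> real^('n + 'k)^'m" where
  "hblock A B = (\<chi> i j. case j of Inl j' \<Rightarrow> A $ i $ j' | Inr j' \<Rightarrow> B $ i $ j')"

definition vblock :: "real^'n^'m \<Rightarrow> real^'n^'k \<Rightarrow> real^'n^('m + 'k)" where
  "vblock A B = (\<chi> i. case i of Inl i' \<Rightarrow> A $ i' | Inr i' \<Rightarrow> B $ i')"

definition X_tilde :: "real^'n^'n \<Rightarrow> real^'n^('n + 'n)" where
  "X_tilde X = transpose (hblock (- X) X)"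

text \<open>In the constants below, \<open>\<eta>\<close> stands for the ratio \<open>\<beta> / \<alpha>\<close>.\<close>

definition a_const :: "real \<Rightarrow> real \<Rightarrow> real \<Rightarrow> real \<Rightarrow> real^'n^'n \<Rightarrow> real" where
  "a_const \<mu> l c \<eta> Y =
     (let \<mu>' = \<mu> * eig_min Y; l' = l * eig_max Y
      in 20 * l' * (max (c * eig_max Y / \<mu>') (l' / \<mu>'))\<^sup>2
           * (max (\<eta> / (l' * c)) (l' / \<mu>'))\<^sup>2 * cond_num Y)"

definition tau_const :: "real \<Rightarrow> real \<Rightarrow> real \<Rightarrow> real \<Rightarrow> real^'n^'n \<Rightarrow> real" where
  "tau_const \<mu> l c \<eta> Y = \<eta> / 2 * (eig_min Y / a_const \<mu> l c \<eta> Y)"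

definition nu_const :: "real \<Rightarrow> real \<Rightarrow> real \<Rightarrow> real^'n^'n \<Rightarrow> real" where
  "nu_const l c \<eta> Y =
     (let l' = l * eig_max Y
      in max (sqrt (2 * (l' + eig_max Y * c)\<^sup>2 + 2 * \<eta>\<^sup>2 * eig_max Y))
             (sqrt (2 * eig_max Y + 8 * (\<eta>\<^sup>2 / c\<^sup>2))))"

definition P0_matrix :: "real \<Rightarrow> real \<Rightarrow> real^'n^'n \<Rightarrow> real^('n + 'n)^('n + 'n)" where
  "P0_matrix \<eta> a Y =
     vblock (hblock ((\<eta> * a) *\<^sub>R mat 1) (\<eta> *\<^sub>R sqrt_matrix Y))
            (hblock (\<eta> *\<^sub>R sqrt_matrix Y) (a *\<^sub>R mat 1))"

definition P_matrix :: "real \<Rightarrow> real \<Rightarrow> real^'n^'n \<Rightarrow> real^('n + 'n)^('n + 'n)" where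
  "P_matrix \<eta> a Y =
     vblock (hblock ((\<eta> * a) *\<^sub>R matrix_inv Y) (\<eta> *\<^sub>R mat 1))
            (hblock (\<eta> *\<^sub>R mat 1) (a *\<^sub>R mat 1))"

definition C2_const :: "real \<Rightarrow> real \<Rightarrow> real^'n^'n \<Rightarrow> real^('n + 'n)^('n + 'n) \<Rightarrow> real" where
  "C2_const \<mu> l X P =
     (spectral_norm (X_tilde X))\<^sup>2 * sqrt (cond_num P) * sqrt ((1 + 4 * l\<^sup>2) / \<mu>\<^sup>2)"

end

theory Submission
  imports Defs
begin

text \<open>
  Write \<open>\<theta> = (\<lambda>\<^sup>u, \<lambda>\<^sup>l)\<close> for the pair of multipliers of the upper and of the lower voltage bounds. The algorithm
  runs two loops at once, and the proof shows that their interaction is stable.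

  With \<open>\<theta>\<close> held fixed, the updates of \<open>q\<close> and \<open>\<xi>\<close> are an explicit Euler step for a preconditioned
  primal-dual gradient flow. Its equilibrium consists of the minimizer \<open>q\<^sup>*(\<theta>)\<close> of the Lagrangian over the
  box and the multiplier \<open>\<xi>\<^sup>*(\<theta>)\<close> of the box. The weighted energy, the quadratic form of the matrix \<open>P\<close>,
  decays along the flow at rate \<open>\<tau>\<close> (\<open>energy_dissipation\<close>), and one Euler step shrinks its square root by the
  factor \<open>\<rho>\<close> (\<open>energy_contraction\<close>). In suitable coordinates the same energy is the form of \<open>P0\<close>, which is
  how the condition number of \<open>P0\<close> comes into \<open>\<rho>\<close>.

  The updates of \<open>\<theta>\<close> are projected gradient ascent on the concave dual function, whose gradient at \<open>\<theta>\<close> is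
  the vector of constraint values at \<open>q\<^sup>*(\<theta>)\<close>. The algorithm uses the constraint values at \<open>q(t)\<close> instead. The size \<open>b\<close>
  of the resulting error is contracted by \<open>\<rho>\<close> in each step and raised by the movement of the equilibrium, by at
  most \<open>C2\<close> times the movement of \<open>\<theta>\<close>. Along such an inexact ascent the dual function minus a multiple of
  \<open>b\<^sup>2\<close> increases by at least the squares of the increments of \<open>\<theta>\<close>, up to a factor
  (\<open>ascent_with_tracking\<close>). The bounds on \<open>\<gamma>\<close> make this factor positive (\<open>gamma_small\<close>). As the
  dual function is bounded above, increments and errors tend to zero.

  The strictly feasible point makes superlevel sets of the dual function bounded, so \<open>\<theta>(t)\<close> has a limit
  point. Passing to the limit in the projection step shows that it satisfies the Karush-Kuhn-Tucker
  conditions, so its \<open>q\<^sup>*\<close> is the optimizer of the problem and there is no duality gap. The gap at \<open>\<theta>(t)\<close>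
  is controlled by increments and errors and thus vanishes, and strong convexity of the Lagrangian turns it into a bound on
  the distance of \<open>q\<^sup>*(\<theta>(t))\<close> from the optimizer (\<open>optdist_converges\<close>).

  The tree enters only through two properties of \<open>X\<close>: it is symmetric and positive definite, and its inverse vanishes off
  the neighbourhoods, so that the sums over neighbours in the algorithm are full products with \<open>Y\<close>.
\<close>

section \<open>Self-adjoint maps and positive definite matrices\<close>

text \<open>
  The quadratic \<open>t \<mapsto> (x + t y) \<bullet> g (x + t y)\<close> is nonnegative, since \<open>x + t y\<close> stays in the subspace. The
  relative version is what allows eigenvectors to be split off one after the other.
\<close>

lemma psd_Cauchy_Schwarz_on:
  fixes g :: "'a::real_inner \<Rightarrow> 'a"
  assumes lin: "linear g" and sym: "\<And>x y. g x \<bullet> y = x \<bullet> g y"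
    and U: "subspace U" and psd: "\<And>x. x \<in> U \<Longrightarrow> 0 \<le> x \<bullet> g x"
    and xy: "x \<in> U" "y \<in> U"
  shows "(x \<bullet> g y)\<^sup>2 \<le> (x \<bullet> g x) * (y \<bullet> g y)"
proof -
  have *: "0 \<le> x \<bullet> g x + 2 * t * (x \<bullet> g y) + t\<^sup>2 * (y \<bullet> g y)" for t :: real
  proof -
    have "x + t *\<^sub>R y \<in> U"
      using U xy by (simp add: subspace_add subspace_scale)
    from psd[OF this] have "0 \<le> (x + t *\<^sub>R y) \<bullet> g (x + t *\<^sub>R y)" .
    moreover have "y \<bullet> g x = x \<bullet> g y"
      by (metis sym inner_commute)
    ultimately show ?thesis
      by (simp add: linear_add[OF lin] linear_scale[OF lin] inner_add_left inner_add_right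
          power2_eq_square algebra_simps)
  qed
  show ?thesis
  proof (cases "y \<bullet> g y = 0")
    case True
    have "x \<bullet> g y = 0"
    proof (rule ccontr)
      assume ne: "x \<bullet> g y \<noteq> 0"
      show False
        using *[of "- (x \<bullet> g x + 1) / (2 * (x \<bullet> g y))"] True ne by (simp add: field_simps)
    qed
    then show ?thesis using True by simp
  next
    case False
    then have pos: "y \<bullet> g y > 0" using psd[OF xy(2)] by simp
    have "0 \<le> x \<bullet> g x - (x \<bullet> g y)\<^sup>2 / (y \<bullet> g y)"
      using *[of "- (x \<bullet> g y) / (y \<bullet> g y)"] pos
      by (simp add: power2_eq_square field_simps)
    then show ?thesis using pos by (simp add: field_simps)
  qed
qed

lemma psd_Cauchy_Schwarz:
  fixes g :: "'a::real_inner \<Rightarrow> 'a"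
  assumes "linear g" "\<And>x y. g x \<bullet> y = x \<bullet> g y" "\<And>x. 0 \<le> x \<bullet> g x"
  shows "(x \<bullet> g y)\<^sup>2 \<le> (x \<bullet> g x) * (y \<bullet> g y)"
  by (rule psd_Cauchy_Schwarz_on[where U = UNIV]) (use assms in auto)

text \<open>
  If \<open>u\<close> maximizes the Rayleigh quotient over \<open>U\<close> with value \<open>k\<close>, the map \<open>k - g\<close> is positive
  semidefinite on \<open>U\<close> and its form vanishes at \<open>u\<close>; by Cauchy-Schwarz it annihilates \<open>u\<close>.
\<close>

lemma selfadjoint_max_eigenvector:
  fixes g :: "'a::euclidean_space \<Rightarrow> 'a"
  assumes lin: "linear g" and sym: "\<And>x y. g x \<bullet> y = x \<bullet> g y"
    and U: "subspace U" and inv: "\<And>x. x \<in> U \<Longrightarrow> g x \<in> U" and ne: "\<exists>x\<in>U. x \<noteq> 0"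
  obtains u k where "u \<in> U" "norm u = 1" "g u = k *\<^sub>R u" "\<And>x. x \<in> U \<Longrightarrow> x \<bullet> g x \<le> k * (norm x)\<^sup>2"
proof -
  let ?S = "sphere 0 1 \<inter> U"
  obtain x0 where x0: "x0 \<in> U" "x0 \<noteq> 0" using ne by blast
  have mem: "x0 /\<^sub>R norm x0 \<in> ?S"
    using x0 U by (simp add: subspace_scale)
  then have S: "compact ?S" "?S \<noteq> {}"
    using U by (blast intro: compact_Int_closed closed_subspace compact_sphere)+
  have "continuous_on ?S (\<lambda>x. x \<bullet> g x)"
    using linear_continuous_on[OF linear_conv_bounded_linear[THEN iffD1, OF lin]]
    by (intro continuous_on_inner continuous_on_id)
  from continuous_attains_sup[OF S this] obtain u
    where u: "u \<in> ?S" and max: "\<And>y. y \<in> ?S \<Longrightarrow> y \<bullet> g y \<le> u \<bullet> g u" by blast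
  define k where "k = u \<bullet> g u"
  have bound: "x \<bullet> g x \<le> k * (norm x)\<^sup>2" if "x \<in> U" for x
  proof (cases "x = 0")
    case False
    have "x /\<^sub>R norm x \<in> ?S" using False that U by (simp add: subspace_scale)
    from max[OF this] have "(x \<bullet> g x) / (norm x)\<^sup>2 \<le> k"
      by (simp add: k_def linear_scale[OF lin] power2_eq_square field_simps)
    then show ?thesis using False by (simp add: field_simps)
  qed (simp add: linear_0[OF lin])
  define h where "h = (\<lambda>x. k *\<^sub>R x - g x)"
  have hU: "h u \<in> U" using u inv U by (auto simp: h_def intro!: subspace_diff subspace_scale)
  have "(h u \<bullet> h u)\<^sup>2 \<le> (h u \<bullet> h (h u)) * (u \<bullet> h u)"
  proof (rule psd_Cauchy_Schwarz_on[OF _ _ U])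
    show "linear h"
      unfolding h_def by (intro linear_compose_sub linear_compose_scale_right linear_ident lin)
    show "h x \<bullet> y = x \<bullet> h y" for x y
      by (simp add: h_def inner_diff_left inner_diff_right sym)
    show "0 \<le> x \<bullet> h x" if "x \<in> U" for x
      using bound[OF that] by (simp add: h_def inner_diff_right power2_norm_eq_inner)
  qed (use u hU in auto)
  moreover have "u \<bullet> h u = 0"
    using u by (simp add: h_def inner_diff_right k_def flip: power2_norm_eq_inner)
  ultimately have "h u = 0" by simp
  then have "g u = k *\<^sub>R u" by (simp add: h_def)
  with that u bound show thesis by auto
qed

lemma selfadjoint_eigenvectors_orthogonal:
  assumes sym: "\<And>x y. g x \<bullet> y = x \<bullet> g y" and "g u = k *\<^sub>R u" "g w = m *\<^sub>R w" "k \<noteq> m"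
  shows "u \<bullet> w = 0"
  using sym[of u w] assms(2-) by simp

text \<open>
  An orthonormal set of eigenvectors of maximal size spans the space: its orthogonal complement is
  invariant, and an eigenvector in there would enlarge the set.
\<close>

theorem selfadjoint_orthonormal_eigenbasis:
  fixes g :: "'a::euclidean_space \<Rightarrow> 'a"
  assumes lin: "linear g" and sym: "\<And>x y. g x \<bullet> y = x \<bullet> g y"
  obtains B k where "finite B" "\<And>b c. b \<in> B \<Longrightarrow> c \<in> B \<Longrightarrow> b \<bullet> c = (if b = c then 1 else 0)"
    "\<And>b. b \<in> B \<Longrightarrow> g b = k b *\<^sub>R b" "\<And>x. x = (\<Sum>b\<in>B. (b \<bullet> x) *\<^sub>R b)"
proof -
  \<comment> \<open>orthonormal sets of eigenvectors; their size is at most the dimension\<close>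
  define ok where "ok B \<longleftrightarrow> pairwise orthogonal B \<and> (\<forall>b\<in>B. norm b = 1 \<and> (\<exists>k. g b = k *\<^sub>R b))"
    for B :: "'a set"
  have ok_fin: "finite B" "card B \<le> DIM('a)" if "ok B" for B
  proof -
    have "independent B"
      using that unfolding ok_def by (intro pairwise_orthogonal_independent) auto
    then show "finite B" "card B \<le> DIM('a)"
      using independent_bound by blast+
  qed
  have "ok {}" by (simp add: ok_def)
  then obtain B where B: "ok B" and B_max: "\<And>C. ok C \<Longrightarrow> card C \<le> card B"
    using ex_has_greatest_nat[of ok "{}" card "Suc (DIM('a))"] ok_fin(2) by (auto simp: less_Suc_eq_le)
  define k where "k b = (SOME k. g b = k *\<^sub>R b)" for b
  have k: "g b = k b *\<^sub>R b" if "b \<in> B" for b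
    unfolding k_def by (rule someI_ex) (use B that ok_def in blast)
  have on: "b \<bullet> c = (if b = c then 1 else 0)" if "b \<in> B" "c \<in> B" for b c
    using B that by (auto simp: ok_def pairwise_def orthogonal_def norm_eq_1)
  have fin: "finite B" using ok_fin B by blast
  define U where "U = {x. \<forall>b\<in>B. b \<bullet> x = 0}"
  have U: "subspace U"
    by (auto simp: U_def subspace_def inner_add_right)
  have zero: "x = 0" if "x \<in> U" for x
  proof (rule ccontr)
    assume "x \<noteq> 0"
    have inv: "g y \<in> U" if "y \<in> U" for y
    proof -
      have "b \<bullet> g y = 0" if "b \<in> B" for b
        using \<open>y \<in> U\<close> that sym[of b y] by (simp add: k U_def)
      then show ?thesis by (simp add: U_def)
    qed
    obtain u m where u: "u \<in> U" "norm u = 1" "g u = m *\<^sub>R u"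
      by (rule selfadjoint_max_eigenvector[OF lin sym U inv])
        (use \<open>x \<noteq> 0\<close> \<open>x \<in> U\<close> in auto)
    have "u \<notin> B" using u on by (auto simp: U_def norm_eq_1)
    have "ok (insert u B)"
      using B u unfolding ok_def U_def pairwise_insert orthogonal_def by (simp add: inner_commute)
    from B_max[OF this] show False using \<open>u \<notin> B\<close> fin by simp
  qed
  have exp: "x = (\<Sum>b\<in>B. (b \<bullet> x) *\<^sub>R b)" for x
  proof -
    have "x - (\<Sum>b\<in>B. (b \<bullet> x) *\<^sub>R b) \<in> U"
    proof -
      have "c \<bullet> (\<Sum>b\<in>B. (b \<bullet> x) *\<^sub>R b) = c \<bullet> x" if "c \<in> B" for c
      proof -
        have "c \<bullet> (\<Sum>b\<in>B. (b \<bullet> x) *\<^sub>R b) = (\<Sum>b\<in>B. if b = c then b \<bullet> x else 0)"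
          unfolding inner_sum_right by (rule sum.cong) (auto simp: on that)
        then show ?thesis using that fin by simp
      qed
      then show ?thesis by (simp add: U_def inner_diff_right)
    qed
    then show ?thesis using zero by fastforce
  qed
  from that[OF fin on k exp] show thesis by blast
qed

lemma symmetric_matrix_inner:
  fixes A :: "real^'n^'n"
  assumes "transpose A = A"
  shows "(A *v x) \<bullet> y = x \<bullet> (A *v y)"
  by (metis assms dot_lmul_matrix transpose_matrix_vector)

lemma symmetric_matrixI:
  fixes A :: "real^'n^'n"
  assumes "\<And>x y. (A *v x) \<bullet> y = x \<bullet> (A *v y)"
  shows "transpose A = A"
proof -
  have "transpose A *v y = A *v y" for y
  proof -
    have "(transpose A *v y) \<bullet> x = (A *v y) \<bullet> x" for x
      by (metis assms dot_lmul_matrix transpose_matrix_vector inner_commute)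
    then show ?thesis by (metis vector_eq_rdot)
  qed
  then show ?thesis by (simp add: matrix_eq)
qed

subsection \<open>Extreme eigenvalues\<close>

text \<open>
  Without finiteness, the maximum and the minimum that define the extreme eigenvalues would be
  unspecified.
\<close>

lemma finite_eigenvalues:
  fixes A :: "real^'n^'n"
  assumes A: "transpose A = A"
  shows "finite (eigenvalues A)"
proof -
  define w where "w k = (SOME w. w \<noteq> 0 \<and> A *v w = k *\<^sub>R w)" for k
  have w: "w k \<noteq> 0 \<and> A *v w k = k *\<^sub>R w k" if "k \<in> eigenvalues A" for k
    unfolding w_def by (rule someI_ex) (use that eigenvalues_def in blast)
  have orth: "w k \<bullet> w m = 0" if "k \<in> eigenvalues A" "m \<in> eigenvalues A" "k \<noteq> m" for k m
    by (rule selfadjoint_eigenvectors_orthogonal[where g = "(*v) A"])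
      (use that w symmetric_matrix_inner[OF A] in auto)
  have "inj_on w (eigenvalues A)"
    by (rule inj_onI) (metis orth w inner_eq_zero_iff)
  moreover have "independent (w ` eigenvalues A)"
    using w orth by (intro pairwise_orthogonal_independent) (auto simp: pairwise_def orthogonal_def)
  then have "finite (w ` eigenvalues A)"
    using independent_bound by blast
  ultimately show ?thesis using finite_imageD by blast
qed

lemma
  fixes A :: "real^'n^'n"
  assumes A: "transpose A = A"
  shows eig_max_bound: "x \<bullet> (A *v x) \<le> eig_max A * (norm x)\<^sup>2"
    and eig_min_bound: "eig_min A * (norm x)\<^sup>2 \<le> x \<bullet> (A *v x)"
    and eig_min_in: "eig_min A \<in> eigenvalues A"
proof -
  note fin = finite_eigenvalues[OF A]
  have ne: "\<exists>x\<in>UNIV. x \<noteq> (0::real^'n)" by (rule bexI[of _ "axis undefined 1"]) (auto simp: axis_eq_0_iff)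
  obtain u k where u: "norm u = 1" "A *v u = k *\<^sub>R u" and k: "\<And>x. x \<bullet> (A *v x) \<le> k * (norm x)\<^sup>2"
    by (rule selfadjoint_max_eigenvector[OF matrix_vector_mul_linear[of A] _ subspace_UNIV _ ne])
      (auto simp: symmetric_matrix_inner[OF A])
  have "k \<in> eigenvalues A" unfolding eigenvalues_def using u by (intro CollectI exI[of _ u]) auto
  then have "k \<le> eig_max A" unfolding eig_max_def using fin by simp
  then show "x \<bullet> (A *v x) \<le> eig_max A * (norm x)\<^sup>2"
    using k[of x] by (meson mult_right_mono order_trans zero_le_power2)
  have lin: "linear (\<lambda>x. - (A *v x))"
    by (intro linear_compose_neg matrix_vector_mul_linear)
  obtain u k where u: "norm u = 1" "- (A *v u) = k *\<^sub>R u"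
    and k: "\<And>x. x \<bullet> - (A *v x) \<le> k * (norm x)\<^sup>2"
    by (rule selfadjoint_max_eigenvector[OF lin _ subspace_UNIV _ ne])
      (auto simp: symmetric_matrix_inner[OF A])
  have "A *v u = (- k) *\<^sub>R u" using u(2) by (metis minus_equation_iff scaleR_minus_left)
  then have in_ev: "- k \<in> eigenvalues A" unfolding eigenvalues_def using u by (intro CollectI exI[of _ u]) auto
  then have "eig_min A \<le> - k" unfolding eig_min_def using fin by simp
  then show "eig_min A * (norm x)\<^sup>2 \<le> x \<bullet> (A *v x)"
    using k[of x] mult_right_mono[of "eig_min A" "-k" "(norm x)\<^sup>2"] by simp
  show "eig_min A \<in> eigenvalues A"
    unfolding eig_min_def using fin in_ev by (metis Min_in emptyE)
qed

lemma
  fixes A :: "real^'n^'n"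
  assumes A: "transpose A = A" and pos: "\<And>x. x \<noteq> 0 \<Longrightarrow> 0 < x \<bullet> (A *v x)"
  shows eig_min_pos: "0 < eig_min A" and eig_min_le_max: "eig_min A \<le> eig_max A"
proof -
  obtain w where w: "w \<noteq> 0" "A *v w = eig_min A *\<^sub>R w"
    using eig_min_in[OF A] unfolding eigenvalues_def by blast
  show "0 < eig_min A"
    using pos[OF w(1)] w by (simp add: zero_less_mult_iff not_le) (meson inner_ge_zero not_less)
  show "eig_min A \<le> eig_max A"
    using eig_max_bound[OF A, of w] eig_min_bound[OF A, of w] w(1)
    by (meson mult_le_cancel_right_pos order_trans zero_less_norm_iff zero_less_power)
qed

subsection \<open>The positive square root\<close>

text \<open>
  On an eigenvector \<open>b\<close> of \<open>S\<close> with value \<open>k\<close>, the equation \<open>T\<^sup>2 b = k\<^sup>2 b\<close> reads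
  \<open>(T + k) (T - k) b = 0\<close>, and \<open>T + k\<close> is injective if \<open>k > 0\<close>. So \<open>T\<close> acts on an eigenbasis of \<open>S\<close> as \<open>S\<close> does.
\<close>

lemma psd_square_root_unique:
  fixes S T :: "real^'n^'n"
  assumes S: "transpose S = S" "\<And>w. 0 \<le> w \<bullet> (S *v w)"
    and T: "transpose T = T" "\<And>w. 0 \<le> w \<bullet> (T *v w)"
    and eq: "S ** S = T ** T"
  shows "S = T"
proof -
  obtain B k where B: "finite B" "\<And>b c. b \<in> B \<Longrightarrow> c \<in> B \<Longrightarrow> b \<bullet> c = (if b = c then 1 else 0)"
    "\<And>b. b \<in> B \<Longrightarrow> S *v b = k b *\<^sub>R b" and exp: "\<And>x. x = (\<Sum>b\<in>B. (b \<bullet> x) *\<^sub>R b)"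
    by (rule selfadjoint_orthonormal_eigenbasis[OF matrix_vector_mul_linear symmetric_matrix_inner[OF S(1)]])
      blast
  have Tb: "T *v b = k b *\<^sub>R b" if b: "b \<in> B" for b
  proof -
    have k0: "0 \<le> k b" using S(2)[of b] B(2)[OF b b] B(3)[OF b] by simp
    have TT: "T *v (T *v b) = (k b * k b) *\<^sub>R b"
      by (simp add: matrix_vector_mul_assoc flip: eq)
        (simp add: B(3)[OF b] flip: matrix_vector_mul_assoc
           add: matrix_vector_mult_scaleR)
    show ?thesis
    proof (cases "k b = 0")
      case True
      then have "(T *v b) \<bullet> (T *v b) = 0"
        using TT by (simp add: symmetric_matrix_inner[OF T(1)])
      then show ?thesis using True by simp
    next
      case False
      define w where "w = T *v b - k b *\<^sub>R b"
      have "T *v w + k b *\<^sub>R w = 0"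
        by (simp add: w_def TT matrix_vector_mult_diff_distrib matrix_vector_mult_scaleR algebra_simps)
      then have "w \<bullet> (T *v w) + k b * (w \<bullet> w) = 0"
        by (metis inner_add_right inner_scaleR_right inner_zero_right)
      then have "k b * (w \<bullet> w) \<le> 0" using T(2)[of w] by simp
      then have "w = 0" using False k0 by (simp add: mult_le_0_iff)
          (metis inner_eq_zero_iff inner_ge_zero order_antisym)
      then show ?thesis by (simp add: w_def)
    qed
  qed
  have "S *v x = T *v x" for x
    by (subst (1 2) exp[of x])
      (simp add: linear_sum[OF matrix_vector_mul_linear] matrix_vector_mult_scaleR B(3) Tb)
  then show ?thesis by (simp add: matrix_eq)
qed

text \<open>
  The root takes square roots of the eigenvalues in an orthonormal eigenbasis.
\<close>

lemma psd_square_root_exists: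
  fixes M :: "real^'n^'n"
  assumes M: "transpose M = M" "\<And>w. 0 \<le> w \<bullet> (M *v w)"
  shows "\<exists>S. transpose S = S \<and> (\<forall>w. 0 \<le> w \<bullet> (S *v w)) \<and> S ** S = M"
proof -
  obtain B k where fin: "finite B" and on: "\<And>b c. b \<in> B \<Longrightarrow> c \<in> B \<Longrightarrow> b \<bullet> c = (if b = c then 1 else 0)"
    and k: "\<And>b. b \<in> B \<Longrightarrow> M *v b = k b *\<^sub>R b" and exp: "\<And>x. x = (\<Sum>b\<in>B. (b \<bullet> x) *\<^sub>R b)"
    by (rule selfadjoint_orthonormal_eigenbasis[OF matrix_vector_mul_linear symmetric_matrix_inner[OF M(1)]])
      blast
  have k0: "0 \<le> k b" if b: "b \<in> B" for b
    using M(2)[of b] on[OF b b] k[OF b] by simp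
  define s where "s x = (\<Sum>b\<in>B. (sqrt (k b) * (b \<bullet> x)) *\<^sub>R b)" for x
  have lin: "linear s"
    by (rule linearI) (auto simp: s_def inner_add_right scaleR_add_left distrib_left sum.distrib
        scaleR_sum_right mult.left_commute intro!: sum.cong)
  have Sv: "matrix s *v x = s x" for x
    using matrix_works[of s x] lin linear_matrix_vector_mul_eq by blast
  have sb: "c \<bullet> s x = sqrt (k c) * (c \<bullet> x)" if "c \<in> B" for c x
  proof -
    have "c \<bullet> s x = (\<Sum>b\<in>B. if b = c then sqrt (k c) * (c \<bullet> x) else 0)"
      unfolding s_def inner_sum_right by (rule sum.cong) (auto simp: on that)
    then show ?thesis using that fin by simp
  qed
  have "transpose (matrix s) = matrix s"
    by (rule symmetric_matrixI)
      (auto simp: Sv s_def inner_sum_left inner_sum_right inner_commute intro!: sum.cong)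
  moreover have "0 \<le> w \<bullet> (matrix s *v w)" for w
  proof -
    have "w \<bullet> s w = (\<Sum>b\<in>B. sqrt (k b) * (b \<bullet> w)\<^sup>2)"
      by (simp add: s_def inner_sum_right inner_commute[of w] power2_eq_square mult.assoc)
    then show ?thesis by (simp add: Sv k0 sum_nonneg)
  qed
  moreover have "matrix s ** matrix s = M"
  proof -
    have "s (s x) = M *v x" for x
    proof -
      have "s (s x) = (\<Sum>b\<in>B. (k b * (b \<bullet> x)) *\<^sub>R b)"
        unfolding s_def[of "s x"] by (rule sum.cong) (auto simp: sb k0 simp flip: mult.assoc)
      also have "\<dots> = M *v (\<Sum>b\<in>B. (b \<bullet> x) *\<^sub>R b)"
        by (simp add: linear_sum[OF matrix_vector_mul_linear] matrix_vector_mult_scaleR k mult.commute)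
      finally show ?thesis using exp[of x] by simp
    qed
    then show ?thesis by (simp add: matrix_eq Sv flip: matrix_vector_mul_assoc)
  qed
  ultimately show ?thesis by blast
qed

lemma
  fixes M :: "real^'n^'n"
  assumes M: "transpose M = M" "\<And>w. 0 \<le> w \<bullet> (M *v w)"
  shows transpose_sqrt_matrix: "transpose (sqrt_matrix M) = sqrt_matrix M"
    and sqrt_matrix_square: "sqrt_matrix M ** sqrt_matrix M = M"
proof -
  have "\<exists>!S. transpose S = S \<and> (\<forall>w. 0 \<le> w \<bullet> (S *v w)) \<and> S ** S = M"
    using psd_square_root_exists[OF M] psd_square_root_unique by (metis (no_types, lifting))
  from theI'[OF this] show "transpose (sqrt_matrix M) = sqrt_matrix M"
    "sqrt_matrix M ** sqrt_matrix M = M"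
    unfolding sqrt_matrix_def by blast+
qed

subsection \<open>Spectral norms and condition numbers\<close>

lemma
  fixes A :: "real^'n^'m"
  shows spectral_norm_bound: "norm (A *v x) \<le> spectral_norm A * norm x"
    and spectral_norm_nonneg: "0 \<le> spectral_norm A"
  unfolding spectral_norm_def
  by (rule onorm onorm_pos_le, rule matrix_vector_mul_bounded_linear)+

lemma posdef_invertible:
  fixes A :: "real^'n^'n"
  assumes "\<And>x. x \<noteq> 0 \<Longrightarrow> 0 < x \<bullet> (A *v x)"
  shows "A ** matrix_inv A = mat 1" "matrix_inv A ** A = mat 1"
proof -
  have "A *v x = 0 \<Longrightarrow> x = 0" for x
    using assms[of x] by force
  then have "invertible A"
    using matrix_left_invertible_ker invertible_left_inverse by metis
  then have "A ** matrix_inv A = mat 1 \<and> matrix_inv A ** A = mat 1"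
    unfolding invertible_def matrix_inv_def by (rule someI_ex)
  then show "A ** matrix_inv A = mat 1" "matrix_inv A ** A = mat 1" by auto
qed

lemma form_le_spectral_norm:
  fixes A :: "real^'n^'n"
  shows "x \<bullet> (A *v x) \<le> spectral_norm A * (norm x)\<^sup>2"
  using norm_cauchy_schwarz[of x "A *v x"] mult_left_mono[OF spectral_norm_bound[of A x] norm_ge_zero[of x]]
  by (simp add: power2_eq_square algebra_simps)

text \<open>
  Apply Cauchy-Schwarz for the form of \<open>A\<close> to \<open>x\<close> and \<open>A\<^sup>-\<^sup>1 x\<close>.
\<close>

lemma posdef_form_ge_inverse_norm:
  fixes A :: "real^'n^'n"
  assumes A: "transpose A = A" and pos: "\<And>x. x \<noteq> 0 \<Longrightarrow> 0 < x \<bullet> (A *v x)"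
  shows "(norm x)\<^sup>2 \<le> spectral_norm (matrix_inv A) * (x \<bullet> (A *v x))"
proof (cases "x = 0")
  case False
  let ?y = "matrix_inv A *v x"
  have nn: "0 \<le> z \<bullet> (A *v z)" for z using pos[of z] by (cases "z = 0") auto
  have Ay: "A *v ?y = x"
    by (simp add: matrix_vector_mul_assoc posdef_invertible[OF pos])
  have "((norm x)\<^sup>2)\<^sup>2 = (x \<bullet> (A *v ?y))\<^sup>2"
    by (simp add: Ay power2_norm_eq_inner)
  also have "\<dots> \<le> (x \<bullet> (A *v x)) * (?y \<bullet> (A *v ?y))"
    by (rule psd_Cauchy_Schwarz) (use nn symmetric_matrix_inner[OF A] in auto)
  also have "\<dots> \<le> (x \<bullet> (A *v x)) * (spectral_norm (matrix_inv A) * (norm x)\<^sup>2)"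
    using form_le_spectral_norm[of x "matrix_inv A"] nn by (intro mult_left_mono) (auto simp: Ay inner_commute)
  finally have "(norm x)\<^sup>2 * (norm x)\<^sup>2
      \<le> (spectral_norm (matrix_inv A) * (x \<bullet> (A *v x))) * (norm x)\<^sup>2"
    by (simp add: power2_eq_square algebra_simps)
  then show ?thesis using False by (metis mult_right_le_imp_le zero_less_norm_iff zero_less_power)
qed simp

lemma posdef_cond_num_ge_1:
  fixes A :: "real^'n^'n"
  assumes pos: "\<And>x. x \<noteq> 0 \<Longrightarrow> 0 < x \<bullet> (A *v x)"
  shows "1 \<le> cond_num A"
proof -
  let ?x = "axis undefined 1 :: real^'n"
  have "norm ?x = norm (A *v (matrix_inv A *v ?x))"
    by (simp add: matrix_vector_mul_assoc posdef_invertible[OF pos])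
  also have "\<dots> \<le> spectral_norm A * (spectral_norm (matrix_inv A) * norm ?x)"
    by (meson spectral_norm_bound spectral_norm_nonneg mult_left_mono order_trans)
  finally show ?thesis by (simp add: cond_num_def)
qed

lemma psd_sqrt_form_triangle:
  fixes A :: "real^'n^'n"
  assumes A: "transpose A = A" and psd: "\<And>x. 0 \<le> x \<bullet> (A *v x)"
  shows "sqrt ((x + y) \<bullet> (A *v (x + y))) \<le> sqrt (x \<bullet> (A *v x)) + sqrt (y \<bullet> (A *v y))"
proof (rule real_le_lsqrt)
  have "(x \<bullet> (A *v y))\<^sup>2 \<le> (x \<bullet> (A *v x)) * (y \<bullet> (A *v y))"
    by (rule psd_Cauchy_Schwarz) (use psd symmetric_matrix_inner[OF A] in auto)
  then have "x \<bullet> (A *v y) \<le> sqrt (x \<bullet> (A *v x)) * sqrt (y \<bullet> (A *v y))"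
    by (metis real_le_rsqrt real_sqrt_mult)
  moreover have "y \<bullet> (A *v x) = x \<bullet> (A *v y)"
    by (metis symmetric_matrix_inner[OF A] inner_commute)
  ultimately show "(x + y) \<bullet> (A *v (x + y)) \<le> (sqrt (x \<bullet> (A *v x)) + sqrt (y \<bullet> (A *v y)))\<^sup>2"
    using psd by (simp add: matrix_vector_right_distrib inner_add_left inner_add_right power2_sum)
qed (use psd in auto)

section \<open>The reactance matrix of a rooted tree\<close>

abbreviation walk :: "('a \<times> 'a) set \<Rightarrow> 'a \<Rightarrow> ('a \<times> 'a) list \<Rightarrow> 'a \<Rightarrow> bool" where
  "walk E u p v \<equiv> pre_digraph.awalk (line_digraph E) u p v"

lemma walk_Nil: "walk E u [] v \<longleftrightarrow> u = v"
  by (simp add: pre_digraph.awalk_def pre_digraph.cas.simps line_digraph_def)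

lemma walk_Cons: "walk E u (e # p) v \<longleftrightarrow> e \<in> E \<and> fst e = u \<and> walk E (snd e) p v"
  by (auto simp: pre_digraph.awalk_def pre_digraph.cas.simps line_digraph_def)

lemma walk_append: "walk E u (p @ p') v \<longleftrightarrow> (\<exists>w. walk E u p w \<and> walk E w p' v)"
  by (induction p arbitrary: u) (auto simp: walk_Nil walk_Cons)

lemma rooted_tree_walk_unique:
  "rooted_tree r E \<Longrightarrow> walk E r p v \<Longrightarrow> walk E r p' v \<Longrightarrow> p = p'"
  unfolding rooted_tree_def by blast

text \<open>
  Every line into \<open>v\<close> ends some walk from the root to \<open>v\<close>, namely the walk to its tail followed by
  the line itself, and this walk is unique.
\<close>

lemma rooted_tree_parent:
  assumes tree: "rooted_tree r E" and v: "v \<noteq> r"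
  shows "\<exists>!e. e \<in> E \<and> snd e = v"
proof -
  obtain p where p: "walk E r p v" using tree unfolding rooted_tree_def by blast
  have "p \<noteq> []" using p v by (auto simp: walk_Nil)
  then obtain p0 e where pe: "p = p0 @ [e]" by (metis append_butlast_last_id)
  have e: "e \<in> E \<and> snd e = v" using p by (auto simp: pe walk_append walk_Cons walk_Nil)
  moreover have "e' = e" if e': "e' \<in> E \<and> snd e' = v" for e'
  proof -
    obtain p' where "walk E r p' (fst e')" using tree unfolding rooted_tree_def by blast
    then have "walk E r (p' @ [e']) v" using e' by (auto simp: walk_append walk_Cons walk_Nil)
    from rooted_tree_walk_unique[OF tree p this] pe show ?thesis by simp
  qed
  ultimately show ?thesis by blast
qed

definition parent_line :: "('n option \<times> 'n option) set \<Rightarrow> 'n \<Rightarrow> 'n option \<times> 'n option" where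
  "parent_line E i = (THE e. e \<in> E \<and> snd e = Some i)"

lemma
  assumes tree: "rooted_tree None E"
  shows parent_line_in: "parent_line E i \<in> E"
    and snd_parent_line: "snd (parent_line E i) = Some i"
    and parent_line_eqI: "e \<in> E \<Longrightarrow> snd e = Some i \<Longrightarrow> e = parent_line E i"
  using theI'[OF rooted_tree_parent[OF tree, of "Some i"]] rooted_tree_parent[OF tree, of "Some i"]
  unfolding parent_line_def by auto

lemma inj_parent_line: "rooted_tree None E \<Longrightarrow> inj (parent_line E)"
  by (metis injI option.inject snd_parent_line)

lemma path_lines_eqI:
  "rooted_tree None E \<Longrightarrow> walk E None p (Some i) \<Longrightarrow> path_lines E i = set p"
  unfolding path_lines_def using rooted_tree_walk_unique by (metis the_equality)

text \<open>
  Each line is the parent line of its head; the root cannot be a head, since the empty walk is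
  the only one that returns to the root. Hence buses can replace lines as summation indices.
\<close>

lemma path_lines_subset_parent_lines:
  assumes tree: "rooted_tree None E"
  shows "path_lines E i \<subseteq> range (parent_line E)"
proof -
  have *: "walk E u p v \<Longrightarrow> set p \<subseteq> E" for u v p
    by (induction p arbitrary: u) (auto simp: walk_Cons)
  have root: "e = parent_line E k" if "e \<in> E" "snd e = Some k" for e k
    using parent_line_eqI[OF tree that] .
  have no_root: "snd e \<noteq> None" if "e \<in> E" for e
  proof
    assume "snd e = None"
    obtain p where "walk E None p (fst e)" using tree unfolding rooted_tree_def by blast
    then have "walk E None (p @ [e]) None"
      using that \<open>snd e = None\<close> by (auto simp: walk_append walk_Cons walk_Nil)
    moreover have "walk E None [] None" by (simp add: walk_Nil)
    ultimately show False using rooted_tree_walk_unique[OF tree] by blast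
  qed
  obtain p where p: "walk E None p (Some i)" using tree unfolding rooted_tree_def by blast
  show ?thesis
  proof
    fix e assume "e \<in> path_lines E i"
    then have "e \<in> E" using *[OF p] path_lines_eqI[OF tree p] by blast
    then show "e \<in> range (parent_line E)" using no_root[of e] root[of e] by (cases "snd e") auto
  qed
qed

text \<open>
  The line into \<open>k\<close> lies on the path to \<open>i\<close> exactly when \<open>i = k\<close> or it lies on the path to the
  parent of \<open>i\<close>, and these alternatives exclude each other. Subtracting from each row of the
  incidence matrix of lines and paths the row of the parent therefore leaves the identity.
\<close>

lemma path_lines_parent:
  assumes tree: "rooted_tree None E"
  shows "of_bool (parent_line E k \<in> path_lines E i)
       - (case fst (parent_line E i) of None \<Rightarrow> 0 | Some h \<Rightarrow> of_bool (parent_line E k \<in> path_lines E h))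
       = (of_bool (i = k) :: real)"
proof -
  let ?e = "parent_line E i"
  obtain p where p: "walk E None p (fst ?e)" using tree unfolding rooted_tree_def by blast
  have pe: "walk E None (p @ [?e]) (Some i)"
    using p parent_line_in[OF tree] snd_parent_line[OF tree] by (auto simp: walk_append walk_Cons walk_Nil)
  have notin: "?e \<notin> set p"
  proof
    assume "?e \<in> set p"
    then obtain p1 p2 where sp: "p = p1 @ ?e # p2" by (meson split_list)
    then have "walk E None (p1 @ [?e]) (Some i)"
      using p snd_parent_line[OF tree] by (auto simp: walk_append walk_Cons walk_Nil)
    from rooted_tree_walk_unique[OF tree this pe] sp show False by simp
  qed
  have lines_i: "path_lines E i = insert ?e (set p)"
    using path_lines_eqI[OF tree pe] by simp
  have k_eq: "parent_line E k = ?e \<longleftrightarrow> i = k"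
    using inj_parent_line[OF tree] by (auto dest: injD)
  show ?thesis
  proof (cases "fst ?e")
    case None
    then have "p = []"
      using p rooted_tree_walk_unique[OF tree, of p None "[]"] by (simp add: walk_Nil)
    then show ?thesis using None by (simp add: lines_i k_eq)
  next
    case (Some h)
    then have "path_lines E h = set p" using p by (intro path_lines_eqI[OF tree]) simp
    then show ?thesis using Some notin by (auto simp: lines_i k_eq)
  qed
qed

definition incidence :: "('n option \<times> 'n option) set \<Rightarrow> real^'n^'n" where
  "incidence E = (\<chi> i k. of_bool (parent_line E k \<in> path_lines E i))"

definition parent_difference :: "('n::finite option \<times> 'n option) set \<Rightarrow> real^'n^'n" where
  "parent_difference E = (\<chi> i k. of_bool (i = k) - of_bool (fst (parent_line E i) = Some k))"

lemma parent_difference_incidence: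
  assumes tree: "rooted_tree None (E :: ('n::finite option \<times> 'n option) set)"
  shows "parent_difference E ** incidence E = mat 1"
    and "incidence E ** parent_difference E = mat 1"
proof -
  have "(\<Sum>j\<in>UNIV. (of_bool (i = j) - of_bool (fst (parent_line E i) = Some j)) *
          of_bool (parent_line E k \<in> path_lines E j)) = (of_bool (i = k) :: real)" for i k
  proof -
    have "(\<Sum>j\<in>UNIV. (of_bool (i = j) - of_bool (fst (parent_line E i) = Some j)) *
          of_bool (parent_line E k \<in> path_lines E j)) =
      (\<Sum>j\<in>UNIV. if i = j then of_bool (parent_line E k \<in> path_lines E j) else 0)
      - (\<Sum>j\<in>UNIV. if fst (parent_line E i) = Some j then of_bool (parent_line E k \<in> path_lines E j) else (0::real))"
      unfolding sum_subtractf[symmetric] by (rule sum.cong) (auto simp: of_bool_def)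
    also have "(\<Sum>j\<in>UNIV. if fst (parent_line E i) = Some j then of_bool (parent_line E k \<in> path_lines E j) else (0::real))
      = (case fst (parent_line E i) of None \<Rightarrow> 0 | Some h \<Rightarrow> of_bool (parent_line E k \<in> path_lines E h))"
      by (cases "fst (parent_line E i)") (simp_all)
    finally show ?thesis using path_lines_parent[OF tree, of k i] by simp
  qed
  then show *: "parent_difference E ** incidence E = mat 1"
    by (simp add: parent_difference_def incidence_def matrix_matrix_mult_def mat_def vec_eq_iff)
  show "incidence E ** parent_difference E = mat 1"
    using * matrix_left_right_inverse by blast
qed

text \<open>
  In matrix form: \<open>X = 2 R D R\<^sup>T\<close> with the incidence matrix \<open>R\<close> and the diagonal matrix \<open>D\<close> of
  reactances.
\<close>

lemma reactance_matrix_entry: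
  fixes E :: "('n::finite option \<times> 'n option) set"
  assumes tree: "rooted_tree None E"
  shows "reactance_matrix E x $ i $ j
    = 2 * (\<Sum>k\<in>UNIV. x (parent_line E k) * incidence E $ i $ k * incidence E $ j $ k)"
proof -
  have "(\<Sum>e\<in>path_lines E i \<inter> path_lines E j. x e)
      = (\<Sum>e\<in>range (parent_line E). if e \<in> path_lines E i \<inter> path_lines E j then x e else 0)"
    by (rule sum.mono_neutral_cong_left) (use path_lines_subset_parent_lines[OF tree] in auto)
  also have "\<dots> = (\<Sum>k\<in>UNIV. x (parent_line E k) * incidence E $ i $ k * incidence E $ j $ k)"
    using inj_parent_line[OF tree]
    by (subst sum.reindex, simp) (rule sum.cong, auto simp: incidence_def of_bool_def)
  finally show ?thesis by (simp add: reactance_matrix_def)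
qed

lemma transpose_reactance_matrix:
  "transpose (reactance_matrix E x) = reactance_matrix E x"
  by (simp add: reactance_matrix_def transpose_def vec_eq_iff Int_commute)

lemma reactance_matrix_form:
  fixes E :: "('n::finite option \<times> 'n option) set"
  assumes tree: "rooted_tree None E"
  shows "w \<bullet> (reactance_matrix E x *v w)
    = 2 * (\<Sum>k\<in>UNIV. x (parent_line E k) * ((transpose (incidence E) *v w) $ k)\<^sup>2)"
proof -
  have "w \<bullet> (reactance_matrix E x *v w) = (\<Sum>i\<in>UNIV. \<Sum>j\<in>UNIV. \<Sum>k\<in>UNIV.
      2 * (x (parent_line E k) * (incidence E $ i $ k * w $ i) * (incidence E $ j $ k * w $ j)))"
    by (simp add: inner_vec_def matrix_vector_mult_def reactance_matrix_entry[OF tree]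
        sum_distrib_left sum_distrib_right mult_ac)
  also have "\<dots> = (\<Sum>i\<in>UNIV. \<Sum>k\<in>UNIV. \<Sum>j\<in>UNIV.
      2 * (x (parent_line E k) * (incidence E $ i $ k * w $ i) * (incidence E $ j $ k * w $ j)))"
    by (intro sum.cong refl sum.swap)
  also have "\<dots> = (\<Sum>k\<in>UNIV. \<Sum>i\<in>UNIV. \<Sum>j\<in>UNIV.
      2 * (x (parent_line E k) * (incidence E $ i $ k * w $ i) * (incidence E $ j $ k * w $ j)))"
    by (rule sum.swap)
  also have "\<dots> = 2 * (\<Sum>k\<in>UNIV. x (parent_line E k) * ((transpose (incidence E) *v w) $ k)\<^sup>2)"
    by (simp add: matrix_vector_mult_def transpose_def power2_eq_square sum_distrib_left
        sum_distrib_right mult_ac)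
  finally show ?thesis .
qed

lemma reactance_matrix_pos_def:
  fixes E :: "('n::finite option \<times> 'n option) set"
  assumes tree: "rooted_tree None E" and x: "\<And>e. e \<in> E \<Longrightarrow> x e > 0" and w: "w \<noteq> 0"
  shows "0 < w \<bullet> (reactance_matrix E x *v w)"
proof -
  let ?y = "transpose (incidence E) *v w"
  have "transpose (parent_difference E) *v ?y = w"
    by (simp only: matrix_vector_mul_assoc matrix_transpose_mul[symmetric]
        parent_difference_incidence(2)[OF tree] transpose_mat matrix_vector_mul_lid)
  then have "?y \<noteq> 0" using w by auto
  then obtain k where "?y $ k \<noteq> 0" by (auto simp: vec_eq_iff)
  moreover have "0 < x (parent_line E k)" for k using x parent_line_in[OF tree] by blast
  ultimately have "0 < (\<Sum>k\<in>UNIV. x (parent_line E k) * (?y $ k)\<^sup>2)"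
    by (intro sum_pos2[of _ k]) (auto simp: less_imp_le)
  then show ?thesis by (simp add: reactance_matrix_form[OF tree])
qed

text \<open>
  With \<open>R\<close> the incidence matrix and \<open>B = R\<^sup>-\<^sup>1\<close> the parent differences,
  \<open>X = 2 R D R\<^sup>T\<close> gives \<open>X\<^sup>-\<^sup>1 = B\<^sup>T D\<^sup>-\<^sup>1 B / 2\<close>. Column \<open>i\<close> of \<open>B\<close> is supported on \<open>i\<close> and the children
  of \<open>i\<close>, and the supports of two columns meet only if one bus is the parent of the other.
\<close>

lemma inverse_reactance_matrix_sparse:
  fixes E :: "('n::finite option \<times> 'n option) set"
  assumes tree: "rooted_tree None E" and x: "\<And>e. e \<in> E \<Longrightarrow> x e > 0"
    and Y: "Y ** reactance_matrix E x = mat 1" and j: "j \<notin> nbrs E i"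
  shows "Y $ i $ j = 0"
proof -
  let ?X = "reactance_matrix E x"
  let ?B = "parent_difference E"
  define D :: "real^'n^'n" where "D = (\<chi> k m. if k = m then 2 * x (parent_line E k) else 0)"
  define D' :: "real^'n^'n" where "D' = (\<chi> k m. if k = m then 1 / (2 * x (parent_line E k)) else 0)"
  have pos: "x (parent_line E k) \<noteq> 0" for k using x parent_line_in[OF tree] by (metis less_irrefl)
  have DD: "D ** D' = mat 1"
    using pos by (auto simp: D_def D'_def matrix_matrix_mult_def mat_def vec_eq_iff
        if_distrib[of "\<lambda>z. z * _"] if_distrib[of "\<lambda>z. _ * z"] cong: if_cong)
  have X: "?X = incidence E ** D ** transpose (incidence E)"
    by (auto simp: vec_eq_iff matrix_matrix_mult_def transpose_def D_def reactance_matrix_entry[OF tree]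
        sum_distrib_left mult_ac if_distrib[of "\<lambda>z. _ * z"] cong: if_cong intro!: sum.cong)
  have TT: "transpose (incidence E) ** transpose ?B = mat 1"
    using parent_difference_incidence(1)[OF tree] by (simp flip: matrix_transpose_mul)
  have "?X ** (transpose ?B ** D' ** ?B) = incidence E ** (D ** (transpose (incidence E) ** transpose ?B) ** D') ** ?B"
    by (simp add: X matrix_mul_assoc)
  also have "\<dots> = mat 1"
    by (simp add: TT DD parent_difference_incidence[OF tree])
  finally have "Y = transpose ?B ** D' ** ?B"
    using Y by (metis matrix_mul_assoc matrix_mul_lid matrix_mul_rid)
  moreover have "(transpose ?B ** D' ** ?B) $ i $ j = (\<Sum>k\<in>UNIV. ?B $ k $ i * (1 / (2 * x (parent_line E k))) * ?B $ k $ j)"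
    by (simp add: matrix_matrix_mult_def transpose_def D'_def if_distrib[of "\<lambda>z. _ * z"] cong: if_cong)
  moreover have "?B $ k $ i * (1 / (2 * x (parent_line E k))) * ?B $ k $ j = 0" for k
  proof (rule ccontr)
    assume "\<not> ?thesis"
    then have ne: "?B $ k $ i \<noteq> 0" "?B $ k $ j \<noteq> 0" by auto
    have supp: "m = k \<or> (Some m, Some k) \<in> E" if "?B $ k $ m \<noteq> 0" for m
      using that parent_line_in[OF tree, of k] snd_parent_line[OF tree, of k]
      by (cases "parent_line E k") (auto simp: parent_difference_def of_bool_def split: if_splits)
    have same: "i = j" if "(Some i, Some k) \<in> E" "(Some j, Some k) \<in> E"
      using parent_line_eqI[OF tree that(1)] parent_line_eqI[OF tree that(2)] by simp
    show False using supp[OF ne(1)] supp[OF ne(2)] same j by (auto simp: nbrs_def)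
  qed
  ultimately show ?thesis by (simp only: sum.neutral_const)
qed

section \<open>Strongly convex functions with Lipschitz gradient\<close>

lemma gderiv_line:
  assumes "GDERIV f (z + t *\<^sub>R h) :> D"
  shows "((\<lambda>t. f (z + t *\<^sub>R h)) has_real_derivative (h \<bullet> D)) (at t)"
proof -
  have "((\<lambda>t. z + t *\<^sub>R h) has_derivative (\<lambda>s. s *\<^sub>R h)) (at t)"
    by (auto intro!: derivative_eq_intros)
  from has_derivative_compose[OF this] assms
  have "((\<lambda>t. f (z + t *\<^sub>R h)) has_derivative (\<lambda>s. (s *\<^sub>R h) \<bullet> D)) (at t)"
    unfolding gderiv_def by blast
  then show ?thesis
    unfolding has_field_derivative_def by (rule has_derivative_eq_rhs) (auto simp: mult.commute)
qed

text \<open>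
  Along the segment from \<open>z\<close> to \<open>z'\<close>, the function minus its quadratic model has nonpositive
  derivative. A negative \<open>L\<close> is allowed; this gives the lower bound for strongly convex functions.
\<close>

lemma gradient_quadratic_upper_bound:
  assumes grad: "\<And>z. GDERIV f z :> g z"
    and bound: "\<And>z z'. (z - z') \<bullet> (g z - g z') \<le> L * (norm (z - z'))\<^sup>2"
  shows "f z' \<le> f z + g z \<bullet> (z' - z) + L / 2 * (norm (z' - z))\<^sup>2"
proof -
  define h where "h = z' - z"
  define \<psi> where "\<psi> t = f (z + t *\<^sub>R h) - t * (g z \<bullet> h) - L / 2 * t\<^sup>2 * (norm h)\<^sup>2" for t
  have deriv: "(\<psi> has_real_derivative (h \<bullet> g (z + t *\<^sub>R h) - g z \<bullet> h - L * t * (norm h)\<^sup>2)) (at t)" for t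
    unfolding \<psi>_def by (auto intro!: derivative_eq_intros gderiv_line grad)
  have le: "h \<bullet> g (z + t *\<^sub>R h) - g z \<bullet> h - L * t * (norm h)\<^sup>2 \<le> 0" if "0 \<le> t" for t
  proof (cases "t = 0")
    case False
    have "t * (h \<bullet> (g (z + t *\<^sub>R h) - g z)) \<le> t * (L * t * (norm h)\<^sup>2)"
      using bound[of "z + t *\<^sub>R h" z] that by (simp add: power_mult_distrib power2_eq_square mult.left_commute mult.assoc)
    then have "h \<bullet> (g (z + t *\<^sub>R h) - g z) \<le> L * t * (norm h)\<^sup>2"
      using False that by (simp add: mult_le_cancel_left)
    then show ?thesis by (simp add: inner_diff_right inner_commute)
  qed (simp add: inner_commute)
  have "\<psi> 1 \<le> \<psi> 0"
  proof (rule DERIV_nonpos_imp_nonincreasing[where f = \<psi>])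
    show "\<exists>y. (\<psi> has_real_derivative y) (at t) \<and> y \<le> 0" if "0 \<le> t" "t \<le> 1" for t
      using deriv[of t] le[OF that(1)] by blast
  qed simp
  then show ?thesis by (simp add: \<psi>_def h_def)
qed

lemma gradient_quadratic_lower_bound:
  assumes grad: "\<And>z. GDERIV f z :> g z"
    and bound: "\<And>z z'. m * (norm (z - z'))\<^sup>2 \<le> (z - z') \<bullet> (g z - g z')"
  shows "f z + g z \<bullet> (z' - z) + m / 2 * (norm (z' - z))\<^sup>2 \<le> f z'"
proof -
  have "- f z' \<le> - f z + (- g z) \<bullet> (z' - z) + (- m) / 2 * (norm (z' - z))\<^sup>2"
  proof (rule gradient_quadratic_upper_bound)
    show "GDERIV (\<lambda>z. - f z) z :> - g z" for z by (rule GDERIV_minus[OF grad])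
    show "(z - z') \<bullet> (- g z - - g z') \<le> - m * (norm (z - z'))\<^sup>2" for z z'
      using bound[of z z'] by (simp add: inner_diff_right)
  qed
  then show ?thesis by simp
qed

text \<open>
  Evaluate the tangent at \<open>w\<close> and the quadratic majorant at \<open>z\<close> in the point that a gradient step of
  length \<open>1 / L\<close> from \<open>z\<close> reaches for the function tilted to have its minimum at \<open>w\<close>, and symmetrize.
\<close>

lemma gradient_cocoercive:
  assumes grad: "\<And>z. GDERIV f z :> g z"
    and mono: "\<And>z z'. 0 \<le> (z - z') \<bullet> (g z - g z')"
    and bound: "\<And>z z'. (z - z') \<bullet> (g z - g z') \<le> L * (norm (z - z'))\<^sup>2" and L: "0 < L"
  shows "(norm (g z - g w))\<^sup>2 \<le> L * ((z - w) \<bullet> (g z - g w))"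
proof -
  have *: "f w + g w \<bullet> (z - w) + (norm (g z - g w))\<^sup>2 / (2 * L) \<le> f z" for z w
  proof -
    define d where "d = g z - g w"
    define y where "y = z - (1 / L) *\<^sub>R d"
    have "f y \<le> f z + g z \<bullet> (y - z) + L / 2 * (norm (y - z))\<^sup>2"
      by (rule gradient_quadratic_upper_bound[OF grad bound])
    moreover have "f w + g w \<bullet> (y - w) \<le> f y"
      using gradient_quadratic_lower_bound[OF grad, of 0 w y] mono by simp
    moreover have "L / 2 * (norm (y - z))\<^sup>2 = (norm d)\<^sup>2 / (2 * L)"
      using L by (simp add: y_def power2_eq_square field_simps)
    moreover have "g z \<bullet> (y - z) = - ((g z \<bullet> d) / L)"
      "g w \<bullet> (y - w) = g w \<bullet> (z - w) - (g w \<bullet> d) / L"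
      by (simp_all add: y_def inner_diff_right)
    moreover have "2 * ((norm d)\<^sup>2 / (2 * L)) = (g z \<bullet> d) / L - (g w \<bullet> d) / L"
      by (simp add: d_def power2_norm_eq_inner inner_diff_left diff_divide_distrib)
    ultimately show ?thesis unfolding d_def[symmetric] by linarith
  qed
  have "(norm (g z - g w))\<^sup>2 / L \<le> (z - w) \<bullet> (g z - g w)"
    using *[of w z] *[of z w]
    by (simp add: norm_minus_commute[of "g w"] inner_diff_left inner_diff_right inner_commute)
  then show ?thesis using L by (simp add: field_simps)
qed

lemma minimizer_variational_inequality:
  assumes grad: "GDERIV f q :> D" and S: "convex S" "q \<in> S" "z \<in> S"
    and min: "\<And>y. y \<in> S \<Longrightarrow> f q \<le> f y"
  shows "0 \<le> D \<bullet> (z - q)"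
proof (rule ccontr)
  assume "\<not> 0 \<le> D \<bullet> (z - q)"
  then have neg: "(z - q) \<bullet> D < 0" by (simp add: inner_commute)
  have "((\<lambda>t. f (q + t *\<^sub>R (z - q))) has_real_derivative ((z - q) \<bullet> D)) (at 0)"
    by (rule gderiv_line) (simp add: grad)
  from DERIV_neg_dec_right[OF this neg] obtain e where e: "e > 0"
    and dec: "\<And>h. 0 < h \<Longrightarrow> h < e \<Longrightarrow> f (q + h *\<^sub>R (z - q)) < f q" by auto
  define h where "h = min (e / 2) 1"
  have h: "0 < h" "h < e" "h \<le> 1" using e by (auto simp: h_def min_def)
  have "q + h *\<^sub>R (z - q) = (1 - h) *\<^sub>R q + h *\<^sub>R z" by (simp add: algebra_simps)
  then have "q + h *\<^sub>R (z - q) \<in> S" using S h by (simp add: convex_alt)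
  from min[OF this] dec[OF h(1,2)] show False by simp
qed

text \<open>
  The summands \<open>f j\<close> inherit differentiability from \<open>obj\<close>, because all other terms are polynomial
  or constant along the \<open>j\<close>-th coordinate direction.
\<close>

lemma separable_quadratic_partial_derivative:
  fixes f :: "'n::finite \<Rightarrow> real \<Rightarrow> real" and M :: "real^'n^'n"
  assumes obj: "\<And>z. obj z = (\<Sum>i\<in>UNIV. f i (z $ i)) + d / 2 * (z \<bullet> (M *v z))"
    and M: "\<And>x y. (M *v x) \<bullet> y = x \<bullet> (M *v y)"
    and grad: "GDERIV obj z :> D"
  shows "deriv (f j) (z $ j) = D $ j - d * (M *v z) $ j"
proof -
  define h :: "real^'n" where "h = axis j 1"
  define C where "C = (\<Sum>i\<in>UNIV - {j}. f i (z $ i)) + d / 2 * (z \<bullet> (M *v z))"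
  have obj_line: "f j (t + z $ j) = obj (z + t *\<^sub>R h) - C - d * t * (h \<bullet> (M *v z)) - d / 2 * t\<^sup>2 * (h \<bullet> (M *v h))" for t
  proof -
    have "z \<bullet> (M *v h) = h \<bullet> (M *v z)" by (metis M inner_commute)
    then have "(z + t *\<^sub>R h) \<bullet> (M *v (z + t *\<^sub>R h))
        = z \<bullet> (M *v z) + 2 * t * (h \<bullet> (M *v z)) + t\<^sup>2 * (h \<bullet> (M *v h))"
      by (simp add: matrix_vector_right_distrib matrix_vector_mult_scaleR inner_add_left
          inner_add_right power2_eq_square algebra_simps)
    moreover have "(\<Sum>i\<in>UNIV. f i ((z + t *\<^sub>R h) $ i)) = f j (t + z $ j) + (\<Sum>i\<in>UNIV - {j}. f i (z $ i))"
      by (subst sum.remove[of _ j]) (auto simp: h_def axis_def add.commute intro!: sum.cong)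
    ultimately show ?thesis by (simp add: obj C_def algebra_simps)
  qed
  have "((\<lambda>t. obj (z + t *\<^sub>R h)) has_real_derivative (h \<bullet> D)) (at 0)"
    by (rule gderiv_line) (simp add: grad)
  then have "((\<lambda>t. f j (t + z $ j)) has_real_derivative (h \<bullet> D - d * (h \<bullet> (M *v z)))) (at 0)"
    unfolding obj_line by (auto intro!: derivative_eq_intros)
  then have "(f j has_real_derivative (h \<bullet> D - d * (h \<bullet> (M *v z)))) (at (0 + z $ j))"
    by (simp only: DERIV_shift)
  then show ?thesis
    using DERIV_imp_deriv by (simp add: h_def inner_axis')
qed

section \<open>Contraction of the primal-dual step\<close>

subsection \<open>Two by two block matrices\<close>

definition stack :: "real^'n \<Rightarrow> real^'m \<Rightarrow> real^('n + 'm)" where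
  "stack x y = (\<chi> i. case i of Inl j \<Rightarrow> x $ j | Inr j \<Rightarrow> y $ j)"

text \<open>
  Block matrices are indexed by a sum type; the next lemmas reduce them to the two blocks.
\<close>

lemma sum_UNIV_sum_type:
  "(\<Sum>i\<in>(UNIV :: ('n::finite + 'm::finite) set). h i) = (\<Sum>i\<in>UNIV. h (Inl i)) + (\<Sum>i\<in>UNIV. h (Inr i))"
  unfolding UNIV_Plus_UNIV[symmetric] by (subst sum.Plus) auto

lemma inner_stack: "stack x y \<bullet> stack x' y' = x \<bullet> x' + y \<bullet> y'"
  by (simp add: inner_vec_def sum_UNIV_sum_type stack_def)

lemma norm_stack: "(norm (stack x y))\<^sup>2 = (norm x)\<^sup>2 + (norm y)\<^sup>2"
  by (simp add: power2_norm_eq_inner inner_stack)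

lemma stack_add: "stack x y + stack x' y' = stack (x + x') (y + y')"
  by (simp add: stack_def vec_eq_iff split: sum.split)

lemma stack_cases:
  obtains x y where "z = stack x y"
proof
  show "z = stack (\<chi> i. z $ Inl i) (\<chi> i. z $ Inr i)"
    by (simp add: stack_def vec_eq_iff split: sum.split)
qed

lemma stack_eq_0: "stack x y = 0 \<longleftrightarrow> x = 0 \<and> y = 0"
  by (auto simp: stack_def vec_eq_iff split: sum.split)

lemma block_mult_stack:
  "vblock (hblock A B) (hblock C D) *v stack x y = stack (A *v x + B *v y) (C *v x + D *v y)"
  by (simp add: vec_eq_iff matrix_vector_mult_def sum_UNIV_sum_type stack_def vblock_def hblock_def
      split: sum.split)

lemma transpose_block:
  "transpose (vblock (hblock A B) (hblock C D))
    = vblock (hblock (transpose A) (transpose C)) (hblock (transpose B) (transpose D))"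
  by (simp add: vec_eq_iff transpose_def vblock_def hblock_def split: sum.split)

text \<open>
  Up to a sign, \<open>X_tilde X\<close> maps \<open>w\<close> to two copies of \<open>X w\<close> on top of each other.
\<close>

lemma X_tilde_norm:
  "2 * (norm (X *v w))\<^sup>2 \<le> (spectral_norm (X_tilde X))\<^sup>2 * (norm w)\<^sup>2" if "transpose X = X"
proof -
  have X: "X $ i $ j = X $ j $ i" for i j
    using that by (metis (no_types) transpose_def vec_lambda_beta)
  have "X_tilde X *v w = stack (- (X *v w)) (X *v w)"
    by (simp add: X_tilde_def vec_eq_iff matrix_vector_mult_def stack_def hblock_def transpose_def
        X sum_negf split: sum.split)
  then have "2 * (norm (X *v w))\<^sup>2 = (norm (X_tilde X *v w))\<^sup>2"
    by (simp add: norm_stack)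
  also have "\<dots> \<le> (spectral_norm (X_tilde X) * norm w)\<^sup>2"
    by (intro power_mono spectral_norm_bound) simp
  finally show ?thesis by (simp add: power_mult_distrib)
qed

subsection \<open>The weighted energy\<close>

locale grid_dynamics =
  fixes X Y :: "real^'n^'n" and \<mu> l c \<eta> a :: real
  assumes X_sym: "transpose X = X" and X_pos: "\<And>w. w \<noteq> 0 \<Longrightarrow> 0 < w \<bullet> (X *v w)"
    and Y_eq: "Y = matrix_inv X"
    and mu_l: "0 < \<mu>" "\<mu> \<le> l" and c_pos: "0 < c" and eta_pos: "0 < \<eta>"
    and a_eq: "a = a_const \<mu> l c \<eta> Y"
begin

lemma XY: "X ** Y = mat 1" and YX: "Y ** X = mat 1"
  using posdef_invertible[OF X_pos] Y_eq by auto

lemma XY_vec: "X *v (Y *v w) = w" and YX_vec: "Y *v (X *v w) = w"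
  by (simp_all add: matrix_vector_mul_assoc XY YX)

lemmas X_inner = symmetric_matrix_inner[OF X_sym]

lemma Y_inner: "(Y *v w) \<bullet> z = w \<bullet> (Y *v z)"
  by (metis X_inner XY_vec)

lemma Y_sym: "transpose Y = Y"
  by (rule symmetric_matrixI) (rule Y_inner)

lemma Y_pos: "w \<noteq> 0 \<Longrightarrow> 0 < w \<bullet> (Y *v w)"
  using X_pos[of "Y *v w"] XY_vec[of w] by (metis inner_commute matrix_vector_mult_0_right)

lemma X_nonneg: "0 \<le> w \<bullet> (X *v w)"
  using X_pos[of w] by (cases "w = 0") auto

lemma Y_nonneg: "0 \<le> w \<bullet> (Y *v w)"
  using Y_pos[of w] by (cases "w = 0") auto

lemma matrix_inv_Y: "matrix_inv Y = X"
  using posdef_invertible[OF Y_pos] XY by (metis matrix_mul_assoc matrix_mul_lid matrix_mul_rid)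

abbreviation \<sigma> :: real where "\<sigma> \<equiv> eig_min Y"
abbreviation S :: real where "S \<equiv> eig_max Y"

lemma sigma_pos: "0 < \<sigma>" and sigma_le_S: "\<sigma> \<le> S"
  using eig_min_pos[OF Y_sym Y_pos] eig_min_le_max[OF Y_sym Y_pos] by auto

lemma S_pos: "0 < S" using sigma_pos sigma_le_S by linarith

lemma l_pos: "0 < l" using mu_l by linarith

lemma Y_le: "w \<bullet> (Y *v w) \<le> S * (norm w)\<^sup>2" and Y_ge: "\<sigma> * (norm w)\<^sup>2 \<le> w \<bullet> (Y *v w)"
  by (rule eig_max_bound[OF Y_sym] eig_min_bound[OF Y_sym])+

lemma norm_le_X_form: "(norm w)\<^sup>2 \<le> S * (w \<bullet> (X *v w))"
proof (cases "w = 0")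
  case False
  have "((norm w)\<^sup>2)\<^sup>2 = (w \<bullet> (X *v (Y *v w)))\<^sup>2"
    by (simp add: XY_vec power2_norm_eq_inner)
  also have "\<dots> \<le> (w \<bullet> (X *v w)) * ((Y *v w) \<bullet> (X *v (Y *v w)))"
    by (rule psd_Cauchy_Schwarz[OF matrix_vector_mul_linear X_inner X_nonneg])
  also have "\<dots> \<le> (w \<bullet> (X *v w)) * (S * (norm w)\<^sup>2)"
    using Y_le[of w] by (intro mult_left_mono X_nonneg) (simp add: XY_vec inner_commute)
  finally have "(norm w)\<^sup>2 * (norm w)\<^sup>2 \<le> (S * (w \<bullet> (X *v w))) * (norm w)\<^sup>2"
    by (simp add: power2_eq_square algebra_simps)
  then show ?thesis using False by (metis mult_right_le_imp_le zero_less_norm_iff zero_less_power)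
qed simp

lemma X_form_le: "\<sigma> * (w \<bullet> (X *v w)) \<le> (norm w)\<^sup>2"
proof -
  define r where "r = X *v w"
  have w: "w = Y *v r" by (simp add: r_def YX_vec)
  have "\<sigma> * (norm r)\<^sup>2 \<le> norm r * norm w"
    using Y_ge[of r] norm_cauchy_schwarz[of r w] w by simp
  then have r: "\<sigma> * norm r \<le> norm w"
    by (cases "r = 0") (auto simp: power2_eq_square mult.left_commute[of _ "norm r"])
  have "\<sigma> * (w \<bullet> r) \<le> \<sigma> * (norm w * norm r)"
    using sigma_pos norm_cauchy_schwarz[of w r] by simp
  also have "\<dots> \<le> norm w * norm w"
    using mult_left_mono[OF r norm_ge_zero[of w]] by (simp add: mult_ac)
  finally show ?thesis by (simp add: r_def power2_eq_square)
qed

text \<open>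
  The definition of \<open>a\<close> enters the proof only through these lower bounds. They
  hold because both maxima in \<open>a\<close> are at least one, the first dominates \<open>c S / (\<mu> \<sigma>)\<close>, and the second dominates
  \<open>\<eta> / (l S c)\<close>.
\<close>

lemma
  shows a_pos: "0 < a"
    and a_ge_cS: "20 * (c * S) \<le> a"
    and a_ge_lS: "20 * (l * S) \<le> a"
    and a_ge_eta: "20 * \<eta> \<le> a * \<mu>"
    and a_square_ge: "400 * \<eta>\<^sup>2 \<le> a\<^sup>2 * \<mu> * c"
    and a_square_ge_S: "400 * (\<eta> * S) \<le> a\<^sup>2"
proof -
  define L where "L = l * S"
  define R where "R = L / (\<mu> * \<sigma>)"
  define M1 where "M1 = max (c * S / (\<mu> * \<sigma>)) R"
  define M2 where "M2 = max (\<eta> / (L * c)) R"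
  have L: "0 < L" using l_pos S_pos by (simp add: L_def)
  have ms: "0 < \<mu> * \<sigma>" using mu_l sigma_pos by simp
  have "\<mu> * \<sigma> \<le> L" using mu_l sigma_pos sigma_le_S unfolding L_def by (intro mult_mono) auto
  then have R: "1 \<le> R" using ms by (simp add: R_def)
  have M: "1 \<le> M1" "1 \<le> M2" using R by (auto simp: M1_def M2_def)
  have a_form: "a = 20 * L * M1\<^sup>2 * M2\<^sup>2 * cond_num Y"
    by (simp add: a_eq a_const_def Let_def L_def M1_def M2_def R_def)
  have pos: "0 < L * (M1\<^sup>2 * M2\<^sup>2)" using M L by simp
  have "20 * (L * (M1\<^sup>2 * M2\<^sup>2)) * 1 \<le> 20 * (L * (M1\<^sup>2 * M2\<^sup>2)) * cond_num Y"
    using posdef_cond_num_ge_1[OF Y_pos] pos by (intro mult_left_mono) auto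
  then have a_ge: "20 * (L * (M1\<^sup>2 * M2\<^sup>2)) \<le> a" by (simp add: a_form mult_ac)
  show a0: "0 < a" using a_ge pos by linarith
  have sq: "M1 \<le> M1\<^sup>2" "M2 \<le> M2\<^sup>2" "1 \<le> M1\<^sup>2" "1 \<le> M2\<^sup>2"
    using M by (auto simp: self_le_power)
  have bound: "20 * (L * (x * y)) \<le> a" if "0 \<le> x" "x \<le> M1\<^sup>2" "0 \<le> y" "y \<le> M2\<^sup>2" for x y
  proof -
    have "x * y \<le> M1\<^sup>2 * M2\<^sup>2" using that by (intro mult_mono) auto
    then have "20 * (L * (x * y)) \<le> 20 * (L * (M1\<^sup>2 * M2\<^sup>2))" using L by simp
    with a_ge show ?thesis by linarith
  qed
  have cS: "c * S / (\<mu> * \<sigma>) \<le> M1\<^sup>2" "0 \<le> c * S / (\<mu> * \<sigma>)"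
    using sq(1) c_pos S_pos ms by (auto simp: M1_def)
  have eLc: "\<eta> / (L * c) \<le> M2\<^sup>2" "0 \<le> \<eta> / (L * c)"
    using sq(2) eta_pos L c_pos by (auto simp: M2_def)
  have cSR: "c * S \<le> L * (c * S / (\<mu> * \<sigma>))"
    using mult_left_mono[OF R, of "c * S"] c_pos S_pos by (simp add: R_def mult_ac)
  show "20 * (c * S) \<le> a"
    using bound[OF cS(2,1), of 1] sq(4) cSR by linarith
  show "20 * (l * S) \<le> a"
    using bound[of 1 1] sq by (simp add: L_def)
  have c_mu: "c / \<mu> \<le> c * S / (\<mu> * \<sigma>)"
    using c_pos mu_l sigma_pos sigma_le_S by (simp add: field_simps)
  have "20 * (L * (c / \<mu> * (\<eta> / (L * c)))) \<le> a"
    by (rule bound) (use c_mu cS eLc c_pos mu_l in auto)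
  moreover have "L * (c / \<mu> * (\<eta> / (L * c))) = \<eta> / \<mu>" using L c_pos by simp
  ultimately have eta_mu: "20 * (\<eta> / \<mu>) \<le> a" by simp
  then show "20 * \<eta> \<le> a * \<mu>" using mu_l by (simp add: field_simps)
  have eta_c: "20 * (\<eta> / c) \<le> a"
    using bound[of 1, OF _ sq(3) eLc(2,1)] L c_pos by simp
  have "20 * (\<eta> / \<mu>) * (20 * (\<eta> / c)) \<le> a * a"
    by (rule mult_mono[OF eta_mu eta_c]) (use a0 eta_pos c_pos in auto)
  then show "400 * \<eta>\<^sup>2 \<le> a\<^sup>2 * \<mu> * c"
    using mu_l c_pos by (simp add: field_simps power2_eq_square)
  have "20 * (c * S) * (20 * (\<eta> / c)) \<le> a * a"
    by (rule mult_mono) (use \<open>20 * (c * S) \<le> a\<close> eta_c a0 eta_pos c_pos in auto)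
  then show "400 * (\<eta> * S) \<le> a\<^sup>2"
    using c_pos by (simp add: power2_eq_square mult_ac)
qed

text \<open>
  The quadratic form of \<open>P\<close> at the vector stacked from \<open>q\<close> and \<open>p\<close>.
\<close>

definition energy :: "real^'n \<Rightarrow> real^'n \<Rightarrow> real" where
  "energy q p = \<eta> * a * (q \<bullet> (X *v q)) + 2 * \<eta> * (q \<bullet> p) + a * (p \<bullet> p)"

abbreviation P where "P \<equiv> P_matrix \<eta> a Y"
abbreviation P0 where "P0 \<equiv> P0_matrix \<eta> a Y"

lemma stack_P_stack: "stack q p \<bullet> (P *v stack q p) = energy q p"
  by (simp add: P_matrix_def block_mult_stack inner_stack energy_def matrix_inv_Y inner_add_right
      inner_commute scaleR_matrix_vector_assoc[symmetric] algebra_simps)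

lemma P_sym: "transpose P = P"
  by (simp add: P_matrix_def transpose_block matrix_inv_Y X_sym transpose_scalar transpose_mat)

text \<open>
  The cross term is absorbed by half of each square, since \<open>4 \<eta> S \<le> a\<^sup>2\<close>.
\<close>

lemma energy_lower: "\<eta> * a / 2 * (q \<bullet> (X *v q)) + a / 2 * (p \<bullet> p) \<le> energy q p"
proof -
  have "(2 * \<eta> / a)\<^sup>2 * (norm q)\<^sup>2 \<le> (2 * \<eta> / a)\<^sup>2 * (S * (q \<bullet> (X *v q)))"
    by (intro mult_left_mono norm_le_X_form) simp
  also have "\<dots> \<le> \<eta> * (q \<bullet> (X *v q))"
  proof -
    have "(2 * \<eta> / a)\<^sup>2 * S = \<eta> * (4 * (\<eta> * S) / a\<^sup>2)"
      by (simp add: power2_eq_square)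
    also have "\<dots> \<le> \<eta> * 1"
    proof -
      have "4 * (\<eta> * S) \<le> a\<^sup>2"
        using a_square_ge_S mult_pos_pos[OF eta_pos S_pos] by linarith
      then show ?thesis using a_pos eta_pos by (intro mult_left_mono) auto
    qed
    finally show ?thesis
      using mult_right_mono[of "(2 * \<eta> / a)\<^sup>2 * S" \<eta> "q \<bullet> (X *v q)"] X_nonneg[of q]
      by (simp add: mult.assoc)
  qed
  finally have 1: "(2 * \<eta> / a)\<^sup>2 * (norm q)\<^sup>2 \<le> \<eta> * (q \<bullet> (X *v q))" .
  have "0 \<le> (norm ((2 * \<eta> / a) *\<^sub>R q + p))\<^sup>2" by simp
  also have "\<dots> = (2 * \<eta> / a)\<^sup>2 * (norm q)\<^sup>2 + 4 * \<eta> / a * (q \<bullet> p) + p \<bullet> p"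
    unfolding power2_norm_eq_inner
    by (simp add: inner_add_left inner_add_right inner_commute power2_eq_square)
  also have "\<dots> \<le> \<eta> * (q \<bullet> (X *v q)) + 4 * \<eta> / a * (q \<bullet> p) + p \<bullet> p" using 1 by simp
  finally have "0 \<le> a / 2 * (\<eta> * (q \<bullet> (X *v q)) + 4 * \<eta> / a * (q \<bullet> p) + p \<bullet> p)"
    using a_pos by simp
  also have "\<dots> = \<eta> * a / 2 * (q \<bullet> (X *v q)) + 2 * \<eta> * (q \<bullet> p) + a / 2 * (p \<bullet> p)"
    using a_pos by (simp add: field_simps)
  finally show ?thesis by (simp add: energy_def)
qed

lemma energy_pos: "q \<noteq> 0 \<or> p \<noteq> 0 \<Longrightarrow> 0 < energy q p"
proof -
  assume "q \<noteq> 0 \<or> p \<noteq> 0"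
  then have "0 < \<eta> * a / 2 * (q \<bullet> (X *v q)) + a / 2 * (p \<bullet> p)"
    using X_pos[of q] X_nonneg[of q] a_pos eta_pos
    by (metis add_nonneg_pos add_pos_nonneg divide_nonneg_pos divide_pos_pos inner_ge_zero inner_gt_zero_iff
        mult_nonneg_nonneg mult_pos_pos less_imp_le zero_less_numeral)
  then show ?thesis using energy_lower[of q p] by linarith
qed

lemma P_pos: "z \<noteq> 0 \<Longrightarrow> 0 < z \<bullet> (P *v z)"
  by (cases z rule: stack_cases) (simp add: stack_P_stack energy_pos stack_eq_0)

lemma energy_nonneg: "0 \<le> energy q p"
  using energy_pos[of q p] by (cases "q \<noteq> 0 \<or> p \<noteq> 0") (auto simp: energy_def)

abbreviation Q where "Q \<equiv> sqrt_matrix Y"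

lemma Q_sym: "transpose Q = Q" and QQ: "Q ** Q = Y"
  using transpose_sqrt_matrix[OF Y_sym Y_nonneg] sqrt_matrix_square[OF Y_sym Y_nonneg] by auto

lemma Q_vec: "Q *v (Q *v w) = Y *v w"
  by (simp add: matrix_vector_mul_assoc QQ)

text \<open>
  That is, \<open>Q\<^sup>-\<^sup>1 = X Q\<close>; in particular every vector has the form \<open>Q X q\<close>.
\<close>

lemma QXQ_vec: "Q *v (X *v (Q *v w)) = w"
proof -
  have "(X ** Q) ** Q = mat 1" by (simp add: QQ XY flip: matrix_mul_assoc)
  then have "Q ** (X ** Q) = mat 1" using matrix_left_right_inverse by blast
  then have "(Q ** (X ** Q)) *v w = w" by simp
  then show ?thesis by (simp only: matrix_vector_mul_assoc[symmetric])
qed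

lemmas Q_inner = symmetric_matrix_inner[OF Q_sym]

lemma QX_form: "(Q *v (X *v q)) \<bullet> (Q *v (X *v q)) = q \<bullet> (X *v q)"
  by (simp add: Q_inner Q_vec YX_vec inner_commute)

lemma stack_P0_stack: "stack (Q *v (X *v q)) p \<bullet> (P0 *v stack (Q *v (X *v q)) p) = energy q p"
proof -
  have "(Q *v (X *v q)) \<bullet> (Q *v p) = q \<bullet> p"
    by (simp add: Q_inner Q_vec) (metis X_inner XY_vec)
  moreover from this have "p \<bullet> (Q *v (Q *v (X *v q))) = q \<bullet> p"
    by (metis Q_inner inner_commute)
  ultimately show ?thesis
    by (simp add: P0_matrix_def block_mult_stack inner_stack energy_def QX_form inner_add_right
      inner_commute scaleR_matrix_vector_assoc[symmetric] algebra_simps)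
qed

lemma P0_sym: "transpose P0 = P0"
  by (simp add: P0_matrix_def transpose_block Q_sym transpose_scalar transpose_mat)

lemma P0_pos: "z \<noteq> 0 \<Longrightarrow> 0 < z \<bullet> (P0 *v z)"
proof (cases z rule: stack_cases)
  fix x p assume z: "z \<noteq> 0" "z = stack x p"
  have x: "x = Q *v (X *v (Q *v x))" by (simp add: QXQ_vec)
  have "Q *v x \<noteq> 0 \<or> p \<noteq> 0"
    using z x by (auto simp: stack_eq_0)
  then show "0 < z \<bullet> (P0 *v z)"
    using energy_pos stack_P0_stack[of "Q *v x" p] x z(2) by simp
qed

text \<open>
  In the coordinates \<open>(Y\<^sup>-\<^sup>1\<^sup>/\<^sup>2 q, p)\<close> the energy is the quadratic form of \<open>P0\<close>; this is how the
  condition number of \<open>P0\<close> relates it to the form that appears in the Lipschitz estimate below.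
\<close>

lemma
  shows energy_le_P0: "energy q p \<le> spectral_norm P0 * (q \<bullet> (X *v q) + p \<bullet> p)"
    and energy_ge_P0: "q \<bullet> (X *v q) + p \<bullet> p \<le> spectral_norm (matrix_inv P0) * energy q p"
  using form_le_spectral_norm[of "stack (Q *v (X *v q)) p" P0]
    posdef_form_ge_inverse_norm[OF P0_sym P0_pos, of "stack (Q *v (X *v q)) p"]
  by (simp_all add: stack_P0_stack power2_norm_eq_inner inner_stack QX_form)

lemma
  shows energy_le_P: "energy q p \<le> spectral_norm P * ((norm q)\<^sup>2 + (norm p)\<^sup>2)"
    and energy_ge_P: "(norm q)\<^sup>2 + (norm p)\<^sup>2 \<le> spectral_norm (matrix_inv P) * energy q p"
  using form_le_spectral_norm[of "stack q p" P] posdef_form_ge_inverse_norm[OF P_sym P_pos, of "stack q p"]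
  by (simp_all add: stack_P_stack norm_stack)

lemma sqrt_energy_triangle:
  "sqrt (energy (q + q') (p + p')) \<le> sqrt (energy q p) + sqrt (energy q' p')"
proof -
  have "0 \<le> z \<bullet> (P *v z)" for z using P_pos[of z] by (cases "z = 0") auto
  from psd_sqrt_form_triangle[OF P_sym this, of "stack q p" "stack q' p'"]
  show ?thesis by (simp add: stack_add stack_P_stack)
qed

subsection \<open>Dissipation and contraction\<close>

text \<open>
  The difference of two states of the inner dynamics has this form: \<open>q\<close> and \<open>p\<close> are the
  differences of the primal and dual variables, \<open>g\<close> that of the gradients, and \<open>s\<close> that of the
  soft thresholds, which is a fraction of \<open>p + c q\<close> in each coordinate.
\<close>

definition increment_pair :: "real^'n \<Rightarrow> real^'n \<Rightarrow> real^'n \<Rightarrow> real^'n \<Rightarrow> bool" where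
  "increment_pair q p g s \<longleftrightarrow> \<mu> * (norm q)\<^sup>2 \<le> q \<bullet> g \<and> (norm g)\<^sup>2 \<le> l * (q \<bullet> g) \<and>
     (\<forall>i. \<exists>\<Gamma>. 0 \<le> \<Gamma> \<and> \<Gamma> \<le> 1 \<and> s $ i = \<Gamma> * (p $ i + c * q $ i))"

text \<open>
  With \<open>u = c q\<close> and \<open>s = \<Gamma> (p + u)\<close>, the common bound is
  \<open>D = \<Sum> \<Gamma> u\<^sup>2 + (1 - \<Gamma>) p\<^sup>2\<close>. It is the dissipation of the box part of the flow, and it also dominates
  \<open>s - p = \<Gamma> u - (1 - \<Gamma>) p\<close> by convexity of the square.
\<close>

lemma threshold_dissipation:
  assumes "increment_pair q p g s"
  obtains D where "c * (q \<bullet> s) - p \<bullet> (s - p) = D" "(norm (s - p))\<^sup>2 \<le> D"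
    "D \<le> c\<^sup>2 * (norm q)\<^sup>2 + (norm p)\<^sup>2" "norm s \<le> norm p + c * norm q"
proof -
  from assms obtain \<Gamma> where \<Gamma>: "\<And>i. 0 \<le> \<Gamma> i" "\<And>i. \<Gamma> i \<le> 1"
    and s: "\<And>i. s $ i = \<Gamma> i * (p $ i + c * q $ i)"
    unfolding increment_pair_def by metis
  define D where "D = (\<Sum>i\<in>UNIV. \<Gamma> i * (c * q $ i)\<^sup>2 + (1 - \<Gamma> i) * (p $ i)\<^sup>2)"
  have "c * (q \<bullet> s) - p \<bullet> (s - p) = D"
    unfolding D_def inner_vec_def sum_distrib_left sum_subtractf[symmetric]
    by (rule sum.cong) (auto simp: s power2_eq_square algebra_simps)
  moreover have "(norm (s - p))\<^sup>2 \<le> D"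
    unfolding power2_norm_eq_inner inner_vec_def D_def
  proof (rule sum_mono)
    fix i
    have "0 \<le> \<Gamma> i * (1 - \<Gamma> i) * (c * q $ i + p $ i)\<^sup>2" using \<Gamma>[of i] by simp
    then show "(s - p) $ i \<bullet> (s - p) $ i \<le> \<Gamma> i * (c * q $ i)\<^sup>2 + (1 - \<Gamma> i) * (p $ i)\<^sup>2"
      by (simp add: s power2_eq_square algebra_simps)
  qed
  moreover have "D \<le> c\<^sup>2 * (norm q)\<^sup>2 + (norm p)\<^sup>2"
    unfolding power2_norm_eq_inner inner_vec_def D_def sum_distrib_left sum.distrib[symmetric]
  proof (rule sum_mono)
    fix i
    have "\<Gamma> i * (c * q $ i)\<^sup>2 \<le> 1 * (c * q $ i)\<^sup>2" "(1 - \<Gamma> i) * (p $ i)\<^sup>2 \<le> 1 * (p $ i)\<^sup>2"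
      using \<Gamma>[of i] by (intro mult_right_mono; simp)+
    then show "\<Gamma> i * (c * q $ i)\<^sup>2 + (1 - \<Gamma> i) * (p $ i)\<^sup>2 \<le> c\<^sup>2 * (q $ i \<bullet> q $ i) + p $ i \<bullet> p $ i"
      by (simp add: power2_eq_square mult_ac)
  qed
  moreover have "norm s \<le> norm p + c * norm q"
  proof -
    have "norm s \<le> norm (p + c *\<^sub>R q)"
      using \<Gamma> by (intro norm_le_componentwise_cart) (simp add: s abs_mult mult_left_le_one_le)
    also have "\<dots> \<le> norm p + c * norm q"
      using norm_triangle_ineq[of p "c *\<^sub>R q"] c_pos by simp
    finally show ?thesis .
  qed
  ultimately show thesis by (rule that)
qed

text \<open>
  Half of the derivative of the energy at \<open>(q, p)\<close> in the direction \<open>(q', p')\<close>.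
\<close>

definition energy_derivative :: "real^'n \<Rightarrow> real^'n \<Rightarrow> real^'n \<Rightarrow> real^'n \<Rightarrow> real" where
  "energy_derivative q p q' p' = \<eta> * a * (q \<bullet> (X *v q')) + \<eta> * (q \<bullet> p' + q' \<bullet> p) + a * (p \<bullet> p')"

lemma energy_expand:
  "energy (q + t *\<^sub>R q') (p + t *\<^sub>R p')
    = energy q p + 2 * t * energy_derivative q p q' p' + t\<^sup>2 * energy q' p'"
proof -
  have "q' \<bullet> (X *v q) = q \<bullet> (X *v q')" by (metis X_inner inner_commute)
  then show ?thesis
    by (simp add: energy_def energy_derivative_def inner_add_left inner_add_right inner_commute
        matrix_vector_right_distrib matrix_vector_mult_scaleR power2_eq_square algebra_simps)
qed

lemma Y_young: "- (p \<bullet> (Y *v v)) \<le> (p \<bullet> (Y *v p)) / 8 + 2 * S * (norm v)\<^sup>2"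
proof -
  have "v \<bullet> (Y *v p) = p \<bullet> (Y *v v)" by (metis Y_inner inner_commute)
  moreover have "0 \<le> (p + 4 *\<^sub>R v) \<bullet> (Y *v (p + 4 *\<^sub>R v))" by (rule Y_nonneg)
  ultimately have "0 \<le> p \<bullet> (Y *v p) + 8 * (p \<bullet> (Y *v v)) + 16 * (v \<bullet> (Y *v v))"
    by (simp add: matrix_vector_right_distrib matrix_vector_mult_scaleR inner_add_left inner_add_right)
  then show ?thesis using Y_le[of v] by linarith
qed

lemma eta_cross_young: "\<eta> / c * (q \<bullet> w) \<le> a * \<mu> / 10 * (norm q)\<^sup>2 + a / (10 * c) * (norm w)\<^sup>2"
proof -
  \<comment> \<open>chosen so that expanding the square below produces the cross term with factor \<open>\<eta> / c\<close>\<close>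
  define k where "k = 5 * \<eta> / (c * a * \<mu>)"
  have k: "\<eta> / c = 2 * (a * \<mu> / 10) * k"
    using a_pos mu_l c_pos by (simp add: k_def)
  have "25 * \<eta>\<^sup>2 \<le> a * a * \<mu> * c"
    using a_square_ge zero_le_power2[of \<eta>] unfolding power2_eq_square[of a] by linarith
  then have kk: "a * \<mu> / 10 * k\<^sup>2 \<le> a / (10 * c)"
    using a_pos mu_l c_pos
    by (simp add: k_def power2_eq_square field_simps)
  have "0 \<le> a * \<mu> / 10 * (norm (q - k *\<^sub>R w))\<^sup>2" using a_pos mu_l by simp
  also have "(norm (q - k *\<^sub>R w))\<^sup>2 = (norm q)\<^sup>2 - 2 * k * (q \<bullet> w) + k\<^sup>2 * (norm w)\<^sup>2"
    unfolding power2_norm_eq_inner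
    by (simp add: inner_diff_left inner_diff_right inner_commute power2_eq_square)
  also have "a * \<mu> / 10 * \<dots> = a * \<mu> / 10 * (norm q)\<^sup>2 - \<eta> / c * (q \<bullet> w) + a * \<mu> / 10 * k\<^sup>2 * (norm w)\<^sup>2"
    unfolding k by (simp add: algebra_simps)
  also have "a * \<mu> / 10 * k\<^sup>2 * (norm w)\<^sup>2 \<le> a / (10 * c) * (norm w)\<^sup>2"
    using kk by (intro mult_right_mono) auto
  finally show ?thesis by simp
qed

lemma energy_upper:
  "\<sigma> / (4 * a) * energy q p \<le> a * \<mu> / 40 * (norm q)\<^sup>2 + \<sigma> / 2 * (norm p)\<^sup>2"
proof -
  have "\<sigma> / (4 * a) * (\<eta> * a * (q \<bullet> (X *v q))) = \<eta> / 4 * (\<sigma> * (q \<bullet> (X *v q)))"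
    using a_pos by simp
  also have "\<dots> \<le> \<eta> / 4 * (norm q)\<^sup>2"
    using X_form_le[of q] eta_pos by (intro mult_left_mono) auto
  finally have 1: "\<sigma> / (4 * a) * (\<eta> * a * (q \<bullet> (X *v q))) \<le> \<eta> / 4 * (norm q)\<^sup>2" .
  have "0 \<le> (norm (\<eta> *\<^sub>R q - a *\<^sub>R p))\<^sup>2" by simp
  also have "\<dots> = \<eta>\<^sup>2 * (norm q)\<^sup>2 - 2 * \<eta> * a * (q \<bullet> p) + a\<^sup>2 * (norm p)\<^sup>2"
    unfolding power2_norm_eq_inner
    by (simp add: inner_diff_left inner_diff_right inner_commute power2_eq_square)
  finally have "\<sigma> / (4 * a\<^sup>2) * (2 * \<eta> * a * (q \<bullet> p)) \<le> \<sigma> / (4 * a\<^sup>2) * (\<eta>\<^sup>2 * (norm q)\<^sup>2 + a\<^sup>2 * (norm p)\<^sup>2)"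
    using sigma_pos a_pos by (intro mult_left_mono) auto
  then have 2: "\<sigma> / (4 * a) * (2 * \<eta> * (q \<bullet> p)) \<le> \<eta> * (\<sigma> * \<eta> / (4 * a\<^sup>2)) * (norm q)\<^sup>2 + \<sigma> / 4 * (norm p)\<^sup>2"
    using a_pos by (simp add: power2_eq_square field_simps)
  have "\<sigma> * \<eta> \<le> a\<^sup>2"
  proof -
    have "\<sigma> * \<eta> \<le> \<eta> * S" using mult_right_mono[OF sigma_le_S, of \<eta>] eta_pos by (simp add: mult.commute)
    then show ?thesis using a_square_ge_S mult_pos_pos[OF eta_pos S_pos] by linarith
  qed
  then have "\<eta> * (\<sigma> * \<eta> / (4 * a\<^sup>2)) \<le> \<eta> * (1 / 4)"
    using eta_pos a_pos by (intro mult_left_mono) (auto simp: field_simps)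
  then have 3: "\<eta> * (\<sigma> * \<eta> / (4 * a\<^sup>2)) * (norm q)\<^sup>2 \<le> \<eta> / 4 * (norm q)\<^sup>2"
    by (intro mult_right_mono) auto
  have 4: "\<eta> / 2 * (norm q)\<^sup>2 \<le> a * \<mu> / 40 * (norm q)\<^sup>2"
    using a_ge_eta by (intro mult_right_mono) auto
  have "\<sigma> / (4 * a) * energy q p = \<sigma> / (4 * a) * (\<eta> * a * (q \<bullet> (X *v q)))
      + \<sigma> / (4 * a) * (2 * \<eta> * (q \<bullet> p)) + \<sigma> / 4 * (norm p)\<^sup>2"
    using a_pos by (simp add: energy_def power2_norm_eq_inner distrib_left)
  then show ?thesis using 1 2 3 4 by (simp add: field_simps)
qed

abbreviation \<tau> where "\<tau> \<equiv> tau_const \<mu> l c \<eta> Y"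
abbreviation \<nu> where "\<nu> \<equiv> nu_const l c \<eta> Y"

lemma tau_altdef: "\<tau> = 2 * (\<eta> * (\<sigma> / (4 * a)))"
  by (simp add: tau_const_def a_eq)

lemma tau_pos: "0 < \<tau>"
  using eta_pos sigma_pos a_pos by (simp add: tau_altdef)

text \<open>
  Up to the factor \<open>\<eta>\<close>, the flow yields \<open>- a q \<bullet> g - (a / c) D\<close> from monotonicity of the gradient and of the thresholds,
  and the cross term \<open>q \<bullet> p\<close> of the energy contributes \<open>- p \<bullet> Y (g + s)\<close>. As \<open>g + s = p + g + (s - p)\<close>, this contains
  \<open>- p \<bullet> Y p \<le> - \<sigma> p \<bullet> p\<close>, which is the source of the decay in \<open>p\<close>. What remains, the terms with
  \<open>g\<close> and \<open>s - p\<close>, is absorbed by Young's inequality because \<open>a\<close> is large.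
\<close>

lemma energy_dissipation:
  assumes inc: "increment_pair q p g s"
  shows "energy_derivative q p (- (Y *v (g + s))) ((\<eta> / c) *\<^sub>R (s - p)) \<le> - (\<tau> / 2) * energy q p"
proof -
  obtain D where D: "c * (q \<bullet> s) - p \<bullet> (s - p) = D" "(norm (s - p))\<^sup>2 \<le> D"
    by (rule threshold_dissipation[OF inc])
  define w where "w = s - p"
  have g: "\<mu> * (norm q)\<^sup>2 \<le> q \<bullet> g" "(norm g)\<^sup>2 \<le> l * (q \<bullet> g)"
    using inc by (auto simp: increment_pair_def)
  have w: "(norm w)\<^sup>2 \<le> D" using D by (simp add: w_def)
  have D0: "0 \<le> D" using w by (meson order_trans zero_le_power2)
  have qg: "0 \<le> q \<bullet> g" using g(1) mu_l by (meson order_trans zero_le_power2 mult_nonneg_nonneg less_imp_le)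
  have "X *v (- (Y *v (g + s))) = - (g + s)"
    unfolding linear_neg[OF matrix_vector_mul_linear[of X]] XY_vec ..
  then have "energy_derivative q p (- (Y *v (g + s))) ((\<eta> / c) *\<^sub>R w)
      = \<eta> * a * (q \<bullet> (- (g + s))) + \<eta> * (q \<bullet> ((\<eta> / c) *\<^sub>R w) + (- (Y *v (g + s))) \<bullet> p) + a * (p \<bullet> ((\<eta> / c) *\<^sub>R w))"
    unfolding energy_derivative_def by simp
  then have "energy_derivative q p (- (Y *v (g + s))) ((\<eta> / c) *\<^sub>R w)
      = \<eta> * (- a * (q \<bullet> g) - a / c * D - p \<bullet> (Y *v (g + s)) + \<eta> / c * (q \<bullet> w))"
    using c_pos unfolding D(1)[symmetric] w_def[symmetric] inner_commute[of "- (Y *v (g + s))"]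
      inner_minus_right inner_add_right[of q] inner_scaleR_right
    by (simp add: field_simps)
  also have "\<dots> \<le> \<eta> * (- (\<sigma> / (4 * a)) * energy q p)"
  proof (rule mult_left_mono)
    have "g + s = p + g + w" by (simp add: w_def)
    then have split: "p \<bullet> (Y *v (g + s)) = p \<bullet> (Y *v p) + p \<bullet> (Y *v g) + p \<bullet> (Y *v w)"
      by (simp add: matrix_vector_right_distrib inner_add_right)
    have yg: "2 * S * (norm g)\<^sup>2 \<le> a / 10 * (q \<bullet> g)"
    proof -
      have "2 * S * (norm g)\<^sup>2 \<le> 2 * S * (l * (q \<bullet> g))"
        using g(2) S_pos by (intro mult_left_mono) auto
      also have "\<dots> = 2 * (l * S) * (q \<bullet> g)" by simp
      also have "\<dots> \<le> a / 10 * (q \<bullet> g)"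
        using a_ge_lS qg by (intro mult_right_mono) auto
      finally show ?thesis .
    qed
    have yw: "2 * S * (norm w)\<^sup>2 \<le> a / (10 * c) * D"
    proof -
      have "2 * S * (norm w)\<^sup>2 \<le> 2 * S * D"
        using w S_pos by (intro mult_left_mono) auto
      also have "\<dots> \<le> a / (10 * c) * D"
        using a_ge_cS D0 c_pos by (intro mult_right_mono) (auto simp: field_simps)
      finally show ?thesis .
    qed
    have cross: "\<eta> / c * (q \<bullet> w) \<le> a * \<mu> / 10 * (norm q)\<^sup>2 + a / (10 * c) * D"
    proof -
      have "a / (10 * c) * (norm w)\<^sup>2 \<le> a / (10 * c) * D"
        using w a_pos c_pos by (intro mult_left_mono) auto
      then show ?thesis using eta_cross_young[of q w] by linarith
    qed
    define K where "K = a / c * D"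
    define N where "N = a * \<mu> * (norm q)\<^sup>2"
    define A where "A = a * (q \<bullet> g)"
    define V where "V = \<sigma> / (4 * a) * energy q p"
    have eqs: "a / (10 * c) * D = K / 10" "a * \<mu> / 10 * (norm q)\<^sup>2 = N / 10" "a / 10 * (q \<bullet> g) = A / 10"
      by (simp_all add: K_def N_def A_def)
    have "2 * S * (norm g)\<^sup>2 \<le> A / 10" "2 * S * (norm w)\<^sup>2 \<le> K / 10"
      "\<eta> / c * (q \<bullet> w) \<le> N / 10 + K / 10"
      using yg yw cross unfolding eqs .
    moreover have "0 \<le> K" "0 \<le> N" "N \<le> A"
      using a_pos c_pos D0 mu_l mult_left_mono[OF g(1), of a] by (simp_all add: K_def N_def A_def mult.assoc)
    moreover have "V \<le> N / 40 + \<sigma> / 2 * (norm p)\<^sup>2"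
      using energy_upper[of q p] by (simp add: V_def N_def)
    ultimately have "- A - K - (p \<bullet> (Y *v p) + p \<bullet> (Y *v g) + p \<bullet> (Y *v w)) + \<eta> / c * (q \<bullet> w) \<le> - V"
      using Y_ge[of p] Y_young[of p g] Y_young[of p w] Y_nonneg[of p] by linarith
    then show "- a * (q \<bullet> g) - a / c * D - p \<bullet> (Y *v (g + s)) + \<eta> / c * (q \<bullet> w)
        \<le> - (\<sigma> / (4 * a)) * energy q p"
      unfolding split by (simp add: K_def A_def V_def)
  qed (use eta_pos in simp)
  finally show ?thesis by (simp add: tau_altdef w_def)
qed

text \<open>
  In the coordinates \<open>(Y\<^sup>-\<^sup>1\<^sup>/\<^sup>2 q, p)\<close> this says that the vector field is Lipschitz with constant \<open>\<nu>\<close>.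
\<close>

lemma field_bound:
  assumes inc: "increment_pair q p g s"
  shows "(g + s) \<bullet> (Y *v (g + s)) + (\<eta> / c)\<^sup>2 * (norm (s - p))\<^sup>2 \<le> \<nu>\<^sup>2 * (q \<bullet> (X *v q) + p \<bullet> p)"
proof -
  obtain D where D: "(norm (s - p))\<^sup>2 \<le> D" "D \<le> c\<^sup>2 * (norm q)\<^sup>2 + (norm p)\<^sup>2"
    and s: "norm s \<le> norm p + c * norm q"
    by (rule threshold_dissipation[OF inc])
  have gl: "norm g \<le> l * norm q"
  proof (cases "g = 0")
    case False
    have "norm g * norm g \<le> l * (norm q * norm g)"
      using inc norm_cauchy_schwarz[of q g] mult_left_mono[of "q \<bullet> g" "norm q * norm g" l] l_pos
      unfolding increment_pair_def power2_eq_square by linarith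
    then show ?thesis using False by (simp add: mult.assoc[symmetric])
  qed (use l_pos in simp)
  have "norm (g + s) \<le> (l + c) * norm q + norm p"
    using norm_triangle_ineq[of g s] gl s by (simp add: distrib_right)
  then have "(norm (g + s))\<^sup>2 \<le> ((l + c) * norm q + norm p)\<^sup>2"
    by (intro power_mono) auto
  also have "\<dots> \<le> 2 * ((l + c) * norm q)\<^sup>2 + 2 * (norm p)\<^sup>2"
    using sum_squares_bound[of "(l + c) * norm q" "norm p"] by (simp add: power2_sum)
  finally have gs: "(norm (g + s))\<^sup>2 \<le> 2 * (l + c)\<^sup>2 * (norm q)\<^sup>2 + 2 * (norm p)\<^sup>2"
    by (simp add: power_mult_distrib)
  define e where "e = q \<bullet> (X *v q)"
  have e: "0 \<le> e" "(norm q)\<^sup>2 \<le> S * e" using X_nonneg norm_le_X_form by (auto simp: e_def)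
  have "(g + s) \<bullet> (Y *v (g + s)) \<le> S * (2 * (l + c)\<^sup>2 * (norm q)\<^sup>2 + 2 * (norm p)\<^sup>2)"
    using Y_le[of "g + s"] mult_left_mono[OF gs, of S] S_pos by linarith
  also have "\<dots> \<le> S * (2 * (l + c)\<^sup>2 * (S * e) + 2 * (norm p)\<^sup>2)"
    using e(2) S_pos by (intro mult_left_mono add_right_mono) auto
  also have "\<dots> = 2 * (l * S + S * c)\<^sup>2 * e + 2 * S * (norm p)\<^sup>2"
    by (simp add: power2_eq_square algebra_simps)
  finally have 1: "(g + s) \<bullet> (Y *v (g + s)) \<le> 2 * (l * S + S * c)\<^sup>2 * e + 2 * S * (norm p)\<^sup>2" .
  have "(\<eta> / c)\<^sup>2 * (norm (s - p))\<^sup>2 \<le> (\<eta> / c)\<^sup>2 * (c\<^sup>2 * (S * e) + (norm p)\<^sup>2)"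
  proof (rule mult_left_mono)
    have "c\<^sup>2 * (norm q)\<^sup>2 \<le> c\<^sup>2 * (S * e)" using e(2) by (intro mult_left_mono) auto
    then show "(norm (s - p))\<^sup>2 \<le> c\<^sup>2 * (S * e) + (norm p)\<^sup>2" using D by linarith
  qed simp
  also have "\<dots> = \<eta>\<^sup>2 * S * e + \<eta>\<^sup>2 / c\<^sup>2 * (norm p)\<^sup>2"
    using c_pos by (simp add: power2_eq_square field_simps)
  finally have 2: "(\<eta> / c)\<^sup>2 * (norm (s - p))\<^sup>2 \<le> \<eta>\<^sup>2 * S * e + \<eta>\<^sup>2 / c\<^sup>2 * (norm p)\<^sup>2" .
  define A where "A = 2 * (l * S + S * c)\<^sup>2 + 2 * \<eta>\<^sup>2 * S"
  define B where "B = 2 * S + 8 * (\<eta>\<^sup>2 / c\<^sup>2)"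
  have AB0: "0 \<le> A" "0 \<le> B" using S_pos by (auto simp: A_def B_def)
  have nu: "\<nu> = max (sqrt A) (sqrt B)" by (simp add: nu_const_def Let_def A_def B_def)
  have "(sqrt A)\<^sup>2 \<le> \<nu>\<^sup>2" "(sqrt B)\<^sup>2 \<le> \<nu>\<^sup>2"
    unfolding nu using AB0 by (intro power_mono; simp)+
  then have AB: "A \<le> \<nu>\<^sup>2" "B \<le> \<nu>\<^sup>2" using AB0 by auto
  have "(g + s) \<bullet> (Y *v (g + s)) + (\<eta> / c)\<^sup>2 * (norm (s - p))\<^sup>2
      \<le> (2 * (l * S + S * c)\<^sup>2 + \<eta>\<^sup>2 * S) * e + (2 * S + \<eta>\<^sup>2 / c\<^sup>2) * (norm p)\<^sup>2"
    using 1 2 by (simp add: algebra_simps)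
  also have "\<dots> \<le> A * e + B * (norm p)\<^sup>2"
  proof -
    have "0 \<le> \<eta>\<^sup>2 / c\<^sup>2" "0 \<le> \<eta>\<^sup>2 * S" using S_pos by simp_all
    then have "2 * (l * S + S * c)\<^sup>2 + \<eta>\<^sup>2 * S \<le> A" "2 * S + \<eta>\<^sup>2 / c\<^sup>2 \<le> B"
      unfolding A_def B_def by linarith+
    then show ?thesis using e(1) by (intro add_mono mult_right_mono) auto
  qed
  also have "\<dots> \<le> \<nu>\<^sup>2 * e + \<nu>\<^sup>2 * (norm p)\<^sup>2"
    using e(1) AB by (intro add_mono mult_right_mono) auto
  finally show ?thesis by (simp add: e_def power2_norm_eq_inner distrib_left)
qed

lemma nu_pos: "0 < \<nu>"
  using S_pos unfolding nu_const_def Let_def by (intro max.strict_coboundedI2) (auto intro: add_pos_nonneg)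

lemma cond_P0_pos: "0 < cond_num P0"
  using posdef_cond_num_ge_1[OF P0_pos] by linarith

text \<open>
  The Euler step of length \<open>\<alpha>\<close> loses \<open>\<tau> \<alpha>\<close> to first order and gains at most \<open>\<alpha>\<^sup>2 \<nu>\<^sup>2 \<kappa>\<close> to second
  order. As \<open>exp (- y) \<ge> 1 - y\<close>, the resulting factor is at most \<open>\<rho>\<^sup>2\<close>.
\<close>

lemma energy_contraction:
  assumes inc: "increment_pair q p g s" and \<rho>: "0 \<le> 1 - \<tau> * \<alpha> / 2"
    "\<rho> = exp (- \<tau> * \<alpha> / 2) + \<alpha>\<^sup>2 * \<nu>\<^sup>2 * cond_num P0 / 2" and \<alpha>: "0 < \<alpha>"
  shows "energy (q - \<alpha> *\<^sub>R (Y *v (g + s))) (p + (\<eta> * \<alpha> / c) *\<^sub>R (s - p)) \<le> \<rho>\<^sup>2 * energy q p"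
proof -
  define q' where "q' = - (Y *v (g + s))"
  define p' where "p' = (\<eta> / c) *\<^sub>R (s - p)"
  define \<kappa> where "\<kappa> = cond_num P0"
  have "q' \<bullet> (X *v q') + p' \<bullet> p' = (g + s) \<bullet> (Y *v (g + s)) + (\<eta> / c)\<^sup>2 * (norm (s - p))\<^sup>2"
  proof -
    have "X *v q' = - (g + s)"
      unfolding q'_def linear_neg[OF matrix_vector_mul_linear[of X]] XY_vec ..
    then have "q' \<bullet> (X *v q') = (g + s) \<bullet> (Y *v (g + s))"
      by (simp only: q'_def inner_minus_left inner_minus_right minus_minus inner_commute)
    moreover have "p' \<bullet> p' = (\<eta> / c)\<^sup>2 * (norm (s - p))\<^sup>2"
      unfolding power2_norm_eq_inner p'_def by (simp add: power2_eq_square)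
    ultimately show ?thesis by simp
  qed
  then have "q' \<bullet> (X *v q') + p' \<bullet> p' \<le> \<nu>\<^sup>2 * (q \<bullet> (X *v q) + p \<bullet> p)"
    using field_bound[OF inc] by simp
  also have "\<dots> \<le> \<nu>\<^sup>2 * (spectral_norm (matrix_inv P0) * energy q p)"
    by (intro mult_left_mono energy_ge_P0) simp
  finally have "spectral_norm P0 * (q' \<bullet> (X *v q') + p' \<bullet> p')
      \<le> spectral_norm P0 * (\<nu>\<^sup>2 * (spectral_norm (matrix_inv P0) * energy q p))"
    by (intro mult_left_mono spectral_norm_nonneg)
  then have second: "energy q' p' \<le> \<nu>\<^sup>2 * \<kappa> * energy q p"
    using energy_le_P0[of q' p'] by (simp add: \<kappa>_def cond_num_def mult_ac)
  have "energy (q + \<alpha> *\<^sub>R q') (p + \<alpha> *\<^sub>R p')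
      = energy q p + 2 * \<alpha> * energy_derivative q p q' p' + \<alpha>\<^sup>2 * energy q' p'"
    by (rule energy_expand)
  also have "\<dots> \<le> energy q p + 2 * \<alpha> * (- (\<tau> / 2) * energy q p) + \<alpha>\<^sup>2 * (\<nu>\<^sup>2 * \<kappa> * energy q p)"
    using energy_dissipation[OF inc] second \<alpha>
    by (intro add_mono mult_left_mono) (auto simp: q'_def p'_def)
  also have "\<dots> = (1 - \<tau> * \<alpha> + \<alpha>\<^sup>2 * \<nu>\<^sup>2 * \<kappa>) * energy q p"
    by (simp add: algebra_simps)
  also have "\<dots> \<le> \<rho>\<^sup>2 * energy q p"
  proof (rule mult_right_mono[OF _ energy_nonneg])
    define w where "w = \<alpha>\<^sup>2 * \<nu>\<^sup>2 * \<kappa>"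
    have w: "0 \<le> w" using cond_P0_pos by (simp add: w_def \<kappa>_def)
    have "1 + (- \<tau> * \<alpha> / 2) \<le> exp (- \<tau> * \<alpha> / 2)" by (rule exp_ge_add_one_self)
    then have "1 - \<tau> * \<alpha> / 2 + w / 2 \<le> \<rho>" by (simp add: \<rho>(2) w_def \<kappa>_def)
    then have "(1 - \<tau> * \<alpha> / 2 + w / 2)\<^sup>2 \<le> \<rho>\<^sup>2" using \<rho>(1) w by (intro power_mono) auto
    moreover have "(1 - \<tau> * \<alpha> / 2 + w / 2)\<^sup>2 = 1 - \<tau> * \<alpha> + w + ((\<tau> * \<alpha> - w) / 2)\<^sup>2"
      by (simp add: power2_eq_square field_simps)
    ultimately show "1 - \<tau> * \<alpha> + \<alpha>\<^sup>2 * \<nu>\<^sup>2 * \<kappa> \<le> \<rho>\<^sup>2"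
      using zero_le_power2[of "(\<tau> * \<alpha> - w) / 2"] unfolding w_def[symmetric] by linarith
  qed
  finally show ?thesis by (simp add: q'_def p'_def mult.commute)
qed

text \<open>
  With \<open>y = \<tau> \<alpha> / 2 < 1 / 2\<close>, the exponential is at most \<open>1 - y / 2\<close>, and the bound on \<open>\<alpha>\<close> makes
  the second-order term less than \<open>y / 2\<close>.
\<close>

lemma contraction_factor_less_1:
  assumes \<alpha>: "0 < \<alpha>" "\<alpha> < min (1 / \<tau>) (\<tau> / (2 * \<nu>\<^sup>2 * cond_num P0))"
  shows "\<tau> * \<alpha> < 1" "exp (- \<tau> * \<alpha> / 2) + \<alpha>\<^sup>2 * \<nu>\<^sup>2 * cond_num P0 / 2 < 1"
proof -
  define y where "y = \<tau> * \<alpha> / 2"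
  show 1: "\<tau> * \<alpha> < 1" using \<alpha> tau_pos by (simp add: field_simps)
  then have y: "0 < y" "y < 1 / 2" using \<alpha> tau_pos by (auto simp: y_def)
  have pos: "0 < 2 * \<nu>\<^sup>2 * cond_num P0" using nu_pos cond_P0_pos by simp
  have "\<alpha> * (2 * \<nu>\<^sup>2 * cond_num P0) < \<tau>" using \<alpha>(2) pos by (simp add: pos_less_divide_eq)
  then have "\<alpha> * (\<alpha> * (2 * \<nu>\<^sup>2 * cond_num P0)) < \<alpha> * \<tau>" using \<alpha>(1) by simp
  then have w: "\<alpha>\<^sup>2 * \<nu>\<^sup>2 * cond_num P0 / 2 < y / 2" by (simp add: y_def power2_eq_square mult_ac)
  have "exp (- y) \<le> 1 - y / 2"
  proof -
    have "1 + y \<le> exp y" by (rule exp_ge_add_one_self)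
    then have "exp (- y) \<le> 1 / (1 + y)" using y by (simp add: exp_minus field_simps)
    also have "\<dots> \<le> 1 - y / 2" using y by (simp add: field_simps)
    finally show ?thesis .
  qed
  moreover have "- \<tau> * \<alpha> / 2 = - y" by (simp add: y_def)
  ultimately show "exp (- \<tau> * \<alpha> / 2) + \<alpha>\<^sup>2 * \<nu>\<^sup>2 * cond_num P0 / 2 < 1" using w by simp
qed

end

section \<open>Inexact projected ascent with tracked errors\<close>

text \<open>
  A small-gain argument with the Lyapunov function \<open>W = D - k b\<^sup>2\<close>. With \<open>r = C / (1 - \<rho>)\<close> and
  \<open>\<delta>\<close> the size of the increment, the ascent step increases \<open>D\<close> by at least \<open>(1 / \<gamma> - L) \<delta>\<^sup>2 - b \<delta>\<close>,
  and by convexity of the square the tracking step decreases \<open>b\<^sup>2\<close> by at least \<open>(1 - \<rho>) (b\<^sup>2 - r\<^sup>2 \<delta>\<^sup>2)\<close>.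
  The choice of \<open>k\<close> completes the square in the cross term \<open>b \<delta>\<close>, and \<open>W\<close> increases by
  \<open>\<epsilon> \<delta>\<^sup>2 + r (\<delta> - b / r)\<^sup>2 / 2\<close>, where \<open>\<epsilon> = 1 / \<gamma> - L - r > 0\<close>. Boundedness of \<open>W\<close> forces both squares to zero.
\<close>

lemma ascent_with_tracking:
  fixes \<theta> :: "nat \<Rightarrow> 'b::real_inner" and D :: "'b \<Rightarrow> real" and G :: "'b \<Rightarrow> 'b" and b :: "nat \<Rightarrow> real"
  assumes concave: "\<And>t. G (\<theta> (Suc t)) \<bullet> (\<theta> (Suc t) - \<theta> t) \<le> D (\<theta> (Suc t)) - D (\<theta> t)"
    and lipschitz: "\<And>t. norm (G (\<theta> (Suc t)) - G (\<theta> t)) \<le> L * norm (\<theta> (Suc t) - \<theta> t)"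
    and bounded: "\<And>t. D (\<theta> t) \<le> M"
    and step: "\<And>t. (norm (\<theta> (Suc t) - \<theta> t))\<^sup>2 \<le> \<gamma> * ((G (\<theta> t) + e t) \<bullet> (\<theta> (Suc t) - \<theta> t))"
    and error: "\<And>t. norm (e t) \<le> b t"
    and tracking: "\<And>t. b (Suc t) \<le> \<rho> * b t + C * norm (\<theta> (Suc t) - \<theta> t)"
    and \<rho>: "0 \<le> \<rho>" "\<rho> < 1" and C: "0 < C" and \<gamma>: "0 < \<gamma>" "L + C / (1 - \<rho>) < 1 / \<gamma>"
  shows "(\<lambda>t. norm (\<theta> (Suc t) - \<theta> t)) \<longlonglongrightarrow> 0" "b \<longlonglongrightarrow> 0" "\<exists>m. \<forall>t. m \<le> D (\<theta> t)"
proof -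
  define r where "r = C / (1 - \<rho>)"
  define \<epsilon> where "\<epsilon> = 1 / \<gamma> - L - r"
  define \<delta> where "\<delta> t = norm (\<theta> (Suc t) - \<theta> t)" for t
  define k where "k = 1 / (2 * r * (1 - \<rho>))"
  define W where "W t = D (\<theta> t) - k * (b t)\<^sup>2" for t
  have r: "0 < r" using \<rho> C by (simp add: r_def)
  have \<epsilon>: "0 < \<epsilon>" using \<gamma> by (simp add: \<epsilon>_def r_def)
  have k: "0 < k" using r \<rho> by (simp add: k_def)
  have kb: "0 \<le> k * (b t)\<^sup>2" for t using k by simp
  have b0: "0 \<le> b t" for t using error[of t] norm_ge_zero[of "e t"] by linarith
  have ascent: "(1 / \<gamma> - L) * (\<delta> t)\<^sup>2 - b t * \<delta> t \<le> D (\<theta> (Suc t)) - D (\<theta> t)" for t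
  proof -
    let ?d = "\<theta> (Suc t) - \<theta> t"
    have "(\<delta> t)\<^sup>2 / \<gamma> \<le> (G (\<theta> t) + e t) \<bullet> ?d"
      using step[of t] \<gamma> by (simp add: \<delta>_def field_simps)
    also have "\<dots> = G (\<theta> (Suc t)) \<bullet> ?d - (G (\<theta> (Suc t)) - G (\<theta> t)) \<bullet> ?d + e t \<bullet> ?d"
      by (simp add: inner_diff_left inner_add_left)
    also have "\<dots> \<le> D (\<theta> (Suc t)) - D (\<theta> t) + L * (\<delta> t)\<^sup>2 + b t * \<delta> t"
    proof -
      have "- ((G (\<theta> (Suc t)) - G (\<theta> t)) \<bullet> ?d) \<le> norm (G (\<theta> (Suc t)) - G (\<theta> t)) * \<delta> t"
        using Cauchy_Schwarz_ineq2[of "G (\<theta> (Suc t)) - G (\<theta> t)" ?d] by (simp add: \<delta>_def)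
      also have "\<dots> \<le> L * \<delta> t * \<delta> t"
        using lipschitz[of t] by (intro mult_right_mono) (auto simp: \<delta>_def)
      finally have "- ((G (\<theta> (Suc t)) - G (\<theta> t)) \<bullet> ?d) \<le> L * (\<delta> t)\<^sup>2"
        by (simp add: power2_eq_square mult.assoc)
      moreover have "e t \<bullet> ?d \<le> b t * \<delta> t"
        using norm_cauchy_schwarz[of "e t" ?d] mult_right_mono[OF error[of t], of "\<delta> t"]
        by (simp add: \<delta>_def)
      ultimately show ?thesis using concave[of t] by linarith
    qed
    finally show ?thesis by (simp add: algebra_simps)
  qed
  have track: "(b (Suc t))\<^sup>2 \<le> \<rho> * (b t)\<^sup>2 + (1 - \<rho>) * (r * \<delta> t)\<^sup>2" for t
  proof -
    have "b (Suc t) \<le> \<rho> * b t + (1 - \<rho>) * (r * \<delta> t)"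
      using tracking[of t] \<rho> by (simp add: r_def \<delta>_def)
    then have "(b (Suc t))\<^sup>2 \<le> (\<rho> * b t + (1 - \<rho>) * (r * \<delta> t))\<^sup>2"
      using b0 by (intro power_mono)
    also have "\<dots> = \<rho> * (b t)\<^sup>2 + (1 - \<rho>) * (r * \<delta> t)\<^sup>2 - \<rho> * (1 - \<rho>) * (b t - r * \<delta> t)\<^sup>2"
      by algebra
    also have "\<dots> \<le> \<rho> * (b t)\<^sup>2 + (1 - \<rho>) * (r * \<delta> t)\<^sup>2"
      using \<rho> by simp
    finally show ?thesis .
  qed
  have W_step: "\<epsilon> * (\<delta> t)\<^sup>2 + r / 2 * (\<delta> t - b t / r)\<^sup>2 \<le> W (Suc t) - W t" for t
  proof -
    have "k * (b (Suc t))\<^sup>2 \<le> k * (\<rho> * (b t)\<^sup>2 + (1 - \<rho>) * (r * \<delta> t)\<^sup>2)"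
      using track[of t] k by (intro mult_left_mono) auto
    then have "(1 / \<gamma> - L) * (\<delta> t)\<^sup>2 - b t * \<delta> t + k * (1 - \<rho>) * (b t)\<^sup>2 - k * (1 - \<rho>) * (r * \<delta> t)\<^sup>2
        \<le> W (Suc t) - W t"
      using ascent[of t] unfolding W_def by (simp add: algebra_simps)
    moreover have "k * (1 - \<rho>) = 1 / (2 * r)" using \<rho> by (simp add: k_def)
    moreover have "(1 / \<gamma> - L) * (\<delta> t)\<^sup>2 - b t * \<delta> t + 1 / (2 * r) * (b t)\<^sup>2 - 1 / (2 * r) * (r * \<delta> t)\<^sup>2
        = \<epsilon> * (\<delta> t)\<^sup>2 + r / 2 * (\<delta> t - b t / r)\<^sup>2"
      using r by (simp add: \<epsilon>_def power2_eq_square field_simps)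
    ultimately show ?thesis by simp
  qed
  have "\<And>t. 0 \<le> \<epsilon> * (\<delta> t)\<^sup>2" "\<And>t. 0 \<le> r / 2 * (\<delta> t - b t / r)\<^sup>2"
    using \<epsilon> r by simp_all
  note nn = this
  have upper: "\<epsilon> * (\<delta> t)\<^sup>2 \<le> W (Suc t) - W t" "r / 2 * (\<delta> t - b t / r)\<^sup>2 \<le> W (Suc t) - W t" for t
    using W_step[of t] nn[of t] by linarith+
  have inc: "W t \<le> W (Suc t)" for t using W_step[of t] nn[of t] by linarith
  have "incseq W" using inc by (rule incseq_SucI)
  moreover have "W t \<le> M" for t
    using bounded[of t] kb[of t] unfolding W_def by linarith
  ultimately obtain W' where W': "W \<longlonglongrightarrow> W'" using incseq_convergent by blast
  have "(\<lambda>t. W (Suc t) - W t) \<longlonglongrightarrow> W' - W'"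
    by (intro tendsto_diff LIMSEQ_Suc W')
  then have lim0: "(\<lambda>t. W (Suc t) - W t) \<longlonglongrightarrow> 0" by simp
  have "(\<lambda>t. \<epsilon> * (\<delta> t)\<^sup>2) \<longlonglongrightarrow> 0"
    by (rule tendsto_sandwich[OF _ _ tendsto_const lim0])
      (auto simp only: intro!: always_eventually nn upper)
  then have "(\<lambda>t. sqrt ((\<epsilon> * (\<delta> t)\<^sup>2) / \<epsilon>)) \<longlonglongrightarrow> sqrt (0 / \<epsilon>)"
    by (intro tendsto_intros) (use \<epsilon> in auto)
  moreover have "sqrt ((\<epsilon> * (\<delta> t)\<^sup>2) / \<epsilon>) = \<delta> t" for t
    using \<epsilon> by (simp add: \<delta>_def)
  ultimately have \<delta>_lim: "\<delta> \<longlonglongrightarrow> 0" by simp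
  then show "(\<lambda>t. norm (\<theta> (Suc t) - \<theta> t)) \<longlonglongrightarrow> 0" by (simp add: \<delta>_def[abs_def])
  have "(\<lambda>t. r / 2 * (\<delta> t - b t / r)\<^sup>2) \<longlonglongrightarrow> 0"
    by (rule tendsto_sandwich[OF _ _ tendsto_const lim0])
      (auto simp only: intro!: always_eventually nn upper)
  then have "(\<lambda>t. sqrt ((r / 2 * (\<delta> t - b t / r)\<^sup>2) / (r / 2))) \<longlonglongrightarrow> sqrt (0 / (r / 2))"
    by (intro tendsto_intros) (use r in auto)
  then have "(\<lambda>t. \<bar>\<delta> t - b t / r\<bar>) \<longlonglongrightarrow> 0" using r by simp
  then have "(\<lambda>t. \<delta> t - b t / r) \<longlonglongrightarrow> 0" by (simp add: tendsto_rabs_zero_iff)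
  from tendsto_mult_left[OF tendsto_diff[OF \<delta>_lim this], of r]
  show "b \<longlonglongrightarrow> 0" using r by simp
  have "W 0 \<le> D (\<theta> t)" for t
    using incseqD[OF \<open>incseq W\<close>, of 0 t] kb[of t] unfolding W_def by linarith
  then show "\<exists>m. \<forall>t. m \<le> D (\<theta> t)" by blast
qed

section \<open>The inner problem and its dependence on the multipliers\<close>

lemma ST_increment:
  assumes "b1 \<le> b2"
  shows "\<exists>\<Gamma>. 0 \<le> \<Gamma> \<and> \<Gamma> \<le> 1 \<and> ST b1 b2 y - ST b1 b2 y' = \<Gamma> * (y - y')"
proof (cases "y = y'")
  case False
  let ?\<Gamma> = "(ST b1 b2 y - ST b1 b2 y') / (y - y')"
  have "0 \<le> ?\<Gamma>" "?\<Gamma> \<le> 1"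
    using assms False
    by (auto simp: ST_def zero_le_divide_iff divide_le_eq_1 max_def min_def)
  then show ?thesis using False by (intro exI[of _ ?\<Gamma>]) simp
qed auto

text \<open>
  The hypotheses say that \<open>\<xi>\<close> is normal to the interval from \<open>b1\<close> to \<open>b2\<close> at \<open>z\<close>.
\<close>

lemma ST_fixed_point:
  assumes b: "b1 \<le> z" "z \<le> b2" and "0 < \<xi> \<Longrightarrow> z = b2" "\<xi> < 0 \<Longrightarrow> z = b1"
  shows "ST b1 b2 (\<xi> + z) = \<xi>"
  by (cases \<xi> "0::real" rule: linorder_cases) (use assms in \<open>auto simp: ST_def\<close>)

locale grid_problem = grid_dynamics X Y \<mu> l c \<eta> a
  for X Y :: "real^'n^'n" and \<mu> l c \<eta> a :: real +
  fixes obj :: "real^'n \<Rightarrow> real" and grad :: "real^'n \<Rightarrow> real^'n" and qlo qhi vpar vlo vhi :: "real^'n"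
  assumes grad: "\<And>z. GDERIV obj z :> grad z"
    and strong: "\<And>z z'. \<mu> * (norm (z - z'))\<^sup>2 \<le> (z - z') \<bullet> (grad z - grad z')"
    and smooth: "\<And>z z'. (z - z') \<bullet> (grad z - grad z') \<le> l * (norm (z - z'))\<^sup>2"
    and q_bounds: "\<And>i. qlo $ i < qhi $ i"
begin

lemma grad_cocoercive: "(norm (grad z - grad z'))\<^sup>2 \<le> l * ((z - z') \<bullet> (grad z - grad z'))"
proof (rule gradient_cocoercive[OF grad _ smooth l_pos])
  show "0 \<le> (z - z') \<bullet> (grad z - grad z')" for z z'
    using strong[of z z'] mu_l by (meson order_trans zero_le_power2 mult_nonneg_nonneg less_imp_le)
qed

lemma grad_lipschitz: "norm (grad z - grad z') \<le> l * norm (z - z')"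
proof (cases "grad z = grad z'")
  case False
  have "norm (grad z - grad z') * norm (grad z - grad z') \<le> l * (norm (z - z') * norm (grad z - grad z'))"
    using grad_cocoercive[of z z'] norm_cauchy_schwarz[of "z - z'" "grad z - grad z'"] l_pos
      mult_left_mono[of "(z - z') \<bullet> (grad z - grad z')" "norm (z - z') * norm (grad z - grad z')" l]
    unfolding power2_eq_square by linarith
  then show ?thesis using False by (simp add: mult.assoc[symmetric])
qed (use l_pos in simp)

definition soft_threshold :: "real^'n \<Rightarrow> real^'n \<Rightarrow> real^'n" where
  "soft_threshold \<xi> z = (\<chi> i. ST (c * qlo $ i) (c * qhi $ i) (\<xi> $ i + c * z $ i))"

lemma increment_pair_soft_threshold:
  "increment_pair (z - z') (\<xi> - \<xi>') (grad z - grad z') (soft_threshold \<xi> z - soft_threshold \<xi>' z')"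
  unfolding increment_pair_def
proof (intro conjI allI)
  show "\<exists>\<Gamma>. 0 \<le> \<Gamma> \<and> \<Gamma> \<le> 1 \<and> (soft_threshold \<xi> z - soft_threshold \<xi>' z') $ i = \<Gamma> * ((\<xi> - \<xi>') $ i + c * (z - z') $ i)" for i
    using ST_increment[of "c * qlo $ i" "c * qhi $ i" "\<xi> $ i + c * z $ i" "\<xi>' $ i + c * z' $ i"]
      q_bounds[of i] c_pos by (simp add: soft_threshold_def algebra_simps less_imp_le)
qed (rule strong grad_cocoercive)+

text \<open>
  The multipliers of the voltage bounds enter the inner problem only through the difference \<open>r\<close> of the upper
  and the lower one, which adds the linear term \<open>X r\<close>. The solution is the point of the box that satisfies the
  variational inequality.
\<close>

definition qstar :: "real^'n \<Rightarrow> real^'n" where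
  "qstar r = (SOME q. q \<in> cbox qlo qhi \<and> (\<forall>z\<in>cbox qlo qhi. 0 \<le> (grad q + X *v r) \<bullet> (z - q)))"

lemma
  shows qstar_in: "qstar r \<in> cbox qlo qhi"
    and qstar_vi: "z \<in> cbox qlo qhi \<Longrightarrow> 0 \<le> (grad (qstar r) + X *v r) \<bullet> (z - qstar r)"
proof -
  define h where "h z = obj z + (X *v r) \<bullet> z" for z
  have gh: "GDERIV h z :> grad z + X *v r" for z
  proof -
    have "GDERIV (\<lambda>z. (X *v r) \<bullet> z) z :> X *v r"
      unfolding gderiv_def inner_commute[of _ "X *v r"]
      by (intro bounded_linear_imp_has_derivative bounded_linear_inner_right)
    then show ?thesis unfolding h_def by (intro GDERIV_add grad)
  qed
  have "continuous_on (cbox qlo qhi) h"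
    by (intro differentiable_imp_continuous_on differentiable_at_imp_differentiable_on)
      (use gh in \<open>auto simp: gderiv_def intro: differentiableI\<close>)
  moreover have "qlo \<in> cbox qlo qhi"
    using q_bounds by (auto simp: mem_box_cart less_imp_le)
  then have "cbox qlo qhi \<noteq> {}" by blast
  ultimately have "\<exists>q\<in>cbox qlo qhi. \<forall>y\<in>cbox qlo qhi. h q \<le> h y"
    by (intro continuous_attains_inf compact_cbox)
  then obtain q where q: "q \<in> cbox qlo qhi" "\<And>y. y \<in> cbox qlo qhi \<Longrightarrow> h q \<le> h y" by blast
  have "\<exists>q. q \<in> cbox qlo qhi \<and> (\<forall>z\<in>cbox qlo qhi. 0 \<le> (grad q + X *v r) \<bullet> (z - q))"
    using q minimizer_variational_inequality[OF gh convex_box(1) q(1) _ q(2)] by blast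
  from someI_ex[OF this]
  show "qstar r \<in> cbox qlo qhi" "z \<in> cbox qlo qhi \<Longrightarrow> 0 \<le> (grad (qstar r) + X *v r) \<bullet> (z - qstar r)"
    unfolding qstar_def by blast+
qed

definition xistar :: "real^'n \<Rightarrow> real^'n" where
  "xistar r = - (grad (qstar r) + X *v r)"

text \<open>
  The equilibrium condition of the update of \<open>\<xi>\<close>. It follows from the variational inequality, tested with
  the points that differ from the solution in one coordinate.
\<close>

lemma soft_threshold_xistar: "soft_threshold (xistar r) (qstar r) = xistar r"
proof -
  let ?q = "qstar r"
  have b: "qlo $ i \<le> ?q $ i" "?q $ i \<le> qhi $ i" for i
    using qstar_in[of r] by (auto simp: mem_box_cart)
  have sign: "xistar r $ i * (y - ?q $ i) \<le> 0" if "qlo $ i \<le> y" "y \<le> qhi $ i" for i y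
  proof -
    define z where "z = (\<chi> j. if j = i then y else ?q $ j)"
    have "z \<in> cbox qlo qhi" using that b by (auto simp: mem_box_cart z_def)
    then have "0 \<le> (- xistar r) \<bullet> (z - ?q)" using qstar_vi[of z r] by (simp add: xistar_def add.commute)
    also have "z - ?q = axis i (y - ?q $ i)" by (simp add: z_def axis_def vec_eq_iff)
    finally show ?thesis by (simp add: inner_axis)
  qed
  have "ST (c * qlo $ i) (c * qhi $ i) (xistar r $ i + c * ?q $ i) = xistar r $ i" for i
  proof (rule ST_fixed_point)
    show "c * ?q $ i = c * qhi $ i" if "0 < xistar r $ i"
      using sign[of i "qhi $ i"] that b[of i] by (simp add: mult_le_0_iff)
    show "c * ?q $ i = c * qlo $ i" if "xistar r $ i < 0"
      using sign[of i "qlo $ i"] that b[of i] by (simp add: mult_le_0_iff)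
  qed (use b c_pos in auto)
  then show ?thesis by (simp add: soft_threshold_def vec_eq_iff)
qed

text \<open>
  Test each of the two variational inequalities with the other solution and add them up.
\<close>

lemma qstar_lipschitz: "\<mu> * norm (qstar r - qstar r') \<le> norm (X *v (r - r'))"
proof (cases "qstar r = qstar r'")
  case False
  let ?d = "qstar r - qstar r'"
  have "0 \<le> (grad (qstar r) + X *v r) \<bullet> (qstar r' - qstar r)"
    "0 \<le> (grad (qstar r') + X *v r') \<bullet> (qstar r - qstar r')"
    by (intro qstar_vi qstar_in)+
  then have "?d \<bullet> (grad (qstar r) - grad (qstar r')) \<le> - ((X *v (r - r')) \<bullet> ?d)"
    by (simp add: matrix_vector_mult_diff_distrib inner_add_left inner_add_right inner_diff_left
        inner_diff_right inner_commute)
  also have "\<dots> \<le> norm (X *v (r - r')) * norm ?d"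
    using Cauchy_Schwarz_ineq2[of "X *v (r - r')" ?d] by linarith
  finally have "\<mu> * norm ?d * norm ?d \<le> norm (X *v (r - r')) * norm ?d"
    using strong[of "qstar r" "qstar r'"] by (simp add: power2_eq_square mult.assoc)
  then show ?thesis using False by simp
qed simp

lemma inner_solution_lipschitz:
  "(norm (qstar r - qstar r'))\<^sup>2 + (norm (xistar r - xistar r'))\<^sup>2
    \<le> (1 + 4 * l\<^sup>2) / \<mu>\<^sup>2 * (norm (X *v (r - r')))\<^sup>2"
proof -
  define n where "n = norm (X *v (r - r'))"
  have q: "norm (qstar r - qstar r') \<le> n / \<mu>"
    using qstar_lipschitz[of r r'] mu_l by (simp add: n_def field_simps)
  have "xistar r - xistar r' = - ((grad (qstar r) - grad (qstar r')) + X *v (r - r'))"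
    by (simp add: xistar_def matrix_vector_mult_diff_distrib)
  then have "norm (xistar r - xistar r') \<le> norm (grad (qstar r) - grad (qstar r')) + n"
    using norm_triangle_ineq[of "grad (qstar r) - grad (qstar r')" "X *v (r - r')"]
    by (simp only: norm_minus_cancel n_def)
  also have "\<dots> \<le> l * (n / \<mu>) + n"
    using grad_lipschitz[of "qstar r" "qstar r'"] mult_left_mono[OF q, of l] l_pos by linarith
  also have "\<dots> \<le> 2 * l * (n / \<mu>)"
  proof -
    have "n * \<mu> \<le> n * l" using mu_l by (intro mult_left_mono) (auto simp: n_def)
    then show ?thesis using mu_l by (simp add: field_simps)
  qed
  finally have "(norm (qstar r - qstar r'))\<^sup>2 + (norm (xistar r - xistar r'))\<^sup>2
      \<le> (n / \<mu>)\<^sup>2 + (2 * l * (n / \<mu>))\<^sup>2"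
    using q by (intro add_mono power_mono) auto
  also have "\<dots> = (1 + 4 * l\<^sup>2) / \<mu>\<^sup>2 * n\<^sup>2"
    using mu_l by (simp add: power2_eq_square field_simps)
  finally show ?thesis by (simp add: n_def)
qed

section \<open>The dual function\<close>

text \<open>
  A multiplier is a pair of the multipliers of the upper and of the lower voltage bounds, and
  \<open>constraint q\<close> pairs the corresponding constraint functions.
\<close>

definition constraint :: "real^'n \<Rightarrow> (real^'n) \<times> (real^'n)" where
  "constraint q = (X *v q + vpar - vhi, vlo - (X *v q + vpar))"

definition qdual :: "(real^'n) \<times> (real^'n) \<Rightarrow> real^'n" where
  "qdual \<theta> = qstar (fst \<theta> - snd \<theta>)"

definition dual :: "(real^'n) \<times> (real^'n) \<Rightarrow> real" where
  "dual \<theta> = obj (qdual \<theta>) + constraint (qdual \<theta>) \<bullet> \<theta>"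

abbreviation K :: real where "K \<equiv> spectral_norm (X_tilde X)"

lemma K_pos: "0 < K"
proof -
  let ?w = "axis undefined 1 :: real^'n"
  have "?w \<noteq> 0" by (simp add: axis_eq_0_iff)
  then have "X *v ?w \<noteq> 0" using X_pos[of ?w] by auto
  then have "0 < K\<^sup>2 * (norm ?w)\<^sup>2"
    by (intro less_le_trans[OF _ X_tilde_norm[OF X_sym, of ?w]]) simp
  then have "K \<noteq> 0" by auto
  then show ?thesis using spectral_norm_nonneg[of "X_tilde X"] by simp
qed

lemma constraint_lipschitz: "norm (constraint q - constraint q') \<le> K * norm (q - q')"
proof (rule power2_le_imp_le)
  have "constraint q - constraint q' = (X *v (q - q'), - (X *v (q - q')))"
    by (simp add: constraint_def matrix_vector_mult_diff_distrib)
  then have "(norm (constraint q - constraint q'))\<^sup>2 = 2 * (norm (X *v (q - q')))\<^sup>2"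
    by (simp add: norm_Pair)
  then show "(norm (constraint q - constraint q'))\<^sup>2 \<le> (K * norm (q - q'))\<^sup>2"
    using X_tilde_norm[OF X_sym, of "q - q'"] by (simp add: power_mult_distrib)
qed (use K_pos in simp)

text \<open>
  The factor 2 lost in bounding the difference of the two multipliers by the pair is regained in
  \<open>X_tilde_norm\<close>.
\<close>

lemma multiplier_term_bound:
  "norm (X *v ((fst \<theta> - snd \<theta>) - (fst \<theta>' - snd \<theta>'))) \<le> K * norm (\<theta> - \<theta>')"
proof (rule power2_le_imp_le)
  define u where "u = fst (\<theta> - \<theta>')"
  define w where "w = snd (\<theta> - \<theta>')"
  have "(norm (u - w))\<^sup>2 + (norm (u + w))\<^sup>2 = 2 * ((norm u)\<^sup>2 + (norm w)\<^sup>2)"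
    unfolding power2_norm_eq_inner by (simp add: inner_diff_left inner_diff_right inner_add_left inner_add_right inner_commute)
  then have uw: "(norm (u - w))\<^sup>2 \<le> 2 * ((norm u)\<^sup>2 + (norm w)\<^sup>2)"
    using zero_le_power2[of "norm (u + w)"] by linarith
  have "2 * (norm (X *v (u - w)))\<^sup>2 \<le> K\<^sup>2 * (norm (u - w))\<^sup>2"
    by (rule X_tilde_norm[OF X_sym])
  also have "\<dots> \<le> K\<^sup>2 * (2 * ((norm u)\<^sup>2 + (norm w)\<^sup>2))"
    using uw by (intro mult_left_mono) auto
  also have "\<dots> = 2 * (K\<^sup>2 * ((norm u)\<^sup>2 + (norm w)\<^sup>2))" by (simp only: mult.left_commute)
  finally have "(norm (X *v (u - w)))\<^sup>2 \<le> K\<^sup>2 * ((norm u)\<^sup>2 + (norm w)\<^sup>2)" by linarith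
  also have "(norm u)\<^sup>2 + (norm w)\<^sup>2 = (norm (\<theta> - \<theta>'))\<^sup>2"
    by (simp add: u_def w_def norm_prod_def)
  finally show "(norm (X *v ((fst \<theta> - snd \<theta>) - (fst \<theta>' - snd \<theta>'))))\<^sup>2 \<le> (K * norm (\<theta> - \<theta>'))\<^sup>2"
    by (simp add: u_def w_def power_mult_distrib algebra_simps)
qed (use K_pos in simp)

lemma qdual_lipschitz: "\<mu> * norm (qdual \<theta> - qdual \<theta>') \<le> K * norm (\<theta> - \<theta>')"
  unfolding qdual_def using qstar_lipschitz multiplier_term_bound order_trans by blast

lemma constraint_qdual_lipschitz: "norm (constraint (qdual \<theta>) - constraint (qdual \<theta>')) \<le> K\<^sup>2 / \<mu> * norm (\<theta> - \<theta>')"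
proof -
  have "norm (constraint (qdual \<theta>) - constraint (qdual \<theta>')) \<le> K * norm (qdual \<theta> - qdual \<theta>')"
    by (rule constraint_lipschitz)
  also have "\<dots> \<le> K * (K * norm (\<theta> - \<theta>') / \<mu>)"
    using qdual_lipschitz[of \<theta> \<theta>'] K_pos mu_l by (intro mult_left_mono) (auto simp: field_simps)
  finally show ?thesis by (simp add: power2_eq_square)
qed

text \<open>
  The inner solution minimizes the \<open>\<mu>\<close>-strongly convex Lagrangian over the box.
\<close>

lemma lagrangian_growth:
  assumes z: "z \<in> cbox qlo qhi"
  shows "dual \<theta> + \<mu> / 2 * (norm (z - qdual \<theta>))\<^sup>2 \<le> obj z + constraint z \<bullet> \<theta>"
proof -
  let ?q = "qdual \<theta>" and ?r = "fst \<theta> - snd \<theta>"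
  have "constraint z \<bullet> \<theta> - constraint ?q \<bullet> \<theta> = (X *v (z - ?q)) \<bullet> ?r"
    by (cases \<theta>) (simp add: constraint_def matrix_vector_mult_diff_distrib inner_diff_left inner_diff_right
        inner_add_left)
  also have "\<dots> = (X *v ?r) \<bullet> (z - ?q)" by (simp add: X_inner inner_commute)
  finally have "constraint z \<bullet> \<theta> = constraint ?q \<bullet> \<theta> + (X *v ?r) \<bullet> (z - ?q)" by simp
  moreover have "obj ?q + grad ?q \<bullet> (z - ?q) + \<mu> / 2 * (norm (z - ?q))\<^sup>2 \<le> obj z"
    by (rule gradient_quadratic_lower_bound[OF grad strong])
  moreover have "0 \<le> grad ?q \<bullet> (z - ?q) + (X *v ?r) \<bullet> (z - ?q)"
    using qstar_vi[OF z, of ?r] by (simp add: qdual_def inner_add_left)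
  ultimately show ?thesis by (simp add: dual_def)
qed

lemma dual_le_lagrangian: "z \<in> cbox qlo qhi \<Longrightarrow> dual \<theta> \<le> obj z + constraint z \<bullet> \<theta>"
  using lagrangian_growth[of z \<theta>] mu_l
  by (meson add_increasing2 divide_nonneg_pos dual_order.trans less_imp_le mult_nonneg_nonneg
      order_refl zero_le_power2 zero_less_numeral le_add_same_cancel1)

text \<open>
  The values of the constraints at the inner solution are a supergradient of the dual function.
\<close>

lemma dual_concave: "constraint (qdual \<theta>') \<bullet> (\<theta>' - \<theta>) \<le> dual \<theta>' - dual \<theta>"
  using dual_le_lagrangian[of "qdual \<theta>'" \<theta>] qstar_in
  by (simp add: dual_def[of \<theta>'] inner_diff_right) (simp add: qdual_def)

end

section \<open>Convergence of the algorithm\<close>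

definition nonneg :: "(real^'n) \<times> (real^'n) \<Rightarrow> bool" where
  "nonneg \<theta> \<longleftrightarrow> (\<forall>i. 0 \<le> fst \<theta> $ i \<and> 0 \<le> snd \<theta> $ i)"

lemma inner_prod_sum: "\<theta> \<bullet> \<theta>' = (\<Sum>i\<in>UNIV. fst \<theta> $ i * fst \<theta>' $ i + snd \<theta> $ i * snd \<theta>' $ i)"
  for \<theta> \<theta>' :: "(real^'n) \<times> (real^'n)"
  by (simp add: inner_prod_def inner_vec_def sum.distrib)

lemma max_projection:
  fixes x :: real
  assumes "y \<ge> 0" shows "(x - max 0 x) * (y - max 0 x) \<le> 0"
  using assms by (auto simp: max_def mult_le_0_iff)

lemma closest_point_interval: "closest_point {a..b} x = max a (min x b)" if "a \<le> b" for x :: real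
proof (rule sym, rule closest_point_unique)
  show "\<forall>z\<in>{a..b}. dist x (max a (min x b)) \<le> dist x z"
    using that by (auto simp: dist_real_def max_def min_def)
qed (use that in auto)

lemma closest_point_halfline: "closest_point {0..} x = max 0 x" for x :: real
  by (rule sym, rule closest_point_unique) (auto simp: dist_real_def max_def)

locale optdist_run = grid_problem X Y \<mu> l c \<eta> a obj grad qlo qhi vpar vlo vhi
  for X Y :: "real^'n^'n" and \<mu> l c \<eta> a :: real
    and obj :: "real^'n \<Rightarrow> real" and grad :: "real^'n \<Rightarrow> real^'n" and qlo qhi vpar vlo vhi :: "real^'n" +
  fixes \<alpha> \<gamma> \<rho> :: real and qh q \<xi> :: "nat \<Rightarrow> real^'n" and \<theta> :: "nat \<Rightarrow> (real^'n) \<times> (real^'n)"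
  assumes alpha: "0 < \<alpha>" "\<alpha> < min (1 / \<tau>) (\<tau> / (2 * \<nu>\<^sup>2 * cond_num P0))"
    and rho_eq: "\<rho> = exp (- \<tau> * \<alpha> / 2) + \<alpha>\<^sup>2 * \<nu>\<^sup>2 * cond_num P0 / 2"
    and gamma: "0 < \<gamma>" "\<gamma> < min (\<mu> / (2 * K\<^sup>2)) (K\<^sup>2 * (1 - \<rho>)\<^sup>2 / (2 * \<mu> * (C2_const \<mu> l X P)\<^sup>2))"
    and theta_0: "nonneg (\<theta> 0)"
    and q_proj: "q t $ i = closest_point {qlo $ i..qhi $ i} (qh t $ i)"
    and qh_step: "qh (Suc t) = qh t - \<alpha> *\<^sub>R (Y *v (grad (qh t) + X *v (fst (\<theta> t) - snd (\<theta> t)) + soft_threshold (\<xi> t) (qh t)))"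
    and xi_step: "\<xi> (Suc t) = \<xi> t + (\<eta> * \<alpha> / c) *\<^sub>R (soft_threshold (\<xi> t) (qh t) - \<xi> t)"
    and theta_step: "fst (\<theta> (Suc t)) $ i = max 0 (fst (\<theta> t) $ i + \<gamma> * fst (constraint (q t)) $ i)"
      "snd (\<theta> (Suc t)) $ i = max 0 (snd (\<theta> t) $ i + \<gamma> * snd (constraint (q t)) $ i)"
    and slater: "\<exists>z\<in>cbox qlo qhi. \<forall>i. fst (constraint z) $ i < 0 \<and> snd (constraint z) $ i < 0"
begin

lemma theta_nonneg: "nonneg (\<theta> t)"
  by (cases t) (use theta_0 in \<open>auto simp: nonneg_def theta_step\<close>)

text \<open>
  The variational characterization of the projection onto the nonnegative orthant.
\<close>

lemma theta_projection:
  assumes "nonneg \<psi>"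
  shows "(\<theta> t + \<gamma> *\<^sub>R constraint (q t) - \<theta> (Suc t)) \<bullet> (\<psi> - \<theta> (Suc t)) \<le> 0"
  unfolding inner_prod_sum
  by (rule sum_nonpos) (use assms in \<open>auto simp: nonneg_def theta_step intro!: add_nonpos_nonpos max_projection\<close>)

lemma q_in: "q t \<in> cbox qlo qhi"
  using q_bounds by (auto simp: mem_box_cart q_proj closest_point_interval less_imp_le)

lemma q_closer:
  assumes z: "z \<in> cbox qlo qhi"
  shows "norm (q t - z) \<le> norm (qh t - z)"
proof (rule norm_le_componentwise_cart)
  fix i
  have "qlo $ i \<le> z $ i" "z $ i \<le> qhi $ i" using z by (auto simp: mem_box_cart)
  then show "norm ((q t - z) $ i) \<le> norm ((qh t - z) $ i)"
    using q_bounds[of i] by (auto simp: q_proj closest_point_interval max_def min_def)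
qed

definition net_multiplier :: "nat \<Rightarrow> real^'n" where
  "net_multiplier t = fst (\<theta> t) - snd (\<theta> t)"

text \<open>
  The distance, in the norm of \<open>P\<close>, of the inner iterate from the equilibrium for the current
  multipliers.
\<close>

definition err :: "nat \<Rightarrow> real" where
  "err t = sqrt (energy (qh t - qstar (net_multiplier t)) (\<xi> t - xistar (net_multiplier t)))"

lemma rho: "0 \<le> \<rho>" "\<rho> < 1"
  using contraction_factor_less_1[OF alpha] cond_P0_pos by (auto simp: rho_eq intro: add_nonneg_nonneg)

lemma inner_step: "sqrt (energy (qh (Suc t) - qstar (net_multiplier t)) (\<xi> (Suc t) - xistar (net_multiplier t))) \<le> \<rho> * err t"
proof -
  define dq where "dq = qh t - qstar (net_multiplier t)"
  define dp where "dp = \<xi> t - xistar (net_multiplier t)"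
  define g where "g = grad (qh t) - grad (qstar (net_multiplier t))"
  define s where "s = soft_threshold (\<xi> t) (qh t) - soft_threshold (xistar (net_multiplier t)) (qstar (net_multiplier t))"
  have inc: "increment_pair dq dp g s"
    unfolding dq_def dp_def g_def s_def by (rule increment_pair_soft_threshold)
  have "grad (qh t) + X *v net_multiplier t + soft_threshold (\<xi> t) (qh t) = g + s"
    by (simp add: g_def s_def soft_threshold_xistar) (simp add: xistar_def)
  then have "qh (Suc t) - qstar (net_multiplier t) = dq - \<alpha> *\<^sub>R (Y *v (g + s))"
    by (simp add: qh_step net_multiplier_def[symmetric] dq_def)
  moreover have "\<xi> (Suc t) - xistar (net_multiplier t) = dp + (\<eta> * \<alpha> / c) *\<^sub>R (s - dp)"
    by (simp add: xi_step dp_def s_def soft_threshold_xistar)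
  moreover have "0 \<le> 1 - \<tau> * \<alpha> / 2" using contraction_factor_less_1(1)[OF alpha] by simp
  note energy_contraction[OF inc this rho_eq alpha(1)]
  ultimately have "energy (qh (Suc t) - qstar (net_multiplier t)) (\<xi> (Suc t) - xistar (net_multiplier t)) \<le> \<rho>\<^sup>2 * energy dq dp"
    by simp
  then have "sqrt (energy (qh (Suc t) - qstar (net_multiplier t)) (\<xi> (Suc t) - xistar (net_multiplier t))) \<le> sqrt (\<rho>\<^sup>2 * energy dq dp)"
    by (rule real_sqrt_le_mono)
  then show ?thesis using rho by (simp add: real_sqrt_mult err_def dq_def dp_def)
qed

definition norm_P :: real where "norm_P = spectral_norm P"
definition norm_P_inv :: real where "norm_P_inv = spectral_norm (matrix_inv P)"

lemma norm_P_nonneg: "0 \<le> norm_P" "0 \<le> norm_P_inv"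
  by (simp_all add: norm_P_def norm_P_inv_def spectral_norm_nonneg)

lemma q_error: "norm (q t - qdual (\<theta> t)) \<le> sqrt norm_P_inv * err t"
proof -
  have "norm (q t - qdual (\<theta> t)) \<le> norm (qh t - qstar (net_multiplier t))"
    unfolding qdual_def net_multiplier_def by (rule q_closer[OF qstar_in])
  also have "\<dots> \<le> sqrt (norm_P_inv * energy (qh t - qstar (net_multiplier t)) (\<xi> t - xistar (net_multiplier t)))"
    using energy_ge_P[of "qh t - qstar (net_multiplier t)" "\<xi> t - xistar (net_multiplier t)"]
      zero_le_power2[of "norm (\<xi> t - xistar (net_multiplier t))"]
    unfolding norm_P_inv_def[symmetric] by (intro real_le_rsqrt) linarith
  finally show ?thesis by (simp add: err_def real_sqrt_mult)
qed

lemma err_step: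
  "err (Suc t) \<le> \<rho> * err t + sqrt norm_P * (sqrt ((1 + 4 * l\<^sup>2) / \<mu>\<^sup>2) * (K * norm (\<theta> (Suc t) - \<theta> t)))"
proof -
  let ?r = "net_multiplier t" and ?r' = "net_multiplier (Suc t)"
  have "err (Suc t) = sqrt (energy ((qh (Suc t) - qstar ?r) + (qstar ?r - qstar ?r'))
      ((\<xi> (Suc t) - xistar ?r) + (xistar ?r - xistar ?r')))"
    by (simp add: err_def)
  also have "\<dots> \<le> sqrt (energy (qh (Suc t) - qstar ?r) (\<xi> (Suc t) - xistar ?r))
      + sqrt (energy (qstar ?r - qstar ?r') (xistar ?r - xistar ?r'))"
    by (rule sqrt_energy_triangle)
  also have "\<dots> \<le> \<rho> * err t + sqrt (norm_P * ((1 + 4 * l\<^sup>2) / \<mu>\<^sup>2 * (K * norm (\<theta> (Suc t) - \<theta> t))\<^sup>2))"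
  proof (intro add_mono inner_step real_sqrt_le_mono)
    have "energy (qstar ?r - qstar ?r') (xistar ?r - xistar ?r')
        \<le> norm_P * ((norm (qstar ?r - qstar ?r'))\<^sup>2 + (norm (xistar ?r - xistar ?r'))\<^sup>2)"
      unfolding norm_P_def by (rule energy_le_P)
    also have "\<dots> \<le> norm_P * ((1 + 4 * l\<^sup>2) / \<mu>\<^sup>2 * (norm (X *v (?r - ?r')))\<^sup>2)"
      by (intro mult_left_mono inner_solution_lipschitz norm_P_nonneg)
    also have "\<dots> \<le> norm_P * ((1 + 4 * l\<^sup>2) / \<mu>\<^sup>2 * (K * norm (\<theta> (Suc t) - \<theta> t))\<^sup>2)"
      using multiplier_term_bound[of "\<theta> t" "\<theta> (Suc t)"]
      by (intro mult_left_mono power_mono norm_P_nonneg) (auto simp: net_multiplier_def norm_minus_commute)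
    finally show "energy (qstar ?r - qstar ?r') (xistar ?r - xistar ?r')
      \<le> norm_P * ((1 + 4 * l\<^sup>2) / \<mu>\<^sup>2 * (K * norm (\<theta> (Suc t) - \<theta> t))\<^sup>2)" .
  qed
  also have "sqrt (norm_P * ((1 + 4 * l\<^sup>2) / \<mu>\<^sup>2 * (K * norm (\<theta> (Suc t) - \<theta> t))\<^sup>2))
      = sqrt norm_P * (sqrt ((1 + 4 * l\<^sup>2) / \<mu>\<^sup>2) * (K * norm (\<theta> (Suc t) - \<theta> t)))"
    using K_pos by (simp only: real_sqrt_mult real_sqrt_abs) simp
  finally show ?thesis .
qed

abbreviation C2 :: real where "C2 \<equiv> C2_const \<mu> l X P"

lemma C2_pos: "0 < C2"
proof -
  have "0 < cond_num P" using posdef_cond_num_ge_1[OF P_pos] by linarith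
  moreover have "0 < (1 + 4 * l\<^sup>2) / \<mu>\<^sup>2" using mu_l by (intro divide_pos_pos add_pos_nonneg) auto
  ultimately show ?thesis using K_pos by (simp add: C2_const_def)
qed

text \<open>
  Multiplying the two bounds on \<open>1 / \<gamma>\<close> gives \<open>1 / \<gamma> > 2 C2 / (1 - \<rho>)\<close>; averaging this with the
  first of them gives the bound on the step size under which the ascent tolerates the errors.
\<close>

lemma gamma_small: "K\<^sup>2 / \<mu> + C2 / (1 - \<rho>) < 1 / \<gamma>"
proof -
  define m where "m = C2 / (1 - \<rho>)"
  define L where "L = K\<^sup>2 / \<mu>"
  have L: "0 < L" using K_pos mu_l by (simp add: L_def)
  have m: "0 < m" using C2_pos rho by (simp add: m_def)
  have "\<gamma> < 1 / (2 * L)" using gamma(2) by (simp add: L_def)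
  then have 1: "2 * L < 1 / \<gamma>" using gamma(1) L by (simp add: field_simps)
  have "K\<^sup>2 * (1 - \<rho>)\<^sup>2 / (2 * \<mu> * C2\<^sup>2) = L / (2 * m\<^sup>2)"
    using mu_l rho C2_pos by (simp add: L_def m_def field_simps)
  then have "\<gamma> < L / (2 * m\<^sup>2)" using gamma(2) by simp
  then have 2: "2 * m\<^sup>2 / L < 1 / \<gamma>" using gamma(1) L m by (simp add: field_simps)
  have "(2 * L) * (2 * m\<^sup>2 / L) < (1 / \<gamma>) * (1 / \<gamma>)"
    by (rule mult_strict_mono[OF 1 2]) (use L m gamma(1) in auto)
  then have "(2 * m)\<^sup>2 < (1 / \<gamma>)\<^sup>2" using L by (simp add: power2_eq_square)
  then have "2 * m < 1 / \<gamma>" by (rule power2_less_imp_less) (use gamma(1) in simp)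
  then show ?thesis using 1 unfolding m_def[symmetric] L_def[symmetric] by linarith
qed

text \<open>
  Weak duality: the cost of the strictly feasible point is an upper bound.
\<close>

lemma dual_bounded: "\<exists>M. \<forall>t. dual (\<theta> t) \<le> M"
proof -
  obtain z where z: "z \<in> cbox qlo qhi" "\<And>i. fst (constraint z) $ i < 0 \<and> snd (constraint z) $ i < 0"
    using slater by blast
  have "constraint z \<bullet> \<theta> t \<le> 0" for t
    unfolding inner_prod_sum
    using z(2) theta_nonneg[of t]
    by (intro sum_nonpos add_nonpos_nonpos mult_nonpos_nonneg) (auto simp: nonneg_def less_imp_le)
  then have "dual (\<theta> t) \<le> obj z" for t
    using dual_le_lagrangian[OF z(1), of "\<theta> t"] by (meson add_le_same_cancel1 order_trans)
  then show ?thesis by blast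
qed

lemma
  shows increments_vanish: "(\<lambda>t. norm (\<theta> (Suc t) - \<theta> t)) \<longlonglongrightarrow> 0"
    and errors_vanish: "(\<lambda>t. K * sqrt norm_P_inv * err t) \<longlonglongrightarrow> 0"
    and dual_bounded_below: "\<exists>m. \<forall>t. m \<le> dual (\<theta> t)"
proof -
  obtain M where M: "\<And>t. dual (\<theta> t) \<le> M" using dual_bounded by blast
  define e where "e t = constraint (q t) - constraint (qdual (\<theta> t))" for t
  have step: "(norm (\<theta> (Suc t) - \<theta> t))\<^sup>2 \<le> \<gamma> * ((constraint (qdual (\<theta> t)) + e t) \<bullet> (\<theta> (Suc t) - \<theta> t))" for t
    using theta_projection[OF theta_nonneg, of t t] unfolding power2_norm_eq_inner e_def
    by (simp add: inner_diff_left inner_diff_right inner_add_left inner_add_right inner_commute algebra_simps)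
  have error: "norm (e t) \<le> K * sqrt norm_P_inv * err t" for t
  proof -
    have "norm (e t) \<le> K * norm (q t - qdual (\<theta> t))" unfolding e_def by (rule constraint_lipschitz)
    also have "\<dots> \<le> K * (sqrt norm_P_inv * err t)" using K_pos by (intro mult_left_mono q_error) simp
    finally show ?thesis by (simp add: mult.assoc)
  qed
  have tracking: "K * sqrt norm_P_inv * err (Suc t) \<le> \<rho> * (K * sqrt norm_P_inv * err t) + C2 * norm (\<theta> (Suc t) - \<theta> t)" for t
  proof -
    have "K * sqrt norm_P_inv * err (Suc t) \<le> K * sqrt norm_P_inv *
        (\<rho> * err t + sqrt norm_P * (sqrt ((1 + 4 * l\<^sup>2) / \<mu>\<^sup>2) * (K * norm (\<theta> (Suc t) - \<theta> t))))"
      using K_pos norm_P_nonneg by (intro mult_left_mono err_step) auto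
    also have "\<dots> = \<rho> * (K * sqrt norm_P_inv * err t) + C2 * norm (\<theta> (Suc t) - \<theta> t)"
      by (simp add: C2_const_def cond_num_def norm_P_def norm_P_inv_def real_sqrt_mult power2_eq_square
          distrib_left mult_ac)
    finally show ?thesis .
  qed
  note ascent = ascent_with_tracking[of "\<lambda>\<theta>. constraint (qdual \<theta>)" \<theta> dual "K\<^sup>2 / \<mu>" M \<gamma> e "\<lambda>t. K * sqrt norm_P_inv * err t" \<rho> C2,
      OF dual_concave constraint_qdual_lipschitz M step error tracking rho C2_pos gamma(1) gamma_small]
  show "(\<lambda>t. norm (\<theta> (Suc t) - \<theta> t)) \<longlonglongrightarrow> 0" "(\<lambda>t. K * sqrt norm_P_inv * err t) \<longlonglongrightarrow> 0"
    "\<exists>m. \<forall>t. m \<le> dual (\<theta> t)"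
    by (fact ascent)+
qed

lemma q_tracks: "(\<lambda>t. norm (q t - qdual (\<theta> t))) \<longlonglongrightarrow> 0"
proof (rule tendsto_sandwich[OF _ _ tendsto_const])
  show "(\<lambda>t. (K * sqrt norm_P_inv * err t) / K) \<longlonglongrightarrow> 0"
    using tendsto_divide[OF errors_vanish tendsto_const[of K]] K_pos by simp
qed (use q_error K_pos in \<open>auto intro!: always_eventually\<close>)

text \<open>
  At a strictly feasible point every constraint term of the Lagrangian is nonpositive, and their sum
  cannot fall below a lower bound of the dual function minus the cost of that point. Each multiplier is therefore at most
  this difference divided by the (negative) constraint value.
\<close>

lemma theta_bounded: "bounded (range \<theta>)"
proof -
  obtain z where z: "z \<in> cbox qlo qhi" "\<And>i. fst (constraint z) $ i < 0" "\<And>i. snd (constraint z) $ i < 0"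
    using slater by blast
  obtain m where m: "\<And>t. m \<le> dual (\<theta> t)" using dual_bounded_below by blast
  have le: "m - obj z \<le> fst (constraint z) $ i * fst (\<theta> t) $ i + snd (constraint z) $ i * snd (\<theta> t) $ i" for i t
  proof -
    have "m \<le> obj z + constraint z \<bullet> \<theta> t"
      using m[of t] dual_le_lagrangian[OF z(1), of "\<theta> t"] by linarith
    also have "constraint z \<bullet> \<theta> t = (fst (constraint z) $ i * fst (\<theta> t) $ i + snd (constraint z) $ i * snd (\<theta> t) $ i)
        + (\<Sum>j\<in>UNIV - {i}. fst (constraint z) $ j * fst (\<theta> t) $ j + snd (constraint z) $ j * snd (\<theta> t) $ j)"
      unfolding inner_prod_sum by (rule sum.remove) auto
    also have "(\<Sum>j\<in>UNIV - {i}. fst (constraint z) $ j * fst (\<theta> t) $ j + snd (constraint z) $ j * snd (\<theta> t) $ j) \<le> 0"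
      using z theta_nonneg[of t]
      by (intro sum_nonpos add_nonpos_nonpos mult_nonpos_nonneg) (auto simp: nonneg_def less_imp_le)
    finally show ?thesis by simp
  qed
  have nonpos: "fst (constraint z) $ i * fst (\<theta> t) $ i \<le> 0" "snd (constraint z) $ i * snd (\<theta> t) $ i \<le> 0" for i t
    using z theta_nonneg[of t] by (auto simp: nonneg_def less_imp_le intro!: mult_nonpos_nonneg)
  have comp: "\<bar>fst (\<theta> t) $ i\<bar> \<le> (m - obj z) / fst (constraint z) $ i"
    "\<bar>snd (\<theta> t) $ i\<bar> \<le> (m - obj z) / snd (constraint z) $ i" for i t
  proof -
    have "m - obj z \<le> fst (constraint z) $ i * fst (\<theta> t) $ i" "m - obj z \<le> snd (constraint z) $ i * snd (\<theta> t) $ i"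
      using le[of i t] nonpos[where i = i and t = t] by linarith+
    then show "\<bar>fst (\<theta> t) $ i\<bar> \<le> (m - obj z) / fst (constraint z) $ i"
      "\<bar>snd (\<theta> t) $ i\<bar> \<le> (m - obj z) / snd (constraint z) $ i"
      using z(2)[of i] z(3)[of i] theta_nonneg[of t]
      by (auto simp: nonneg_def neg_le_divide_eq mult.commute)
  qed
  have "norm (\<theta> t) \<le> (\<Sum>i\<in>UNIV. (m - obj z) / fst (constraint z) $ i) + (\<Sum>i\<in>UNIV. (m - obj z) / snd (constraint z) $ i)" for t
  proof -
    have "norm (\<theta> t) \<le> norm (fst (\<theta> t)) + norm (snd (\<theta> t))"
      using norm_Pair_le[of "fst (\<theta> t)" "snd (\<theta> t)"] by simp
    also have "\<dots> \<le> (\<Sum>i\<in>UNIV. \<bar>fst (\<theta> t) $ i\<bar>) + (\<Sum>i\<in>UNIV. \<bar>snd (\<theta> t) $ i\<bar>)"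
      by (intro add_mono norm_le_l1_cart)
    also have "\<dots> \<le> (\<Sum>i\<in>UNIV. (m - obj z) / fst (constraint z) $ i) + (\<Sum>i\<in>UNIV. (m - obj z) / snd (constraint z) $ i)"
      by (intro add_mono sum_mono comp)
    finally show ?thesis .
  qed
  then show ?thesis unfolding bounded_iff by blast
qed

lemma qdual_continuous: "(f \<longlongrightarrow> \<psi>) F \<Longrightarrow> ((\<lambda>x. qdual (f x)) \<longlongrightarrow> qdual \<psi>) F"
proof (rule Lim_null_comparison[THEN LIM_zero_cancel])
  assume "(f \<longlongrightarrow> \<psi>) F"
  then have "((\<lambda>x. K / \<mu> * norm (f x - \<psi>)) \<longlongrightarrow> K / \<mu> * 0) F"
    by (intro tendsto_mult tendsto_const tendsto_norm_zero LIM_zero)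
  then show "((\<lambda>x. K / \<mu> * norm (f x - \<psi>)) \<longlongrightarrow> 0) F" by simp
  show "\<forall>\<^sub>F x in F. norm (qdual (f x) - qdual \<psi>) \<le> K / \<mu> * norm (f x - \<psi>)"
    using qdual_lipschitz mu_l by (auto intro!: always_eventually simp: field_simps)
qed

text \<open>
  Any limit point of the multipliers is a fixed point of the exact projected ascent step, because increments and
  errors vanish; fixed points are the multipliers satisfying complementary slackness and feasibility.
\<close>

lemma kkt_multiplier:
  obtains \<psi> where "nonneg \<psi>" "constraint (qdual \<psi>) \<bullet> \<psi> = 0"
    "\<And>i. fst (constraint (qdual \<psi>)) $ i \<le> 0 \<and> snd (constraint (qdual \<psi>)) $ i \<le> 0"
proof -
  obtain \<psi> k where k: "strict_mono (k :: nat \<Rightarrow> nat)" and lim: "(\<theta> \<circ> k) \<longlonglongrightarrow> \<psi>"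
    using bounded_imp_convergent_subsequence[OF theta_bounded] by blast
  have sub: "(\<lambda>t. h (k t)) \<longlonglongrightarrow> y" if "h \<longlonglongrightarrow> y" for h :: "nat \<Rightarrow> 'x::topological_space" and y
    using LIMSEQ_subseq_LIMSEQ[OF that k] by (simp add: o_def)
  have lim_t: "(\<lambda>t. \<theta> (k t)) \<longlonglongrightarrow> \<psi>" using lim by (simp add: o_def)
  have "(\<lambda>t. \<theta> (Suc (k t)) - \<theta> (k t)) \<longlonglongrightarrow> 0"
    using sub[OF increments_vanish] by (simp add: tendsto_norm_zero_iff)
  from tendsto_add[OF this lim_t] have lim_Suc: "(\<lambda>t. \<theta> (Suc (k t))) \<longlonglongrightarrow> \<psi>" by simp
  have "(\<lambda>t. q (k t) - qdual (\<theta> (k t))) \<longlonglongrightarrow> 0"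
    using sub[OF q_tracks] by (simp add: tendsto_norm_zero_iff)
  from tendsto_add[OF this qdual_continuous[OF lim_t]] have lim_q: "(\<lambda>t. q (k t)) \<longlonglongrightarrow> qdual \<psi>" by simp
  have lim_constraint: "(\<lambda>t. constraint (q (k t))) \<longlonglongrightarrow> constraint (qdual \<psi>)"
    unfolding constraint_def
    by (intro tendsto_intros bounded_linear.tendsto[OF matrix_vector_mul_bounded_linear] lim_q)
  have fp: "fst \<psi> $ i = max 0 (fst \<psi> $ i + \<gamma> * fst (constraint (qdual \<psi>)) $ i)"
    "snd \<psi> $ i = max 0 (snd \<psi> $ i + \<gamma> * snd (constraint (qdual \<psi>)) $ i)" for i
  proof -
    have "(\<lambda>t. fst (\<theta> (Suc (k t))) $ i) \<longlonglongrightarrow> max 0 (fst \<psi> $ i + \<gamma> * fst (constraint (qdual \<psi>)) $ i)"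
      unfolding theta_step by (intro tendsto_intros lim_t lim_constraint)
    moreover have "(\<lambda>t. fst (\<theta> (Suc (k t))) $ i) \<longlonglongrightarrow> fst \<psi> $ i" by (intro tendsto_intros lim_Suc)
    ultimately show "fst \<psi> $ i = max 0 (fst \<psi> $ i + \<gamma> * fst (constraint (qdual \<psi>)) $ i)"
      using LIMSEQ_unique by blast
    have "(\<lambda>t. snd (\<theta> (Suc (k t))) $ i) \<longlonglongrightarrow> max 0 (snd \<psi> $ i + \<gamma> * snd (constraint (qdual \<psi>)) $ i)"
      unfolding theta_step by (intro tendsto_intros lim_t lim_constraint)
    moreover have "(\<lambda>t. snd (\<theta> (Suc (k t))) $ i) \<longlonglongrightarrow> snd \<psi> $ i" by (intro tendsto_intros lim_Suc)
    ultimately show "snd \<psi> $ i = max 0 (snd \<psi> $ i + \<gamma> * snd (constraint (qdual \<psi>)) $ i)"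
      using LIMSEQ_unique by blast
  qed
  have slack: "0 \<le> x \<and> y * x = 0 \<and> y \<le> 0" if "x = max 0 (x + \<gamma> * y)" for x y :: real
  proof (cases "x + \<gamma> * y \<le> 0")
    case True
    then have "x = 0" using that by simp
    then show ?thesis using True gamma(1) by (simp add: mult_le_0_iff)
  next
    case False
    then have "\<gamma> * y = 0" using that by simp
    then show ?thesis using that False gamma(1) by simp
  qed
  show thesis
  proof (rule that[of \<psi>])
    show "nonneg \<psi>" unfolding nonneg_def using slack[OF fp(1)] slack[OF fp(2)] by blast
    show "constraint (qdual \<psi>) \<bullet> \<psi> = 0"
    proof -
      have "fst (constraint (qdual \<psi>)) $ i * fst \<psi> $ i = 0" "snd (constraint (qdual \<psi>)) $ i * snd \<psi> $ i = 0" for i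
        using slack[OF fp(1)] slack[OF fp(2)] by blast+
      then show ?thesis by (simp only: inner_prod_sum add_0 sum.neutral_const)
    qed
    show "fst (constraint (qdual \<psi>)) $ i \<le> 0 \<and> snd (constraint (qdual \<psi>)) $ i \<le> 0" for i
      using slack[OF fp(1)] slack[OF fp(2)] by blast
  qed
qed

lemma constraint_inner_nonpos:
  assumes "\<And>i. fst (constraint z) $ i \<le> 0 \<and> snd (constraint z) $ i \<le> 0" "nonneg \<psi>"
  shows "constraint z \<bullet> \<psi> \<le> 0"
  unfolding inner_prod_sum
  using assms by (intro sum_nonpos add_nonpos_nonpos mult_nonpos_nonneg) (auto simp: nonneg_def)

text \<open>
  By concavity the duality gap at \<open>\<theta> t\<close> is at most \<open>constraint (qdual (\<theta> t)) \<bullet> (\<psi> - \<theta> t)\<close> for the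
  Karush-Kuhn-Tucker multiplier \<open>\<psi>\<close>. The projection inequality bounds the part with \<open>\<psi> - \<theta> (t + 1)\<close> by
  the increment; the rest involves an increment or the tracking error as a factor.
\<close>

theorem optdist_converges:
  obtains qopt where "qopt \<in> cbox qlo qhi" "\<And>i. fst (constraint qopt) $ i \<le> 0 \<and> snd (constraint qopt) $ i \<le> 0"
    "\<And>z. z \<in> cbox qlo qhi \<Longrightarrow> (\<And>i. fst (constraint z) $ i \<le> 0 \<and> snd (constraint z) $ i \<le> 0) \<Longrightarrow>
      obj qopt + \<mu> / 2 * (norm (z - qopt))\<^sup>2 \<le> obj z"
    "q \<longlonglongrightarrow> qopt"
proof -
  obtain \<psi> where \<psi>: "nonneg \<psi>" "constraint (qdual \<psi>) \<bullet> \<psi> = 0"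
    "\<And>i. fst (constraint (qdual \<psi>)) $ i \<le> 0 \<and> snd (constraint (qdual \<psi>)) $ i \<le> 0"
    by (rule kkt_multiplier) blast
  define qopt where "qopt = qdual \<psi>"
  have dual_opt: "dual \<psi> = obj qopt" by (simp add: dual_def qopt_def \<psi>(2))
  have opt_in: "qopt \<in> cbox qlo qhi" unfolding qopt_def qdual_def by (rule qstar_in)
  have opt_feas: "fst (constraint qopt) $ i \<le> 0 \<and> snd (constraint qopt) $ i \<le> 0" for i
    unfolding qopt_def by (rule \<psi>(3))
  have optimal: "obj qopt + \<mu> / 2 * (norm (z - qopt))\<^sup>2 \<le> obj z"
    if "z \<in> cbox qlo qhi" "\<And>i. fst (constraint z) $ i \<le> 0 \<and> snd (constraint z) $ i \<le> 0" for z
    using lagrangian_growth[OF that(1), of \<psi>] constraint_inner_nonpos[OF that(2) \<psi>(1)]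
    by (simp add: dual_opt flip: qopt_def)
  obtain B where B: "\<And>t. norm (\<theta> t) \<le> B" using theta_bounded by (auto simp: bounded_iff)
  have "bounded (range (\<lambda>t. constraint (q t)))"
  proof -
    have "bounded (constraint ` cbox qlo qhi)"
    proof (intro compact_imp_bounded compact_continuous_image compact_cbox)
      show "continuous_on (cbox qlo qhi) constraint"
        unfolding constraint_def
        by (intro continuous_intros linear_continuous_on matrix_vector_mul_bounded_linear)
    qed
    then show ?thesis by (rule bounded_subset) (use q_in in auto)
  qed
  then obtain V where V: "\<And>t. norm (constraint (q t)) \<le> V" by (auto simp: bounded_iff)
  define R where "R = norm \<psi> + B"
  have R: "norm (\<psi> - \<theta> t) \<le> R" for t
    using norm_triangle_ineq4[of \<psi> "\<theta> t"] B[of t] by (simp add: R_def)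
  define \<delta> where "\<delta> t = norm (\<theta> (Suc t) - \<theta> t)" for t
  define b where "b t = K * norm (q t - qdual (\<theta> t))" for t
  define gap where "gap t = \<delta> t * R / \<gamma> + V * \<delta> t + b t * R" for t
  have gap: "dual \<psi> - dual (\<theta> t) \<le> gap t" for t
  proof -
    let ?d = "\<theta> (Suc t) - \<theta> t"
    have "dual \<psi> - dual (\<theta> t) \<le> constraint (qdual (\<theta> t)) \<bullet> (\<psi> - \<theta> t)"
      using dual_concave[of "\<theta> t" \<psi>] by (simp add: inner_diff_right)
    also have "\<dots> = constraint (q t) \<bullet> (\<psi> - \<theta> (Suc t)) + constraint (q t) \<bullet> ?d
        + (constraint (qdual (\<theta> t)) - constraint (q t)) \<bullet> (\<psi> - \<theta> t)"
      by (simp add: inner_diff_right inner_diff_left)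
    also have "constraint (q t) \<bullet> (\<psi> - \<theta> (Suc t)) \<le> \<delta> t * R / \<gamma>"
    proof -
      have "\<gamma> * (constraint (q t) \<bullet> (\<psi> - \<theta> (Suc t))) \<le> ?d \<bullet> (\<psi> - \<theta> (Suc t))"
        using theta_projection[OF \<psi>(1), of t] by (simp add: inner_diff_left inner_add_left)
      also have "\<dots> \<le> norm ?d * norm (\<psi> - \<theta> (Suc t))" by (rule norm_cauchy_schwarz)
      also have "\<dots> \<le> \<delta> t * R" unfolding \<delta>_def by (intro mult_left_mono R) simp
      finally show ?thesis using gamma(1) by (simp add: field_simps)
    qed
    also have "constraint (q t) \<bullet> ?d \<le> V * \<delta> t"
      using norm_cauchy_schwarz[of "constraint (q t)" ?d] mult_right_mono[OF V[of t], of "\<delta> t"]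
      by (simp add: \<delta>_def)
    also have "(constraint (qdual (\<theta> t)) - constraint (q t)) \<bullet> (\<psi> - \<theta> t) \<le> b t * R"
    proof -
      have "(constraint (qdual (\<theta> t)) - constraint (q t)) \<bullet> (\<psi> - \<theta> t)
          \<le> norm (constraint (qdual (\<theta> t)) - constraint (q t)) * norm (\<psi> - \<theta> t)" by (rule norm_cauchy_schwarz)
      also have "\<dots> \<le> b t * R"
        using constraint_lipschitz[of "qdual (\<theta> t)" "q t"] K_pos
        by (intro mult_mono R) (auto simp: b_def norm_minus_commute)
      finally show ?thesis .
    qed
    finally show ?thesis by (simp add: gap_def)
  qed
  have "gap \<longlonglongrightarrow> 0 * R / \<gamma> + V * 0 + K * 0 * R"
    unfolding gap_def \<delta>_def b_def
    by (intro tendsto_intros increments_vanish q_tracks) (use gamma(1) in simp)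
  then have gap_lim: "(\<lambda>t. sqrt (2 / \<mu> * gap t)) \<longlonglongrightarrow> sqrt (2 / \<mu> * 0)"
    by (intro tendsto_intros) simp
  have close: "norm (qopt - qdual (\<theta> t)) \<le> sqrt (2 / \<mu> * gap t)" for t
  proof (rule real_le_rsqrt)
    have "dual (\<theta> t) + \<mu> / 2 * (norm (qopt - qdual (\<theta> t)))\<^sup>2 \<le> obj qopt"
      using lagrangian_growth[OF opt_in, of "\<theta> t"] constraint_inner_nonpos[OF opt_feas theta_nonneg[of t]] by linarith
    then have "\<mu> / 2 * (norm (qopt - qdual (\<theta> t)))\<^sup>2 \<le> gap t"
      using gap[of t] dual_opt by linarith
    then show "(norm (qopt - qdual (\<theta> t)))\<^sup>2 \<le> 2 / \<mu> * gap t"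
      using mu_l by (simp add: field_simps)
  qed
  have "(\<lambda>t. norm (qopt - qdual (\<theta> t))) \<longlonglongrightarrow> 0"
    by (rule tendsto_sandwich[OF _ _ tendsto_const]) (use close gap_lim in \<open>auto intro!: always_eventually\<close>)
  then have "(\<lambda>t. qopt - qdual (\<theta> t)) \<longlonglongrightarrow> 0" by (simp add: tendsto_norm_zero_iff)
  moreover have "(\<lambda>t. q t - qdual (\<theta> t)) \<longlonglongrightarrow> 0" using q_tracks by (simp add: tendsto_norm_zero_iff)
  ultimately have "(\<lambda>t. (q t - qdual (\<theta> t)) - (qopt - qdual (\<theta> t)) + qopt) \<longlonglongrightarrow> 0 - 0 + qopt"
    by (intro tendsto_intros)
  then have "q \<longlonglongrightarrow> qopt" by simp
  with opt_in opt_feas optimal show thesis by (rule that)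
qed

end

theorem theorem2:
  fixes E :: "('n::finite option \<times> 'n option) set"
    and x :: "'n option \<times> 'n option \<Rightarrow> real"
    and X Y :: "real^'n^'n"
    and vpar :: "real^'n"
    and v :: "real^'n \<Rightarrow> real^'n"
    and d \<mu> l c \<alpha> \<beta> \<gamma> \<eta> a \<tau> \<nu> \<rho> C2 :: real
    and f :: "'n \<Rightarrow> real \<Rightarrow> real"
    and obj :: "real^'n \<Rightarrow> real"
    and grad :: "real^'n \<Rightarrow> real^'n"
    and vlo vhi qlo qhi :: "real^'n"
    and P0 P :: "real^('n + 'n)^('n + 'n)"
    and feasible :: "real^'n \<Rightarrow> bool"
    and qh q \<xi> lamu laml :: "nat \<Rightarrow> real^'n"
  \<comment> \<open>the network\<close>
  assumes tree: "rooted_tree None E"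
    and x_pos: "\<And>e. e \<in> E \<Longrightarrow> x e > 0"
    and X_eq: "X = reactance_matrix E x"
    and Y_eq: "Y = matrix_inv X"
    and v_eq: "\<And>z. v z = X *v z + vpar"
  \<comment> \<open>the optimization problem (P)\<close>
    and d_nonneg: "d \<ge> 0"
    and q_bounds: "\<And>i. qlo $ i < qhi $ i"
    and obj_eq: "\<And>z. obj z = (\<Sum>i\<in>UNIV. f i (z $ i)) + d / 2 * (z \<bullet> (X *v z))"
    and feasible_iff: "\<And>z. feasible z \<longleftrightarrow>
          (\<forall>i. vlo $ i \<le> v z $ i \<and> v z $ i \<le> vhi $ i \<and> qlo $ i \<le> z $ i \<and> z $ i \<le> qhi $ i)"
    and mu_l: "0 < \<mu>" "\<mu> \<le> l"
    and obj_grad: "\<And>z. GDERIV obj z :> grad z"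
    and strongly_convex: "\<And>z z'. \<mu> * (norm (z - z'))\<^sup>2 \<le> (z - z') \<bullet> (grad z - grad z')"
    and smooth: "\<And>z z'. (z - z') \<bullet> (grad z - grad z') \<le> l * (norm (z - z'))\<^sup>2"
    and slater: "\<exists>z. \<forall>i. vlo $ i < v z $ i \<and> v z $ i < vhi $ i \<and> qlo $ i \<le> z $ i \<and> z $ i \<le> qhi $ i"
  \<comment> \<open>the algorithm\<close>
    and lam_init: "\<And>i. lamu 0 $ i \<ge> 0" "\<And>i. laml 0 $ i \<ge> 0"
    and q_proj: "\<And>t i. q t $ i = closest_point {qlo $ i..qhi $ i} (qh t $ i)"
    and qh_step: "\<And>t i. qh (Suc t) $ i = qh t $ i - \<alpha> *
          (lamu t $ i - laml t $ i + d * qh t $ i +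
           (\<Sum>j\<in>nbrs E i. Y $ i $ j *
              (deriv (f j) (qh t $ j) + ST (c * qlo $ j) (c * qhi $ j) (\<xi> t $ j + c * qh t $ j))))"
    and xi_step: "\<And>t i. \<xi> (Suc t) $ i = \<xi> t $ i + \<beta> *
          ((ST (c * qlo $ i) (c * qhi $ i) (\<xi> t $ i + c * qh t $ i) - \<xi> t $ i) / c)"
    and lamu_step: "\<And>t i. lamu (Suc t) $ i =
          closest_point {0..} (lamu t $ i + \<gamma> * (v (q t) $ i - vhi $ i))"
    and laml_step: "\<And>t i. laml (Suc t) $ i =
          closest_point {0..} (laml t $ i + \<gamma> * (vlo $ i - v (q t) $ i))"
  \<comment> \<open>the constants and the step size conditions\<close>
    and c_pos: "c > 0"
    and eta_pos: "\<eta> > 0"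
    and a_eq: "a = a_const \<mu> l c \<eta> Y"
    and tau_eq: "\<tau> = tau_const \<mu> l c \<eta> Y"
    and nu_eq: "\<nu> = nu_const l c \<eta> Y"
    and P0_eq: "P0 = P0_matrix \<eta> a Y"
    and P_eq: "P = P_matrix \<eta> a Y"
    and C2_eq: "C2 = C2_const \<mu> l X P"
    and alpha: "0 < \<alpha>" "\<alpha> < min (1 / \<tau>) (\<tau> / (2 * \<nu>\<^sup>2 * cond_num P0))"
    and beta: "\<beta> = \<eta> * \<alpha>"
    and rho_eq: "\<rho> = exp (- \<tau> * \<alpha> / 2) + \<alpha>\<^sup>2 * \<nu>\<^sup>2 * cond_num P0 / 2"
    and gamma: "0 < \<gamma>"
      "\<gamma> < min (\<mu> / (2 * (spectral_norm (X_tilde X))\<^sup>2))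
               ((spectral_norm (X_tilde X))\<^sup>2 * (1 - \<rho>)\<^sup>2 / (2 * \<mu> * C2\<^sup>2))"
  shows "\<rho> < 1 \<and>
    (\<exists>qopt. is_arg_min obj feasible qopt \<and>
            (\<forall>z. is_arg_min obj feasible z \<longrightarrow> z = qopt) \<and>
            q \<longlonglongrightarrow> qopt)"
proof -
  have X_sym: "transpose X = X" by (simp add: X_eq transpose_reactance_matrix)
  have X_pos: "0 < w \<bullet> (X *v w)" if "w \<noteq> 0" for w
    unfolding X_eq by (rule reactance_matrix_pos_def[OF tree x_pos that])
  have YX: "Y ** X = mat 1" unfolding Y_eq by (rule posdef_invertible(2)[OF X_pos])
  have X_inner: "(X *v y) \<bullet> z = y \<bullet> (X *v z)" for y z by (rule symmetric_matrix_inner[OF X_sym])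
  \<comment> \<open>the neighbour sums of the algorithm are products with \<open>Y\<close>\<close>
  have sparse: "(\<Sum>j\<in>nbrs E i. Y $ i $ j * w j) = (Y *v (\<chi> j. w j)) $ i" for i and w :: "'n \<Rightarrow> real"
  proof -
    have "Y $ i $ j = 0" if "j \<notin> nbrs E i" for j
      using inverse_reactance_matrix_sparse[OF tree x_pos YX[unfolded X_eq] that] .
    then have "(\<Sum>j\<in>nbrs E i. Y $ i $ j * w j) = (\<Sum>j\<in>UNIV. Y $ i $ j * w j)"
      by (intro sum.mono_neutral_left) auto
    then show ?thesis by (simp add: matrix_vector_mult_def)
  qed
  interpret grid_problem X Y \<mu> l c \<eta> a obj grad qlo qhi vpar vlo vhi
    by unfold_locales (fact X_sym X_pos Y_eq mu_l c_pos eta_pos a_eq obj_grad strongly_convex smooth q_bounds)+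
  define \<theta> where "\<theta> t = (lamu t, laml t)" for t
  have constraint_v: "constraint z = (v z - vhi, vlo - v z)" for z by (simp add: constraint_def v_eq)
  interpret optdist_run X Y \<mu> l c \<eta> a obj grad qlo qhi vpar vlo vhi \<alpha> \<gamma> \<rho> qh q \<xi> \<theta>
  proof unfold_locales
    show "0 < \<alpha>" "\<alpha> < min (1 / tau_const \<mu> l c \<eta> Y)
        (tau_const \<mu> l c \<eta> Y / (2 * (nu_const l c \<eta> Y)\<^sup>2 * cond_num (P0_matrix \<eta> a Y)))"
      using alpha unfolding tau_eq nu_eq P0_eq by auto
    show "\<rho> = exp (- tau_const \<mu> l c \<eta> Y * \<alpha> / 2)
        + \<alpha>\<^sup>2 * (nu_const l c \<eta> Y)\<^sup>2 * cond_num (P0_matrix \<eta> a Y) / 2"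
      unfolding rho_eq tau_eq nu_eq P0_eq ..
    show "0 < \<gamma>" "\<gamma> < min (\<mu> / (2 * (spectral_norm (X_tilde X))\<^sup>2))
        ((spectral_norm (X_tilde X))\<^sup>2 * (1 - \<rho>)\<^sup>2 / (2 * \<mu> * (C2_const \<mu> l X (P_matrix \<eta> a Y))\<^sup>2))"
      using gamma unfolding C2_eq P_eq by auto
    show "nonneg (\<theta> 0)" using lam_init by (simp add: nonneg_def \<theta>_def)
    show "q t $ i = closest_point {qlo $ i..qhi $ i} (qh t $ i)" for t i by (rule q_proj)
    show "fst (\<theta> (Suc t)) $ i = max 0 (fst (\<theta> t) $ i + \<gamma> * fst (constraint (q t)) $ i)"
      "snd (\<theta> (Suc t)) $ i = max 0 (snd (\<theta> t) $ i + \<gamma> * snd (constraint (q t)) $ i)" for t i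
      by (simp_all add: \<theta>_def constraint_v lamu_step laml_step closest_point_halfline)
    show "\<xi> (Suc t) = \<xi> t + (\<eta> * \<alpha> / c) *\<^sub>R (soft_threshold (\<xi> t) (qh t) - \<xi> t)" for t
      by (simp add: vec_eq_iff xi_step soft_threshold_def beta)
    show "qh (Suc t) = qh t - \<alpha> *\<^sub>R (Y *v (grad (qh t) + X *v (fst (\<theta> t) - snd (\<theta> t)) + soft_threshold (\<xi> t) (qh t)))" for t
    proof -
      \<comment> \<open>the quadratic cost is split off from the gradient: as \<open>Y X = 1\<close>, it becomes the local term \<open>d q\<close>\<close>
      define w where "w = grad (qh t) - d *\<^sub>R (X *v qh t) + soft_threshold (\<xi> t) (qh t)"
      have "Y *v (grad (qh t) + X *v (lamu t - laml t) + soft_threshold (\<xi> t) (qh t))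
          = Y *v (w + X *v (lamu t - laml t + d *\<^sub>R qh t))"
        by (simp add: w_def matrix_vector_right_distrib matrix_vector_mult_scaleR)
      also have "\<dots> = Y *v w + (lamu t - laml t + d *\<^sub>R qh t)"
        by (simp only: matrix_vector_right_distrib[of Y] YX_vec)
      finally have Yw: "Y *v (grad (qh t) + X *v (lamu t - laml t) + soft_threshold (\<xi> t) (qh t))
          = Y *v w + (lamu t - laml t + d *\<^sub>R qh t)" .
      have "(\<chi> j. deriv (f j) (qh t $ j) + ST (c * qlo $ j) (c * qhi $ j) (\<xi> t $ j + c * qh t $ j)) = w"
        by (simp add: w_def vec_eq_iff soft_threshold_def
            separable_quadratic_partial_derivative[OF obj_eq X_inner obj_grad])
      then show ?thesis
        by (simp add: vec_eq_iff qh_step sparse \<theta>_def Yw)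
    qed
    show "\<exists>z\<in>cbox qlo qhi. \<forall>i. fst (constraint z) $ i < 0 \<and> snd (constraint z) $ i < 0"
      using slater by (auto simp: constraint_v mem_box_cart)
  qed
  have feasible: "feasible z \<longleftrightarrow> z \<in> cbox qlo qhi \<and> (\<forall>i. fst (constraint z) $ i \<le> 0 \<and> snd (constraint z) $ i \<le> 0)" for z
    unfolding feasible_iff by (auto simp: constraint_v mem_box_cart)
  obtain qopt where opt_in: "qopt \<in> cbox qlo qhi"
    and opt_constraint: "\<And>i. fst (constraint qopt) $ i \<le> 0 \<and> snd (constraint qopt) $ i \<le> 0"
    and opt_min: "\<And>z. z \<in> cbox qlo qhi \<Longrightarrow> (\<And>i. fst (constraint z) $ i \<le> 0 \<and> snd (constraint z) $ i \<le> 0) \<Longrightarrow>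
      obj qopt + \<mu> / 2 * (norm (z - qopt))\<^sup>2 \<le> obj z"
    and lim: "q \<longlonglongrightarrow> qopt"
    by (rule optdist_converges) blast
  have feas: "feasible qopt" using opt_in opt_constraint by (simp add: feasible)
  have opt: "obj qopt + \<mu> / 2 * (norm (z - qopt))\<^sup>2 \<le> obj z" if "feasible z" for z
    using that by (intro opt_min) (simp_all add: feasible)
  have le: "obj qopt \<le> obj z" if "feasible z" for z
  proof -
    have "0 \<le> \<mu> / 2 * (norm (z - qopt))\<^sup>2" using mu_l by simp
    then show ?thesis using opt[OF that] by linarith
  qed
  have arg_min: "is_arg_min obj feasible qopt"
    using feas le by (auto simp: is_arg_min_def not_less)
  have unique: "z = qopt" if "is_arg_min obj feasible z" for z
  proof -
    have z: "feasible z" "obj z \<le> obj qopt" using that feas by (auto simp: is_arg_min_def not_less)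
    then have "\<mu> / 2 * (norm (z - qopt))\<^sup>2 \<le> 0" using opt[OF z(1)] by linarith
    then show ?thesis using mu_l by (simp add: mult_le_0_iff)
  qed
  show ?thesis using rho arg_min unique lim by blast
qed

end
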